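(* Let $(X,\|\cdot\|)$ be a Banach space, let $m\in\mathbb{N}$, $m\ge1$, and let $f:\mathbb{R}_+\to X$ be a locally integrable function such that its $m$-th weak derivative satisfies $f^{(m)}\in L^p(\mathbb{R}_+;X)$ for some $1<p\le\infty$. Let $M,K:\mathbb{R}_+\to[2,\infty)$ be continuous and increasing functions satisfying (i) $K(s)\ge\max\{s,M(s)\}$ for all $s>1$; (ii) there is $\varepsilon\in(0,1)$ such that $K(s)=O\left(e^{e^{(sM(s))^{1-\varepsilon}}}\right)$ as $s\to\infty$. Assume that the Fourier transform $F$ of $f$ is of class $C^\infty$ and that its derivatives satisfy, for all $j\in\mathbb{N}_0$, $$\|F^{(j)}(s)\|\le j!\,K(|s|)\,M(|s|)^j\quad\text{for all } s\in\mathbb{R}.$$ Then there exists a constant $c_1>0$ such that $$\left(t\mapsto\|w_{M_K}(c_1t)^m f(t)\|\right)\in L^p(\mathbb{R}_+),$$ where $M_K(s):=M(s)\log(K(s))$.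
   Context: $\mathbb{R}_+=[0,\infty)$, $\mathbb{N}_0=\{0,1,2,\dots\}$. "Increasing" is meant in the non-strict sense. For a continuous increasing function $N$ on $\mathbb{R}_+$ (here used with $N=M_K$, which is unbounded), $N^{-1}(t)=\sup\{s\ge0:N(s)=t\}$ is its right-continuous right-inverse, and $w_N(t)=N^{-1}(t)$ if $t\ge N(1)$, $w_N(t)=1$ otherwise. The function $f$ is extended by zero to the negative real numbers, and its Fourier transform $F$, formally $F(s)=\int_{\mathbb{R}}e^{-ist}f(t)\,dt$, is understood in the sense of tempered distributions; this is well defined since $f\in L^1_{loc}$ and $f^{(m)}\in L^p$ imply that $f$ is polynomially bounded. *)

theory Defs
  imports "HOL-Analysis.Analysis" "HOL-Library.Landau_Symbols"
begin

section \<open>Complex Banach spaces\<close>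

class complex_banach = banach +
  fixes scaleC :: "complex \<Rightarrow> 'a \<Rightarrow> 'a"  (infixr \<open>*\<^sub>C\<close> 75)
  assumes scaleC_add_right: "c *\<^sub>C (x + y) = c *\<^sub>C x + c *\<^sub>C y"
    and scaleC_add_left: "(c + d) *\<^sub>C x = c *\<^sub>C x + d *\<^sub>C x"
    and scaleC_scaleC: "c *\<^sub>C (d *\<^sub>C x) = (c * d) *\<^sub>C x"
    and scaleC_of_real: "of_real r *\<^sub>C x = r *\<^sub>R x"
    and norm_scaleC: "norm (c *\<^sub>C x) = cmod c * norm x"

instantiation complex :: complex_banach
begin

definition scaleC_complex :: "complex \<Rightarrow> complex \<Rightarrow> complex" where
  "scaleC_complex c x = c * x"

instance
  by standard (simp_all add: scaleC_complex_def algebra_simps norm_mult scaleR_conv_of_real)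

end

section \<open>Bochner integration in arbitrary Banach spaces\<close>

text \<open>
  The library predicate \<open>has_bochner_integral\<close> is restricted to second countable target spaces.
  The following is the same definition without that restriction. The approximation by simple
  functions forces \<open>f\<close> to be essentially separably valued, so on complete measure spaces
  (all uses below are over Lebesgue measure) this is the usual Bochner integral.
\<close>

definition has_bochner_int :: "'a measure \<Rightarrow> ('a \<Rightarrow> 'b::real_normed_vector) \<Rightarrow> 'b \<Rightarrow> bool" where
  "has_bochner_int M f x \<longleftrightarrow>
     f \<in> borel_measurable M \<and>
     (\<exists>s. (\<forall>i. Bochner_Integration.simple_bochner_integrable M (s i)) \<and>
          (\<lambda>i. \<integral>\<^sup>+ y. ennreal (norm (f y - s i y)) \<partial>M) \<longlonglongrightarrow> 0 \<and>
          (\<lambda>i. Bochner_Integration.simple_bochner_integral M (s i)) \<longlonglongrightarrow> x)"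

lemma has_bochner_int_eq_library:
  fixes f :: "'a \<Rightarrow> 'b::{real_normed_vector, second_countable_topology}"
  shows "has_bochner_int M f x \<longleftrightarrow> has_bochner_integral M f x"
  unfolding has_bochner_int_def has_bochner_integral.simps by auto

definition bochner_integrable :: "'a measure \<Rightarrow> ('a \<Rightarrow> 'b::real_normed_vector) \<Rightarrow> bool" where
  "bochner_integrable M f \<longleftrightarrow> (\<exists>x. has_bochner_int M f x)"

definition bochner_int :: "'a measure \<Rightarrow> ('a \<Rightarrow> 'b::real_normed_vector) \<Rightarrow> 'b" where
  "bochner_int M f = (if bochner_integrable M f then THE x. has_bochner_int M f x else 0)"

definition loc_integrable :: "real set \<Rightarrow> (real \<Rightarrow> 'b::real_normed_vector) \<Rightarrow> bool" where
  "loc_integrable S f \<longleftrightarrow>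
     (\<forall>C. compact C \<and> C \<subseteq> S \<longrightarrow> bochner_integrable (lebesgue_on C) f)"

definition strongly_measurable :: "'a measure \<Rightarrow> ('a \<Rightarrow> 'b::real_normed_vector) \<Rightarrow> bool" where
  "strongly_measurable M f \<longleftrightarrow>
     (\<exists>s. (\<forall>i::nat. simple_function M (s i)) \<and> (AE x in M. (\<lambda>i. s i x) \<longlonglongrightarrow> f x))"

definition in_Lp :: "ennreal \<Rightarrow> 'a measure \<Rightarrow> ('a \<Rightarrow> 'b::real_normed_vector) \<Rightarrow> bool" where
  "in_Lp p M f \<longleftrightarrow> strongly_measurable M f \<and>
     (if p = \<infinity> then \<exists>C. AE x in M. norm (f x) \<le> C
      else (\<integral>\<^sup>+ x. ennreal (norm (f x) powr enn2real p) \<partial>M) < \<infinity>)"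

section \<open>Smooth functions, test functions and weak derivatives\<close>

definition nderiv :: "nat \<Rightarrow> (real \<Rightarrow> 'b::real_normed_vector) \<Rightarrow> real \<Rightarrow> 'b" where
  "nderiv k f = ((\<lambda>g t. vector_derivative g (at t)) ^^ k) f"

definition smooth :: "(real \<Rightarrow> 'b::real_normed_vector) \<Rightarrow> bool" where
  "smooth f \<longleftrightarrow> (\<forall>k t. nderiv k f differentiable (at t))"

definition test_function :: "real set \<Rightarrow> (real \<Rightarrow> complex) \<Rightarrow> bool" where
  "test_function U \<phi> \<longleftrightarrow>
     smooth \<phi> \<and> compact (closure {t. \<phi> t \<noteq> 0}) \<and> closure {t. \<phi> t \<noteq> 0} \<subseteq> U"

definition weak_derivative ::
    "real set \<Rightarrow> nat \<Rightarrow> (real \<Rightarrow> 'b::complex_banach) \<Rightarrow> (real \<Rightarrow> 'b) \<Rightarrow> bool" where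
  "weak_derivative U m f g \<longleftrightarrow>
     loc_integrable U f \<and> loc_integrable U g \<and>
     (\<forall>\<phi>. test_function U \<phi> \<longrightarrow>
        bochner_int (lebesgue_on U) (\<lambda>t. nderiv m \<phi> t *\<^sub>C f t) =
        (-1) ^ m *\<^sub>R bochner_int (lebesgue_on U) (\<lambda>t. \<phi> t *\<^sub>C g t))"

section \<open>Distributional Fourier transform\<close>

definition zero_ext :: "(real \<Rightarrow> 'b::zero) \<Rightarrow> real \<Rightarrow> 'b" where
  "zero_ext f t = (if 0 \<le> t then f t else 0)"

definition regular_distr :: "(real \<Rightarrow> 'b::complex_banach) \<Rightarrow> (real \<Rightarrow> complex) \<Rightarrow> 'b" where
  "regular_distr f \<phi> = bochner_int lebesgue (\<lambda>t. \<phi> t *\<^sub>C f t)"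

definition fourier :: "(real \<Rightarrow> complex) \<Rightarrow> real \<Rightarrow> complex" where
  "fourier \<phi> s = (LINT t|lebesgue. exp (- \<i> * of_real s * of_real t) * \<phi> t)"

definition fourier_distr :: "((real \<Rightarrow> complex) \<Rightarrow> 'b) \<Rightarrow> (real \<Rightarrow> complex) \<Rightarrow> 'b" where
  "fourier_distr T \<phi> = T (fourier \<phi>)"

text \<open>
  A tempered distribution \<open>T\<close> is (given by) the function \<open>F\<close>. As usual this is tested on compactly
  supported smooth functions, which are dense in the Schwartz space: \<open>F\<close> is not assumed to be of
  polynomial growth, so \<open>\<phi> F\<close> need not be integrable for a general Schwartz function \<open>\<phi>\<close>.
\<close>

definition represented_by ::
    "((real \<Rightarrow> complex) \<Rightarrow> 'b::complex_banach) \<Rightarrow> (real \<Rightarrow> 'b) \<Rightarrow> bool" where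
  "represented_by T F \<longleftrightarrow>
     loc_integrable UNIV F \<and> (\<forall>\<phi>. test_function UNIV \<phi> \<longrightarrow> T \<phi> = regular_distr F \<phi>)"

text \<open>
  For polynomially bounded \<open>f\<close> on the half-line, \<open>regular_distr (zero_ext f)\<close> is a tempered
  distribution, and all integrals involved converge, since the Fourier transform of a test
  function is a Schwartz function.
\<close>

definition is_fourier_transform :: "(real \<Rightarrow> 'b::complex_banach) \<Rightarrow> (real \<Rightarrow> 'b) \<Rightarrow> bool" where
  "is_fourier_transform f F \<longleftrightarrow> represented_by (fourier_distr (regular_distr (zero_ext f))) F"

section \<open>The weight\<close>

definition right_inverse :: "(real \<Rightarrow> real) \<Rightarrow> real \<Rightarrow> real" where
  "right_inverse N t = Sup {s. 0 \<le> s \<and> N s = t}"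

definition weight :: "(real \<Rightarrow> real) \<Rightarrow> real \<Rightarrow> real" where
  "weight N t = (if N 1 \<le> t then right_inverse N t else 1)"

definition M_log :: "(real \<Rightarrow> real) \<Rightarrow> (real \<Rightarrow> real) \<Rightarrow> real \<Rightarrow> real" where
  "M_log M K s = M s * ln (K s)"

end

theory Submission
  imports Defs "HOL-Computational_Algebra.Polynomial" "HOL-Probability.Sinc_Integral"
begin

text \<open>
  The weight grows like the inverse of \<open>M_log M K\<close>, so the claim says that \<open>R ^ m * norm (f t)\<close> is in
  \<open>L\<^sup>p\<close> when the frequency scale \<open>R\<close> is tied to \<open>t\<close> by \<open>M R * ln (K R) = c * t\<close>. At a fixed \<open>t\<close> the
  function is split at the frequency \<open>R\<close>. Low frequencies are small because the transform \<open>F\<close> is smooth: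
  decay in \<open>t\<close> comes from integrating by parts. High frequencies are small because \<open>m\<close> derivatives of
  \<open>f\<close> exist, which gains the factor \<open>R ^ (- m)\<close>.

  The splitting uses kernels \<open>kernel N \<ge> 0\<close> which are the Fourier transforms of cutoff functions
  \<open>cutoff N\<close> supported in \<open>[-2, 2]\<close>. For \<open>r = R / 2\<close>, integrating the \<open>m\<close>-th difference of \<open>f\<close> at \<open>t\<close>
  with step \<open>v / r\<close> against \<open>kernel N v\<close> gives \<open>f t\<close> times the mass of the kernel, up to sign,
  plus a combination of the integrals of \<open>kernel N v\<close> against \<open>f (t + k * v / r)\<close> with \<open>1 \<le> k \<le> m\<close>. The latter
  see frequencies up to \<open>R\<close> only.

  These low frequency terms are estimated by \<open>N\<close> integrations by parts (\<open>low_frequency\<close>). A fixed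
  cutoff would lose too much when differentiated \<open>N\<close> times, so the cutoff depends on \<open>N\<close>: it is a fixed
  smooth function averaged \<open>N\<close> times over intervals of length \<open>1 / N\<close> in both directions. Each
  average absorbs one derivative at the cost of a factor \<open>2 * N\<close> (\<open>norm_nderiv_cutoff\<close>), and yet the
  kernels keep a uniform decay and a mass bounded from below (\<open>kernel_decay\<close>, \<open>kernel_mass\<close>).
  With \<open>N\<close> of the order of \<open>t / M R\<close> the outcome is a power of \<open>1 / K R\<close> (\<open>low_frequency_choice\<close>), and since
  \<open>K R\<close> dominates both \<open>R\<close> and \<open>M R\<close>, this is at most a constant times \<open>1 / t ^ 2\<close>.

  The difference term is controlled by the weak derivative: the \<open>m\<close>-th difference with step \<open>\<sigma>\<close> is bounded by
  \<open>\<bar>\<sigma>\<bar> ^ (m - 1)\<close> times the integral of the derivative near \<open>t\<close> (\<open>difference_inequality\<close>). Put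
  together, \<open>R ^ m * norm (f t)\<close> is at most an average of the derivative around \<open>t\<close> at scale \<open>1 / R\<close>
  plus \<open>O(1 / t ^ 2)\<close> (\<open>pointwise_estimate\<close>, \<open>block_estimate\<close>). By taking \<open>R\<close> constant on each dyadic
  block of \<open>t\<close>, the averages become translation invariant on the block. Fubini then bounds their
  \<open>L\<^sup>p\<close> norms on the block by that of the derivative on a slightly larger block, and no maximal function
  is involved; summing over the blocks gives the theorem (\<open>Lp_from_windows\<close>).

  All of this is done for scalar functions. A Banach space valued \<open>f\<close> is essentially separably valued,
  so countably many functionals of norm at most one recover its norm almost everywhere
  (\<open>norm_bound_from_functionals\<close>), and the scalar estimates are uniform in the functional.
\<close>

section \<open>Calculus of smooth functions\<close>

lemma nderiv_0 [simp]: "nderiv 0 f = f"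
  by (simp add: nderiv_def)

lemma nderiv_Suc: "nderiv (Suc k) f = (\<lambda>t. vector_derivative (nderiv k f) (at t))"
  by (simp add: nderiv_def)

lemma smooth_has_derivative:
  "smooth f \<Longrightarrow> (nderiv k f has_vector_derivative nderiv (Suc k) f t) (at t)"
  unfolding smooth_def nderiv_Suc by (simp add: vector_derivative_works)

lemma smooth_chain:
  assumes "\<And>k t. (d k has_vector_derivative d (Suc k) t) (at t)"
  shows "smooth (d 0)" and "nderiv k (d 0) = d k"
proof -
  have *: "nderiv k (d 0) = d k" for k
    by (induction k) (simp, force simp: nderiv_Suc intro!: vector_derivative_at assms)
  show "smooth (d 0)"
    unfolding smooth_def * using assms differentiableI_vector by blast
  show "nderiv k (d 0) = d k" by (rule *)
qed

text \<open>A function is smooth, with known derivatives, as soon as a candidate chain of derivatives is exhibited.\<close>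

lemma smooth_chainI:
  assumes "d 0 = f" "\<And>k t. (d k has_vector_derivative d (Suc k) t) (at t)"
  shows "smooth f \<and> (\<forall>k. nderiv k f = d k)"
  using smooth_chain[of d, OF assms(2)] assms(1) by simp

lemma nderiv_nderiv: "nderiv k (nderiv j f) = nderiv (k + j) f"
  by (simp add: nderiv_def funpow_add)

lemma smooth_nderiv: "smooth f \<Longrightarrow> smooth (nderiv j f)"
  by (simp add: smooth_def nderiv_nderiv)

lemma smooth_continuous: "smooth f \<Longrightarrow> continuous_on S (nderiv k f)"
  by (rule continuous_at_imp_continuous_on, rule ballI, rule has_vector_derivative_continuous, rule smooth_has_derivative)

lemma smooth_continuous0: "smooth f \<Longrightarrow> continuous_on S f"
  using smooth_continuous[of f S 0] by simp

lemma smooth_bounded_linear: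
  assumes "smooth f" "bounded_linear T"
  shows "smooth (\<lambda>s. T (f s)) \<and> (\<forall>k. nderiv k (\<lambda>s. T (f s)) = (\<lambda>s. T (nderiv k f s)))"
  by (rule smooth_chainI)
     (auto intro!: bounded_linear.has_vector_derivative[OF assms(2)] smooth_has_derivative assms(1))

lemma smooth_affine:
  assumes "smooth f"
  shows "smooth (\<lambda>s. f (a * s + b)) \<and>
    (\<forall>k. nderiv k (\<lambda>s. f (a * s + b)) = (\<lambda>s. a ^ k *\<^sub>R nderiv k f (a * s + b)))"
proof (rule smooth_chainI)
  fix k t
  have "((\<lambda>s. nderiv k f (a * s + b)) has_vector_derivative a *\<^sub>R nderiv (Suc k) f (a * t + b)) (at t)"
  proof -
    have "((\<lambda>s. a * s + b) has_vector_derivative a) (at t)"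
      by (auto intro!: derivative_eq_intros)
    from vector_diff_chain_at[OF this smooth_has_derivative[OF assms, of k]]
    show ?thesis by (simp add: o_def)
  qed
  then have "((\<lambda>s. a ^ k *\<^sub>R nderiv k f (a * s + b)) has_vector_derivative
      a ^ k *\<^sub>R (a *\<^sub>R nderiv (Suc k) f (a * t + b))) (at t)"
    by (rule has_vector_derivative_scaleR[OF DERIV_const, THEN has_vector_derivative_eq_rhs]) simp
  then show "((\<lambda>s. a ^ k *\<^sub>R nderiv k f (a * s + b)) has_vector_derivative
      a ^ Suc k *\<^sub>R nderiv (Suc k) f (a * t + b)) (at t)"
    by (simp add: mult.commute)
qed simp

lemma smooth_exp: "smooth (\<lambda>s::real. exp (c * of_real s) :: complex)"
  and nderiv_exp: "nderiv k (\<lambda>s::real. exp (c * of_real s) :: complex) = (\<lambda>s. c ^ k * exp (c * of_real s))"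
proof -
  have "((\<lambda>s::real. c ^ k * exp (c * of_real s)) has_vector_derivative c ^ Suc k * exp (c * of_real t)) (at t)" for k t
    by (rule has_vector_derivative_eq_rhs, rule has_vector_derivative_mult_right,
        rule field_vector_diff_chain_at[of "\<lambda>s. c * of_real s" c t exp, unfolded o_def])
       (auto intro!: derivative_eq_intros)
  note * = smooth_chainI[of "\<lambda>k s. c ^ k * exp (c * of_real s)" "\<lambda>s. exp (c * of_real s)", OF _ this]
  show "smooth (\<lambda>s::real. exp (c * of_real s) :: complex)"
    by (rule *[THEN conjunct1]) simp
  show "nderiv k (\<lambda>s::real. exp (c * of_real s) :: complex) = (\<lambda>s. c ^ k * exp (c * of_real s))"
    by (rule *[THEN conjunct2, THEN spec]) simp
qed

lemma binomial_Suc_sum: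
  fixes f :: "nat \<Rightarrow> nat \<Rightarrow> 'a::comm_semiring_1"
  shows "(\<Sum>k\<le>n. of_nat (n choose k) * (f (Suc k) (n - k) + f k (Suc n - k))) =
    (\<Sum>k\<le>Suc n. of_nat (Suc n choose k) * f k (Suc n - k))"
proof -
  have "(\<Sum>k\<le>Suc n. of_nat (Suc n choose k) * f k (Suc n - k)) =
      f 0 (Suc n) + (\<Sum>k\<le>n. of_nat (Suc n choose Suc k) * f (Suc k) (n - k))"
    by (simp only: sum.atMost_Suc_shift) simp
  also have "(\<Sum>k\<le>n. of_nat (Suc n choose Suc k) * f (Suc k) (n - k)) =
      (\<Sum>k\<le>n. of_nat (n choose k) * f (Suc k) (n - k)) + (\<Sum>k\<le>n. of_nat (n choose Suc k) * f (Suc k) (n - k))"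
    by (simp add: sum.distrib[symmetric] distrib_right)
  also have "f 0 (Suc n) + (\<dots>) = (\<Sum>k\<le>n. of_nat (n choose k) * f (Suc k) (n - k)) +
      (f 0 (Suc n) + (\<Sum>k\<le>n. of_nat (n choose Suc k) * f (Suc k) (n - k)))"
    by (simp add: ac_simps)
  also have "f 0 (Suc n) + (\<Sum>k\<le>n. of_nat (n choose Suc k) * f (Suc k) (n - k)) =
      (\<Sum>k\<le>Suc n. of_nat (n choose k) * f k (Suc n - k))"
    by (simp only: sum.atMost_Suc_shift) simp
  also have "\<dots> = (\<Sum>k\<le>n. of_nat (n choose k) * f k (Suc n - k))"
    by (simp add: binomial_eq_0)
  finally show ?thesis
    by (simp add: sum.distrib distrib_left)
qed

lemma smooth_mult:
  fixes f g :: "real \<Rightarrow> complex"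
  assumes "smooth f" "smooth g"
  shows "smooth (\<lambda>s. f s * g s) \<and> (\<forall>n. nderiv n (\<lambda>s. f s * g s) =
    (\<lambda>s. \<Sum>k\<le>n. of_nat (n choose k) * (nderiv k f s * nderiv (n - k) g s)))"
proof (rule smooth_chainI)
  fix n t
  have "((\<lambda>s. \<Sum>k\<le>n. of_nat (n choose k) * (nderiv k f s * nderiv (n - k) g s)) has_vector_derivative
     (\<Sum>k\<le>n. of_nat (n choose k) * (nderiv k f t * nderiv (Suc (n - k)) g t + nderiv (Suc k) f t * nderiv (n - k) g t))) (at t)"
    by (intro has_vector_derivative_sum has_vector_derivative_mult_right has_vector_derivative_mult
        smooth_has_derivative assms)
  moreover have "(\<Sum>k\<le>n. of_nat (n choose k) * (nderiv k f t * nderiv (Suc (n - k)) g t + nderiv (Suc k) f t * nderiv (n - k) g t))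
     = (\<Sum>k\<le>Suc n. of_nat (Suc n choose k) * (nderiv k f t * nderiv (Suc n - k) g t))"
    unfolding binomial_Suc_sum[symmetric, of n "\<lambda>k l. nderiv k f t * nderiv l g t"]
    by (intro sum.cong refl) (auto simp: Suc_diff_le add.commute)
  ultimately show "((\<lambda>s. \<Sum>k\<le>n. of_nat (n choose k) * (nderiv k f s * nderiv (n - k) g s)) has_vector_derivative
     (\<Sum>k\<le>Suc n. of_nat (Suc n choose k) * (nderiv k f t * nderiv (Suc n - k) g t))) (at t)"
    by simp
qed simp

definition smooth_in :: "real \<Rightarrow> real \<Rightarrow> (real \<Rightarrow> complex) \<Rightarrow> bool" where
  "smooth_in a b u \<longleftrightarrow> smooth u \<and> (\<forall>s. s \<notin> {a..b} \<longrightarrow> u s = 0)"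

lemma nderiv_outside:
  assumes "\<And>s. s \<notin> {a..b} \<Longrightarrow> u s = 0"
  shows "s \<notin> {a..b} \<Longrightarrow> nderiv k u s = 0"
proof (induction k arbitrary: s)
  case (Suc k)
  have "((\<lambda>_. 0) has_vector_derivative 0) (at s)" by simp
  moreover have "open (- {a..b})" by (simp add: open_Compl)
  ultimately have "(nderiv k u has_vector_derivative 0) (at s)"
    by (rule has_vector_derivative_transform_within_open) (use Suc in auto)
  then show ?case by (simp add: nderiv_Suc vector_derivative_at)
qed (use assms in simp)

lemma smooth_in_nderiv: "smooth_in a b u \<Longrightarrow> smooth_in a b (nderiv k u)"
  using nderiv_outside[of a b u] smooth_nderiv[of u k] by (simp add: smooth_in_def)

lemma smooth_in_mono: "smooth_in a b u \<Longrightarrow> a' \<le> a \<Longrightarrow> b \<le> b' \<Longrightarrow> smooth_in a' b' u"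
  by (auto simp: smooth_in_def)

lemma smooth_in_mult: "smooth_in a b u \<Longrightarrow> smooth v \<Longrightarrow> smooth_in a b (\<lambda>s. v s * u s)"
  unfolding smooth_in_def using smooth_mult by simp

lemma smooth_in_smooth: "smooth_in a b u \<Longrightarrow> smooth u"
  by (simp add: smooth_in_def)

lemma smooth_in_continuous: "smooth_in a b u \<Longrightarrow> continuous_on S u"
  by (rule smooth_continuous0[OF smooth_in_smooth])

lemma smooth_in_outside: "smooth_in a b u \<Longrightarrow> s \<notin> {a..b} \<Longrightarrow> u s = 0"
  by (simp add: smooth_in_def)

lemma smooth_in_test_function:
  assumes "smooth_in a b u" "{a..b} \<subseteq> U"
  shows "test_function U u"
proof -
  have "closure {t. u t \<noteq> 0} \<subseteq> {a..b}"
    using assms(1) by (intro closure_minimal) (auto simp: smooth_in_def)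
  moreover from this have "compact (closure {t. u t \<noteq> 0})"
    using bounded_closed_interval bounded_subset compact_eq_bounded_closed closed_closure by blast
  ultimately show ?thesis
    using assms unfolding test_function_def smooth_in_def by (meson order_trans)
qed

lemma smooth_in_bounded:
  assumes "smooth_in a b u"
  obtains C where "\<And>s. norm (u s) \<le> C"
proof -
  have "compact (u ` {a..b})"
    by (rule compact_continuous_image[OF smooth_in_continuous[OF assms]]) simp
  from compact_imp_bounded[OF this] obtain C where C: "\<And>x. x \<in> u ` {a..b} \<Longrightarrow> norm x \<le> C"
    unfolding bounded_iff by metis
  have "norm (u s) \<le> max C 0" for s
  proof (cases "s \<in> {a..b}")
    case True
    then have "norm (u s) \<le> C" by (rule C[OF imageI])
    then show ?thesis by simp
  next
    case False
    then show ?thesis using assms by (simp add: smooth_in_def)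
  qed
  then show ?thesis using that by blast
qed

lemma continuous_in_has_bochner_integral:
  fixes u :: "real \<Rightarrow> 'a::euclidean_space"
  assumes "continuous_on {a..b} u" "\<And>s. s \<notin> {a..b} \<Longrightarrow> u s = 0"
  shows "has_bochner_integral lebesgue u (integral {a..b} u)"
proof -
  have "u absolutely_integrable_on {a..b}"
    using absolutely_integrable_continuous_real assms(1) by blast
  moreover have *: "(\<lambda>x. indicator {a..b} x *\<^sub>R u x) = u"
    using assms(2) by (auto simp: indicator_def)
  ultimately have i: "integrable lebesgue u"
    by (simp add: set_integrable_def)
  have "set_lebesgue_integral lebesgue {a..b} u = integral {a..b} u"
    using \<open>u absolutely_integrable_on {a..b}\<close> by (rule set_lebesgue_integral_eq_integral(2))
  then have "integral\<^sup>L lebesgue u = integral {a..b} u"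
    by (simp add: set_lebesgue_integral_def *)
  with i show ?thesis by (simp add: has_bochner_integral_iff)
qed

lemma smooth_in_has_bochner_integral:
  assumes "smooth_in a b u"
  shows "has_bochner_integral lebesgue u (integral {a..b} u)"
  by (rule continuous_in_has_bochner_integral[OF smooth_in_continuous smooth_in_outside]) (rule assms)+

lemma fourier_eq_integral:
  assumes "continuous_on {a..b} u" "\<And>s. s \<notin> {a..b} \<Longrightarrow> u s = 0"
  shows "fourier u t = integral {a..b} (\<lambda>s. exp (- \<i> * of_real t * of_real s) * u s)"
proof -
  have "has_bochner_integral lebesgue (\<lambda>s. exp (- \<i> * of_real t * of_real s) * u s)
      (integral {a..b} (\<lambda>s. exp (- \<i> * of_real t * of_real s) * u s))"
    by (intro continuous_in_has_bochner_integral continuous_intros assms) (simp add: assms)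
  then show ?thesis
    unfolding fourier_def by (rule has_bochner_integral_integral_eq)
qed

lemma integral_nderiv_eq_0:
  assumes "smooth_in a b u"
  shows "integral\<^sup>L lebesgue (nderiv (Suc 0) u) = 0"
proof -
  define a' b' where "a' = min a b - 1" and "b' = max a b + 1"
  have u: "smooth_in a' b' u" using assms by (rule smooth_in_mono) (auto simp: a'_def b'_def)
  have "a' \<le> b'" by (auto simp: a'_def b'_def)
  have "(nderiv (Suc 0) u has_integral u b' - u a') {a'..b'}"
  proof (rule fundamental_theorem_of_calculus[OF \<open>a' \<le> b'\<close>])
    fix x show "(u has_vector_derivative nderiv (Suc 0) u x) (at x within {a'..b'})"
      using smooth_has_derivative[of u 0 x] assms
      by (simp add: has_vector_derivative_at_within smooth_in_def)
  qed
  moreover have "b' \<notin> {a..b}" "a' \<notin> {a..b}" by (auto simp: a'_def b'_def)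
  then have "u b' = 0" "u a' = 0" using assms unfolding smooth_in_def by blast+
  ultimately have "integral {a'..b'} (nderiv (Suc 0) u) = 0"
    by (simp add: integral_unique)
  then show ?thesis
    using smooth_in_has_bochner_integral[OF smooth_in_nderiv[OF u, of "Suc 0"]]
    by (simp add: has_bochner_integral_integral_eq)
qed

lemma integrable_smooth_in: "smooth_in a b u \<Longrightarrow> integrable lebesgue u"
  by (rule integrable.intros[OF smooth_in_has_bochner_integral])

text \<open>Induction on \<open>k\<close>: the integral of the derivative of \<open>exp (- i t s) * v s\<close> vanishes, and the product rule
  makes this the case of one derivative.\<close>

lemma fourier_nderiv:
  assumes "smooth_in a b u"
  shows "fourier (nderiv k u) t = (\<i> * of_real t) ^ k * fourier u t"
proof (induction k)
  case (Suc k)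
  define v where "v = nderiv k u"
  have v: "smooth_in a b v" unfolding v_def using assms by (rule smooth_in_nderiv)
  define e where "e = (\<lambda>s. exp ((- \<i> * of_real t) * of_real s) :: complex)"
  have e: "smooth e" "nderiv (Suc 0) e = (\<lambda>s. (- \<i> * of_real t) * e s)"
    unfolding e_def using nderiv_exp[of "Suc 0" "- \<i> * of_real t"] by (simp_all only: smooth_exp power_Suc0_right)
  have "0 = integral\<^sup>L lebesgue (nderiv (Suc 0) (\<lambda>s. e s * v s))"
    using integral_nderiv_eq_0[OF smooth_in_mult[OF v e(1)]] by simp
  also have "nderiv (Suc 0) (\<lambda>s. e s * v s) = (\<lambda>s. e s * nderiv (Suc 0) v s + (- \<i> * of_real t) * (e s * v s))"
    using smooth_mult[of e v] e v unfolding smooth_in_def by (simp add: algebra_simps)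
  also have "integral\<^sup>L lebesgue \<dots> = integral\<^sup>L lebesgue (\<lambda>s. e s * nderiv (Suc 0) v s) + (- \<i> * of_real t) * integral\<^sup>L lebesgue (\<lambda>s. e s * v s)"
    unfolding integral_mult_right_zero[symmetric]
    by (rule Bochner_Integration.integral_add[OF integrable_smooth_in[OF smooth_in_mult[OF smooth_in_nderiv[OF v] e(1)]]
        integrable_mult_right[OF integrable_smooth_in[OF smooth_in_mult[OF v e(1)]]]])
  also have "integral\<^sup>L lebesgue (\<lambda>s. e s * nderiv (Suc 0) v s) = fourier (nderiv (Suc 0) v) t"
    unfolding fourier_def e_def ..
  also have "integral\<^sup>L lebesgue (\<lambda>s. e s * v s) = fourier v t"
    unfolding fourier_def e_def ..
  finally have "fourier (nderiv (Suc 0) v) t - (\<i> * of_real t) * fourier v t = 0"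
    by (simp only: mult_minus_left add_uminus_conv_diff)
  then have "fourier (nderiv (Suc k) u) t = (\<i> * of_real t) * fourier v t"
    by (simp only: v_def nderiv_nderiv right_minus_eq add_Suc add_0)
  then show ?case unfolding v_def Suc by (simp only: power_Suc mult.assoc)
qed simp

lemma norm_fourier_le:
  assumes "smooth_in a b u" "a \<le> b" "\<And>s. norm (u s) \<le> C"
  shows "norm (fourier u t) \<le> (b - a) * C"
proof -
  have c: "continuous_on {a..b} (\<lambda>s. exp (- \<i> * of_real t * of_real s) * u s)"
    by (intro continuous_intros smooth_in_continuous[OF assms(1)])
  have "norm (integral {a..b} (\<lambda>s. exp (- \<i> * of_real t * of_real s) * u s)) \<le> C * (b - a)"
    by (rule integral_bound[OF assms(2) c]) (simp add: norm_mult norm_exp_eq_Re assms(3))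
  moreover have "fourier u t = integral {a..b} (\<lambda>s. exp (- \<i> * of_real t * of_real s) * u s)"
    by (rule fourier_eq_integral[OF smooth_in_continuous smooth_in_outside]) (rule assms(1))+
  ultimately show ?thesis by (simp add: mult.commute)
qed

text \<open>This is \<open>k\<close>-fold integration by parts with all constants explicit. They matter because \<open>k\<close> will grow
  with \<open>t\<close>.\<close>

lemma norm_fourier_decay:
  assumes "smooth_in a b u" "a \<le> b" "\<And>s. norm (nderiv k u s) \<le> C"
  shows "\<bar>t\<bar> ^ k * norm (fourier u t) \<le> (b - a) * C"
proof -
  have "norm (fourier (nderiv k u) t) \<le> (b - a) * C"
    by (rule norm_fourier_le[OF smooth_in_nderiv[OF assms(1)] assms(2,3)])
  then show ?thesis
    unfolding fourier_nderiv[OF assms(1)] by (simp add: norm_mult norm_power)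
qed

lemma fourier_decay:
  assumes "smooth_in a b u" "a \<le> b"
  shows "\<exists>C. \<forall>t. norm (fourier u t) \<le> C / (1 + \<bar>t\<bar>) ^ L"
proof -
  have *: "\<exists>C. \<forall>t. \<bar>t\<bar> ^ k * norm (fourier u t) \<le> C" for k
  proof -
    obtain C where "\<And>s. norm (nderiv k u s) \<le> C"
      using smooth_in_bounded[OF smooth_in_nderiv[OF assms(1), of k]] by blast
    from norm_fourier_decay[OF assms this]
    show ?thesis by (intro exI[of _ "(b - a) * C"]) simp
  qed
  obtain C0 where C0: "\<And>t. norm (fourier u t) \<le> C0" using *[of 0] by auto
  obtain C1 where C1: "\<And>t. \<bar>t\<bar> ^ L * norm (fourier u t) \<le> C1" using *[of L] by auto
  have "(1 + \<bar>t\<bar>) ^ L * norm (fourier u t) \<le> 2 ^ L * (C0 + C1)" for t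
  proof -
    have "(1 + \<bar>t\<bar>) ^ L \<le> (2 * max 1 \<bar>t\<bar>) ^ L"
      by (rule power_mono) auto
    also have "\<dots> \<le> 2 ^ L * (1 + \<bar>t\<bar> ^ L)"
      by (auto simp: power_mult_distrib max_def)
    finally have "(1 + \<bar>t\<bar>) ^ L * norm (fourier u t) \<le> 2 ^ L * (1 + \<bar>t\<bar> ^ L) * norm (fourier u t)"
      by (rule mult_right_mono) simp
    also have "\<dots> = 2 ^ L * (norm (fourier u t) + \<bar>t\<bar> ^ L * norm (fourier u t))"
      by (simp add: algebra_simps)
    also have "\<dots> \<le> 2 ^ L * (C0 + C1)"
      by (intro mult_left_mono add_mono C0 C1) simp
    finally show ?thesis .
  qed
  moreover have "0 < (1 + \<bar>t\<bar>) ^ L" for t :: real by simp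
  ultimately show ?thesis by (auto simp: pos_le_divide_eq mult.commute)
qed

section \<open>Averaging operators\<close>

text \<open>The average of the translates \<open>v (s + r * y)\<close> with density \<open>w\<close>. One operator covers the autocorrelation
  of a bump (\<open>w\<close> the bump itself) and the box averages (\<open>w = 1\<close>).\<close>

definition wavg :: "(real \<Rightarrow> complex) \<Rightarrow> real \<Rightarrow> (real \<Rightarrow> complex) \<Rightarrow> real \<Rightarrow> complex" where
  "wavg w r v s = integral {0..1} (\<lambda>y. w y * v (s + r * y))"

lemma wavg_integrable:
  fixes w v :: "real \<Rightarrow> complex"
  assumes "continuous_on {0..1} w" "continuous_on UNIV v"
  shows "(\<lambda>y. w y * v (s + r * y)) integrable_on {0..1}"
proof (rule integrable_continuous_real)
  have "continuous_on {0..1} (\<lambda>y. v (s + r * y))"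
    by (rule continuous_on_compose2[OF assms(2)]) (auto intro!: continuous_intros)
  then show "continuous_on {0..1} (\<lambda>y. w y * v (s + r * y))"
    by (intro continuous_intros assms(1))
qed

lemma wavg_has_derivative:
  assumes w: "continuous_on {0..1} w" and v: "smooth v"
  shows "(wavg w r (nderiv k v) has_vector_derivative wavg w r (nderiv (Suc k) v) s) (at s)"
proof -
  have "((\<lambda>s. integral (cbox 0 1) (\<lambda>y. w y * nderiv k v (s + r * y))) has_vector_derivative
      integral (cbox 0 1) (\<lambda>y. w y * nderiv (Suc k) v (s + r * y))) (at s within UNIV)"
  proof (rule leibniz_rule_vector_derivative[where fx="\<lambda>s y. w y * nderiv (Suc k) v (s + r * y)"])
    fix x t :: real
    have "((\<lambda>s. s + r * t) has_vector_derivative 1) (at x)"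
      by (auto intro!: derivative_eq_intros)
    from vector_diff_chain_at[OF this smooth_has_derivative[OF v, of k]]
    have "((\<lambda>s. nderiv k v (s + r * t)) has_vector_derivative nderiv (Suc k) v (x + r * t)) (at x)"
      by (simp add: o_def)
    then show "((\<lambda>x. w t * nderiv k v (x + r * t)) has_vector_derivative w t * nderiv (Suc k) v (x + r * t)) (at x within UNIV)"
      by (rule has_vector_derivative_mult_right)
  next
    fix x show "(\<lambda>y. w y * nderiv k v (x + r * y)) integrable_on cbox 0 1"
      using wavg_integrable[OF w smooth_continuous[OF v]] by simp
  next
    have w2: "continuous_on (UNIV \<times> cbox 0 1) (\<lambda>p::real\<times>real. w (snd p))"
      by (rule continuous_on_compose2[OF w]) (auto intro!: continuous_intros)
    have v2: "continuous_on (UNIV \<times> cbox 0 1) (\<lambda>p::real\<times>real. nderiv (Suc k) v (fst p + r * snd p))"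
      by (rule continuous_on_compose2[OF smooth_continuous[OF v, of UNIV]]) (auto intro!: continuous_intros)
    show "continuous_on (UNIV \<times> cbox 0 1) (\<lambda>(x, t). w t * nderiv (Suc k) v (x + r * t))"
      unfolding split_beta by (intro continuous_intros w2 v2)
  qed auto
  then show ?thesis by (simp add: wavg_def[abs_def])
qed

lemma smooth_wavg:
  assumes "continuous_on {0..1} w" "smooth v"
  shows "smooth (wavg w r v)" and "nderiv k (wavg w r v) = wavg w r (nderiv k v)"
  using smooth_chain[of "\<lambda>k. wavg w r (nderiv k v)"] wavg_has_derivative[OF assms] by auto

lemma wavg_outside:
  assumes "\<And>s. s \<notin> {a..b} \<Longrightarrow> v s = 0" "s \<notin> {a - max r 0..b - min r 0}"
  shows "wavg w r v s = 0"
proof -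
  have "v (s + r * y) = 0" if y: "y \<in> {0..1}" for y
  proof (rule assms(1))
    have "min r 0 \<le> r * y" "r * y \<le> max r 0"
      using y by (auto simp: min_def max_def mult_le_0_iff mult_left_le mult_le_cancel_left1 mult_le_cancel_left2)
    then show "s + r * y \<notin> {a..b}" using assms(2) by auto
  qed
  then have "wavg w r v s = integral {0..1} (\<lambda>y::real. 0)"
    unfolding wavg_def by (intro integral_cong) simp
  then show ?thesis by simp
qed

lemma smooth_in_wavg:
  assumes "continuous_on {0..1} w" "smooth_in a b v"
  shows "smooth_in (a - max r 0) (b - min r 0) (wavg w r v)"
  using assms smooth_wavg(1) wavg_outside[of a b v] unfolding smooth_in_def by metis

lemma norm_wavg_le:
  assumes "continuous_on UNIV v" "\<And>s. norm (v s) \<le> C"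
  shows "norm (wavg (\<lambda>_. 1) r v s) \<le> C"
proof -
  have "norm (integral {0..1} (\<lambda>y. v (s + r * y))) \<le> C * (1 - 0)"
    by (rule integral_bound) (auto intro!: continuous_intros continuous_on_compose2[OF assms(1)] assms(2))
  then show ?thesis by (simp add: wavg_def)
qed

text \<open>A box average turns one derivative into a difference quotient. Hence it gains a derivative at
  the cost of the inverse of its length.\<close>

lemma nderiv_wavg_1:
  assumes v: "smooth v" and "r \<noteq> 0"
  shows "nderiv (Suc k) (wavg (\<lambda>_. 1) r v) s = (nderiv k v (s + r) - nderiv k v s) /\<^sub>R r"
proof -
  have "((\<lambda>y. nderiv (Suc k) v (s + r * y)) has_integral (inverse r *\<^sub>R nderiv k v (s + r * 1) - inverse r *\<^sub>R nderiv k v (s + r * 0))) {0..1}"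
  proof (rule fundamental_theorem_of_calculus)
    fix y :: real
    have "((\<lambda>y. s + r * y) has_vector_derivative r) (at y)"
      by (auto intro!: derivative_eq_intros)
    from vector_diff_chain_at[OF this smooth_has_derivative[OF v, of k]]
    have "((\<lambda>y. nderiv k v (s + r * y)) has_vector_derivative r *\<^sub>R nderiv (Suc k) v (s + r * y)) (at y)"
      by (simp add: o_def)
    then have "((\<lambda>y. inverse r *\<^sub>R nderiv k v (s + r * y)) has_vector_derivative inverse r *\<^sub>R (r *\<^sub>R nderiv (Suc k) v (s + r * y))) (at y)"
      by (rule has_vector_derivative_scaleR[OF DERIV_const, THEN has_vector_derivative_eq_rhs]) simp
    then show "((\<lambda>y. inverse r *\<^sub>R nderiv k v (s + r * y)) has_vector_derivative nderiv (Suc k) v (s + r * y)) (at y within {0..1})"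
      using assms by (auto intro: has_vector_derivative_at_within)
  qed simp
  then have "wavg (\<lambda>_. 1) r (nderiv (Suc k) v) s = inverse r *\<^sub>R (nderiv k v (s + r) - nderiv k v s)"
    unfolding wavg_def by (simp add: integral_unique scaleR_diff_right)
  then show ?thesis by (subst smooth_wavg) (auto intro: v)
qed

text \<open>Averaging translates is a convolution, so it multiplies the transform. Since all functions are
  continuous with compact support, swapping two integrals proves it.\<close>

lemma fourier_wavg:
  assumes w: "continuous_on {0..1} w" and v: "smooth_in a b v"
  shows "fourier (wavg w r v) t = integral {0..1} (\<lambda>y. w y * exp (\<i> * of_real (t * r * y))) * fourier v t"
proof -
  define a' b' where "a' = a - max r 0" and "b' = b - min r 0"
  have wv: "smooth_in a' b' (wavg w r v)" unfolding a'_def b'_def by (rule smooth_in_wavg[OF w v])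
  have cv: "continuous_on UNIV v" using v smooth_continuous0 smooth_in_def by blast
  have "fourier (wavg w r v) t = integral {a'..b'} (\<lambda>s. exp (- \<i> * of_real t * of_real s) * wavg w r v s)"
    by (rule fourier_eq_integral[OF smooth_in_continuous smooth_in_outside]) (rule wv)+
  also have "\<dots> = integral {a'..b'} (\<lambda>s. integral {0..1} (\<lambda>y. exp (- \<i> * of_real t * of_real s) * (w y * v (s + r * y))))"
    unfolding wavg_def by (intro integral_cong) simp
  also have "\<dots> = integral {0..1} (\<lambda>y. integral {a'..b'} (\<lambda>s. exp (- \<i> * of_real t * of_real s) * (w y * v (s + r * y))))"
  proof -
    have w2: "continuous_on (cbox (a', 0) (b', 1)) (\<lambda>p::real\<times>real. w (snd p))"
      by (rule continuous_on_compose2[OF w]) (auto intro!: continuous_intros simp: cbox_Pair_eq)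
    have v2: "continuous_on (cbox (a', 0) (b', 1)) (\<lambda>p::real\<times>real. v (fst p + r * snd p))"
      by (rule continuous_on_compose2[OF cv]) (auto intro!: continuous_intros)
    have "continuous_on (cbox (a', 0) (b', 1)) (\<lambda>(s, y). exp (- \<i> * of_real t * of_real s) * (w y * v (s + r * y)))"
      unfolding split_beta by (intro continuous_intros w2 v2)
    from integral_swap_continuous[OF this] show ?thesis by simp
  qed
  also have "\<dots> = integral {0..1} (\<lambda>y. w y * exp (\<i> * of_real (t * r * y)) * fourier v t)"
  proof (rule integral_cong)
    fix y :: real assume y: "y \<in> {0..1}"
    have c: "continuous_on {a'..b'} (\<lambda>s. v (s + r * y))"
      by (rule continuous_on_compose2[OF cv]) (auto intro!: continuous_intros)
    have out: "v (s + r * y) = 0" if "s \<notin> {a'..b'}" for s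
    proof -
      have "min r 0 \<le> r * y" "r * y \<le> max r 0"
        using y by (auto simp: min_def max_def mult_le_0_iff mult_left_le mult_le_cancel_left1 mult_le_cancel_left2)
      then show ?thesis using that v by (auto simp: smooth_in_def a'_def b'_def)
    qed
    have "integral {a'..b'} (\<lambda>s. exp (- \<i> * of_real t * of_real s) * (w y * v (s + r * y)))
       = w y * integral {a'..b'} (\<lambda>s. exp (- \<i> * of_real t * of_real s) * v (s + r * y))"
      by (subst integral_mult_right[symmetric]) (simp add: algebra_simps)
    also have "integral {a'..b'} (\<lambda>s. exp (- \<i> * of_real t * of_real s) * v (s + r * y)) = fourier (\<lambda>s. v (s + r * y)) t"
      by (intro fourier_eq_integral[symmetric] c out)
    also have "fourier (\<lambda>s. v (s + r * y)) t = exp (\<i> * of_real (t * r * y)) * fourier v t"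
    proof -
      have "fourier v t = integral\<^sup>L lebesgue (\<lambda>s. exp (- \<i> * of_real t * of_real (r * y + 1 * s)) * v (r * y + 1 * s))"
        unfolding fourier_def by (subst lebesgue_integral_real_affine[of 1 _ "r * y"]) auto
      also have "\<dots> = integral\<^sup>L lebesgue (\<lambda>s. exp (- (\<i> * of_real (t * r * y))) * (exp (- \<i> * of_real t * of_real s) * v (s + r * y)))"
      proof (intro Bochner_Integration.integral_cong refl)
        fix s
        have "- \<i> * of_real t * of_real (r * y + 1 * s) = - (\<i> * of_real (t * r * y)) + - \<i> * of_real t * complex_of_real s"
          by (simp add: algebra_simps)
        then show "exp (- \<i> * of_real t * of_real (r * y + 1 * s)) * v (r * y + 1 * s) =
            exp (- (\<i> * of_real (t * r * y))) * (exp (- \<i> * of_real t * of_real s) * v (s + r * y))"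
          by (simp only: exp_add ac_simps mult_1)
      qed
      also have "\<dots> = exp (- (\<i> * of_real (t * r * y))) * fourier (\<lambda>s. v (s + r * y)) t"
        unfolding fourier_def by (rule integral_mult_right_zero)
      finally show ?thesis by (simp add: exp_minus field_simps)
    qed
    finally show "integral {a'..b'} (\<lambda>s. exp (- \<i> * of_real t * of_real s) * (w y * v (s + r * y))) =
       w y * exp (\<i> * of_real (t * r * y)) * fourier v t" by simp
  qed
  finally show ?thesis by simp
qed

section \<open>A smooth bump\<close>

text \<open>The family \<open>p(1/x) * exp (-1/x)\<close>, extended by zero, is closed under differentiation: the derivative
  corresponds to the polynomial \<open>z\<^sup>2 * (p - p')\<close> in \<open>z = 1/x\<close>. It contains the classical flat function.\<close>

definition flat :: "real poly \<Rightarrow> real \<Rightarrow> real" where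
  "flat p x = (if 0 < x then poly p (inverse x) * exp (- inverse x) else 0)"

lemma poly_mult_exp_minus_tendsto_0: "((\<lambda>z::real. poly p z * exp (- z)) \<longlongrightarrow> 0) at_top"
proof -
  have "((\<lambda>z::real. \<Sum>i\<le>degree p. coeff p i * (z ^ i / exp z)) \<longlongrightarrow> (\<Sum>i\<le>degree p. coeff p i * 0)) at_top"
    by (intro tendsto_sum tendsto_mult tendsto_const tendsto_power_div_exp_0)
  then show ?thesis
    by (simp add: poly_altdef exp_minus sum_distrib_right divide_inverse mult.assoc)
qed

lemma flat_has_derivative:
  "(flat p has_vector_derivative flat ([:0, 0, 1:] * (p - pderiv p)) x) (at x)"
proof (cases x "0::real" rule: linorder_cases)
  case less
  have "((\<lambda>_. 0) has_vector_derivative 0) (at x)" by simp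
  then have "(flat p has_vector_derivative 0) (at x)"
    by (rule has_vector_derivative_transform_within_open[where S="{..<0}"]) (use less in \<open>auto simp: flat_def\<close>)
  then show ?thesis using less by (simp add: flat_def)
next
  case greater
  have "((\<lambda>x. poly p (inverse x) * exp (- inverse x)) has_field_derivative
      flat ([:0, 0, 1:] * (p - pderiv p)) x) (at x)"
    using greater
    by (auto intro!: derivative_eq_intros DERIV_chain2[OF poly_DERIV] simp: flat_def field_simps power2_eq_square)
  then have "((\<lambda>x. poly p (inverse x) * exp (- inverse x)) has_vector_derivative
      flat ([:0, 0, 1:] * (p - pderiv p)) x) (at x)"
    by (simp add: has_real_derivative_iff_has_vector_derivative)
  then show ?thesis
    by (rule has_vector_derivative_transform_within_open[where S="{0<..}"]) (use greater in \<open>auto simp: flat_def\<close>)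
next
  case equal
  have "((\<lambda>h. flat p h / h) \<longlongrightarrow> 0) (at 0)"
  proof (rule filterlim_split_at)
    have "eventually (\<lambda>h. 0 = flat p h / h) (at_left (0::real))"
      by (auto simp: eventually_at_filter flat_def)
    then show "((\<lambda>h. flat p h / h) \<longlongrightarrow> 0) (at_left 0)"
      by (rule Lim_transform_eventually[OF tendsto_const])
    have "((\<lambda>h. poly (pCons 0 p) (inverse h) * exp (- inverse h)) \<longlongrightarrow> 0) (at_right (0::real))"
      by (rule filterlim_compose[OF poly_mult_exp_minus_tendsto_0 filterlim_inverse_at_top_right])
    moreover have "eventually (\<lambda>h. poly (pCons 0 p) (inverse h) * exp (- inverse h) = flat p h / h) (at_right (0::real))"
      unfolding eventually_at_filter by (rule always_eventually) (auto simp: flat_def field_simps)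
    ultimately show "((\<lambda>h. flat p h / h) \<longlongrightarrow> 0) (at_right 0)"
      by (rule Lim_transform_eventually)
  qed
  then have "(flat p has_field_derivative 0) (at 0)"
    by (simp add: has_field_derivative_iff flat_def)
  then show ?thesis using equal by (simp add: has_real_derivative_iff_has_vector_derivative flat_def)
qed

lemma smooth_flat: "smooth (flat p)"
proof -
  define q where "q = rec_nat p (\<lambda>_ p. [:0, 0, 1:] * (p - pderiv p))"
  have "(flat (q k) has_vector_derivative flat (q (Suc k)) t) (at t)" for k t
    using flat_has_derivative[of "q k" t] by (simp add: q_def)
  from smooth_chain(1)[of "\<lambda>k. flat (q k)", OF this] show ?thesis by (simp add: q_def)
qed

definition bump :: "real \<Rightarrow> real" where
  "bump s = flat 1 s * flat 1 (1 - s)"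

lemma bump_nonneg: "0 \<le> bump s" and bump_pos: "0 < s \<Longrightarrow> s < 1 \<Longrightarrow> 0 < bump s"
  by (auto simp: bump_def flat_def)

lemma smooth_in_bump: "smooth_in 0 1 (\<lambda>s. of_real (bump s))"
proof -
  have 1: "smooth (\<lambda>s. complex_of_real (flat 1 s))"
    by (rule smooth_bounded_linear[OF smooth_flat bounded_linear_of_real, THEN conjunct1])
  have 2: "smooth (\<lambda>s. complex_of_real (flat 1 (1 - s)))"
    using smooth_affine[OF 1, of "-1" 1] by simp
  have "smooth (\<lambda>s. complex_of_real (bump s))"
    using smooth_mult[OF 1 2] by (simp add: bump_def)
  then show ?thesis by (auto simp: smooth_in_def bump_def flat_def)
qed

lemma continuous_bump: "continuous_on S bump"
proof -
  have "continuous_on S (\<lambda>s. Re (of_real (bump s)))"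
    by (intro continuous_intros smooth_in_continuous[OF smooth_in_bump])
  then show ?thesis by simp
qed

definition bump_mass :: real where "bump_mass = integral {0..1} bump"

lemma bump_mass_pos: "0 < bump_mass"
proof -
  have i: "bump integrable_on {0..1}"
    by (intro integrable_continuous_real continuous_bump)
  have "0 \<le> bump_mass" unfolding bump_mass_def
    by (intro integral_nonneg i) (simp add: bump_nonneg)
  moreover have "bump_mass \<noteq> 0"
  proof
    assume "bump_mass = 0"
    then have "(bump has_integral 0) (cbox 0 1)"
      using i by (simp add: bump_mass_def has_integral_iff)
    then have "bump (1/2) = 0"
      by (rule has_integral_0_cbox_imp_0[rotated 2]) (auto intro: continuous_bump bump_nonneg)
    then show False using bump_pos[of "1/2"] by simp
  qed
  ultimately show ?thesis by simp
qed

section \<open>Cutoffs and kernels\<close>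

lemma continuous_fourier:
  assumes "smooth_in a b u"
  shows "continuous_on UNIV (fourier u)"
proof -
  have "continuous_on (UNIV \<times> cbox a b) (\<lambda>p::real\<times>real. u (snd p))"
    by (rule continuous_on_compose2[OF smooth_in_continuous[OF assms, of UNIV]]) (auto intro!: continuous_intros)
  then have "continuous_on (UNIV \<times> cbox a b) (\<lambda>(t, s). exp (- \<i> * of_real t * of_real s) * u s)"
    unfolding split_beta by (intro continuous_intros)
  from integral_continuous_on_param[OF this]
  have "continuous_on UNIV (\<lambda>t. integral {a..b} (\<lambda>s. exp (- \<i> * of_real t * of_real s) * u s))"
    by simp
  moreover have "fourier u = (\<lambda>t. integral {a..b} (\<lambda>s. exp (- \<i> * of_real t * of_real s) * u s))"
    by (rule ext, rule fourier_eq_integral[OF smooth_in_continuous smooth_in_outside]) (rule assms, rule assms)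
  ultimately show ?thesis by simp
qed

abbreviation bump_hat :: "real \<Rightarrow> complex" where
  "bump_hat \<equiv> fourier (\<lambda>s. of_real (bump s))"

lemma bump_hat_eq: "bump_hat t = integral {0..1} (\<lambda>s. exp (- \<i> * of_real t * of_real s) * of_real (bump s))"
  by (rule fourier_eq_integral[OF smooth_in_continuous smooth_in_outside]) (rule smooth_in_bump)+

lemma bump_hat_decay: "\<exists>C. \<forall>t. norm (bump_hat t) \<le> C / (1 + \<bar>t\<bar>) ^ L"
  by (rule fourier_decay[OF smooth_in_bump]) simp

text \<open>For \<open>\<bar>t\<bar> \<le> 1\<close> and \<open>0 \<le> s \<le> 1\<close> the real part of \<open>exp (- i t s)\<close> is at least \<open>cos (\<pi>/3) = 1/2\<close>.\<close>

lemma bump_hat_lower: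
  assumes "\<bar>t\<bar> \<le> 1"
  shows "bump_mass / 2 \<le> norm (bump_hat t)"
proof -
  have c: "continuous_on {0..1} (\<lambda>s. exp (- \<i> * of_real t * of_real s) * complex_of_real (bump s))"
    by (intro continuous_intros smooth_in_continuous[OF smooth_in_bump])
  have "Re (bump_hat t) = integral {0..1} (\<lambda>s. Re (exp (- \<i> * of_real t * of_real s) * of_real (bump s)))"
    unfolding bump_hat_eq
    by (subst integral_linear[symmetric, OF integrable_continuous_real[OF c] bounded_linear_Re]) (simp only: o_def)
  also have "\<dots> \<ge> integral {0..1} (\<lambda>s. bump s / 2)"
  proof (rule integral_le)
    show "(\<lambda>s. bump s / 2) integrable_on {0..1}"
      by (intro integrable_continuous_real continuous_intros continuous_bump) auto
    show "(\<lambda>s. Re (exp (- \<i> * of_real t * of_real s) * of_real (bump s))) integrable_on {0..1}"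
      by (intro integrable_continuous_real continuous_on_Re c)
    fix s :: real assume s: "s \<in> {0..1}"
    then have "\<bar>t * s\<bar> \<le> 1" using assms by (simp add: abs_mult mult_le_one)
    then have "\<bar>t * s\<bar> \<le> pi / 3" using pi_gt3 by linarith
    then have "cos (pi / 3) \<le> cos \<bar>t * s\<bar>" by (intro cos_monotone_0_pi_le) auto
    then have "1/2 \<le> cos (t * s)" by (simp add: cos_60)
    then have "bump s * (1/2) \<le> bump s * cos (t * s)" by (intro mult_left_mono bump_nonneg)
    then show "bump s / 2 \<le> Re (exp (- \<i> * of_real t * of_real s) * of_real (bump s))"
      by (simp add: Re_exp mult.commute)
  qed
  finally have "bump_mass / 2 \<le> Re (bump_hat t)"
    by (simp add: bump_mass_def)
  also have "\<dots> \<le> norm (bump_hat t)" by (rule complex_Re_le_cmod)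
  finally show ?thesis .
qed

text \<open>Averaging over both \<open>[0, \<tau>]\<close> and \<open>[-\<tau>, 0]\<close> multiplies the Fourier transform by a squared modulus, which keeps
  it nonnegative.\<close>

definition pair_avg :: "real \<Rightarrow> (real \<Rightarrow> complex) \<Rightarrow> real \<Rightarrow> complex" where
  "pair_avg \<tau> v = wavg (\<lambda>_. 1) \<tau> (wavg (\<lambda>_. 1) (- \<tau>) v)"

definition box_hat :: "real \<Rightarrow> complex" where
  "box_hat x = integral {0..1} (\<lambda>y. exp (\<i> * of_real (x * y)))"

lemma box_hat_cnj: "box_hat (- x) = cnj (box_hat x)"
proof -
  have "integral {0..1} (cnj \<circ> (\<lambda>y. exp (\<i> * of_real (x * y)))) = cnj (box_hat x)"
    unfolding box_hat_def
    by (rule integral_linear[OF _ bounded_linear_cnj]) (intro integrable_continuous_real continuous_intros)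
  then show ?thesis by (simp add: box_hat_def o_def exp_cnj)
qed

lemma norm_box_hat_le: "norm (box_hat x) \<le> 1"
proof -
  have "norm (integral {0..1} (\<lambda>y. exp (\<i> * of_real (x * y)))) \<le> 1 * (1 - 0)"
    by (rule integral_bound) (auto intro!: continuous_intros simp: norm_exp_eq_Re)
  then show ?thesis by (simp add: box_hat_def)
qed

lemma norm_box_hat_ge: "1 - \<bar>x\<bar> \<le> norm (box_hat x)"
proof -
  have "box_hat x - 1 = integral {0..1} (\<lambda>y. exp (\<i> * of_real (x * y)) - 1)"
    unfolding box_hat_def
    by (subst integral_diff) (auto intro!: integrable_continuous_real continuous_intros)
  also have "norm \<dots> \<le> \<bar>x\<bar> * (1 - 0)"
  proof (rule integral_bound)
    fix y :: real assume y: "y \<in> {0..1}"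
    have "norm (exp (\<i> * of_real (x * y)) - 1) = 2 * \<bar>sin (x * y / 2)\<bar>"
      using dist_exp_i_1[of "x * y"] by (simp add: dist_norm)
    also have "\<dots> \<le> 2 * \<bar>x * y / 2\<bar>" by (intro mult_left_mono abs_sin_x_le_abs_x) simp
    also have "\<dots> \<le> \<bar>x\<bar>" using y by (simp add: abs_mult mult_left_le)
    finally show "norm (exp (\<i> * of_real (x * y)) - 1) \<le> \<bar>x\<bar>" .
  qed (auto intro!: continuous_intros)
  finally have "norm (box_hat x - 1) \<le> \<bar>x\<bar>" by simp
  moreover have "1 = norm (box_hat x - (box_hat x - 1))" by simp
  then have "1 \<le> norm (box_hat x) + norm (box_hat x - 1)" using norm_triangle_ineq4 by metis
  ultimately show ?thesis by linarith
qed

lemma smooth_in_pair_avg: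
  assumes "smooth_in a b v" "0 \<le> \<tau>"
  shows "smooth_in (a - \<tau>) (b + \<tau>) (pair_avg \<tau> v)"
proof -
  have "smooth_in a (b + \<tau>) (wavg (\<lambda>_. 1) (- \<tau>) v)"
    using smooth_in_wavg[OF _ assms(1), of "\<lambda>_. 1" "- \<tau>"] assms(2) by simp
  from smooth_in_wavg[OF _ this, of "\<lambda>_. 1" \<tau>] show ?thesis
    using assms(2) by (simp add: pair_avg_def)
qed

lemma fourier_pair_avg:
  assumes "smooth_in a b v"
  shows "fourier (pair_avg \<tau> v) t = of_real (norm (box_hat (t * \<tau>)) ^ 2) * fourier v t"
proof -
  have 1: "smooth_in (a - max (- \<tau>) 0) (b - min (- \<tau>) 0) (wavg (\<lambda>_. 1) (- \<tau>) v)"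
    by (rule smooth_in_wavg) (auto intro: assms)
  have "fourier (pair_avg \<tau> v) t = box_hat (t * \<tau>) * (box_hat (- (t * \<tau>)) * fourier v t)"
    unfolding pair_avg_def
    by (subst fourier_wavg[OF _ 1], simp, subst fourier_wavg[OF _ assms]) (simp_all add: box_hat_def)
  then show ?thesis
    by (simp add: box_hat_cnj complex_norm_square[symmetric] mult.assoc[symmetric] del: of_real_power)
qed

text \<open>The first average keeps the bound on the \<open>k\<close>-th derivative, the second trades a factor \<open>2 / \<bar>\<tau>\<bar>\<close> for one
  further derivative.\<close>

lemma norm_nderiv_pair_avg:
  assumes v: "smooth v" and "\<tau> \<noteq> 0" and "\<And>s. norm (nderiv k v s) \<le> C"
  shows "norm (nderiv k (pair_avg \<tau> v) s) \<le> C"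
    and "norm (nderiv (Suc k) (pair_avg \<tau> v) s) \<le> 2 * C / \<bar>\<tau>\<bar>"
proof -
  define w where "w = wavg (\<lambda>_. 1) (- \<tau>) v"
  have w: "smooth w" "nderiv k w = wavg (\<lambda>_. 1) (- \<tau>) (nderiv k v)"
    unfolding w_def by (auto intro!: smooth_wavg v)
  have wC: "norm (nderiv k w s) \<le> C" for s
    unfolding w(2) by (rule norm_wavg_le[OF smooth_continuous[OF v] assms(3)])
  show "norm (nderiv k (pair_avg \<tau> v) s) \<le> C"
    unfolding pair_avg_def w_def[symmetric]
    by (subst smooth_wavg) (auto intro!: w norm_wavg_le smooth_continuous wC)
  have "nderiv (Suc k) (pair_avg \<tau> v) s = (nderiv k w (s + \<tau>) - nderiv k w s) /\<^sub>R \<tau>"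
    unfolding pair_avg_def w_def[symmetric] by (rule nderiv_wavg_1[OF w(1) assms(2)])
  moreover have "norm (nderiv k w (s + \<tau>) - nderiv k w s) \<le> C + C"
    by (rule order_trans[OF norm_triangle_ineq4 add_mono[OF wC wC]])
  ultimately show "norm (nderiv (Suc k) (pair_avg \<tau> v) s) \<le> 2 * C / \<bar>\<tau>\<bar>"
    by (simp add: divide_inverse_commute mult_left_mono)
qed

text \<open>The autocorrelation of the bump; its transform is the squared modulus of that of the bump, in
  particular nonnegative.\<close>

definition autocorr :: "real \<Rightarrow> complex" where
  "autocorr = wavg (\<lambda>s. of_real (bump s)) 1 (\<lambda>s. of_real (bump s))"

lemma smooth_in_autocorr: "smooth_in (- 1) 1 autocorr"
  unfolding autocorr_def
  using smooth_in_wavg[OF smooth_in_continuous[OF smooth_in_bump] smooth_in_bump, of 1] by simp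

lemma fourier_autocorr: "fourier autocorr t = of_real (norm (bump_hat t) ^ 2)"
proof -
  have "integral {0..1} (cnj \<circ> (\<lambda>s. exp (- \<i> * of_real t * of_real s) * of_real (bump s))) = cnj (bump_hat t)"
    unfolding bump_hat_eq
    by (rule integral_linear[OF _ bounded_linear_cnj])
       (intro integrable_continuous_real continuous_intros smooth_in_continuous[OF smooth_in_bump])
  then have "integral {0..1} (\<lambda>y. of_real (bump y) * exp (\<i> * of_real (t * 1 * y))) = cnj (bump_hat t)"
    by (simp add: o_def exp_cnj ac_simps)
  then have "fourier autocorr t = cnj (bump_hat t) * bump_hat t"
    unfolding autocorr_def by (subst fourier_wavg[OF smooth_in_continuous[OF smooth_in_bump] smooth_in_bump]) simp
  then show ?thesis by (simp add: complex_norm_square mult.commute del: of_real_power)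
qed

text \<open>The total length of the \<open>N\<close> averages is \<open>1\<close> on either side, so the support stays in \<open>[-2, 2]\<close> for all \<open>N\<close>.\<close>

definition cutoff :: "nat \<Rightarrow> real \<Rightarrow> complex" where
  "cutoff N = (pair_avg (1 / N) ^^ N) autocorr"

text \<open>The Fourier transform of \<open>cutoff N\<close>, see \<open>fourier_cutoff\<close>.\<close>

definition kernel :: "nat \<Rightarrow> real \<Rightarrow> real" where
  "kernel N t = norm (box_hat (t / N)) ^ (2 * N) * norm (bump_hat t) ^ 2"

lemma smooth_in_pair_avg_power:
  assumes "0 \<le> \<tau>"
  shows "smooth_in (- 1 - n * \<tau>) (1 + n * \<tau>) ((pair_avg \<tau> ^^ n) autocorr)"
proof (induction n)
  case (Suc n)
  from smooth_in_pair_avg[OF this assms] show ?case by (simp add: algebra_simps)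
qed (simp add: smooth_in_autocorr)

lemma smooth_in_cutoff: "1 \<le> N \<Longrightarrow> smooth_in (- 2) 2 (cutoff N)"
  using smooth_in_pair_avg_power[of "1 / N" N] by (simp add: cutoff_def)

lemma fourier_cutoff: "fourier (cutoff N) t = of_real (kernel N t)"
proof -
  have "fourier ((pair_avg \<tau> ^^ n) autocorr) t = of_real (norm (box_hat (t * \<tau>)) ^ (2 * n) * norm (bump_hat t) ^ 2)"
    if "0 \<le> \<tau>" for n \<tau>
  proof (induction n)
    case (Suc n)
    have "fourier ((pair_avg \<tau> ^^ Suc n) autocorr) t = of_real (norm (box_hat (t * \<tau>)) ^ 2) * fourier ((pair_avg \<tau> ^^ n) autocorr) t"
      unfolding funpow.simps o_apply by (rule fourier_pair_avg[OF smooth_in_pair_avg_power[OF that]])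
    then show ?case unfolding Suc by (simp add: power_add power2_eq_square mult.assoc)
  qed (simp add: fourier_autocorr)
  from this[of "1 / N" N] show ?thesis by (simp add: cutoff_def kernel_def)
qed

text \<open>Each of the \<open>N\<close> averages can absorb one derivative and costs \<open>2 * N\<close>. For \<open>k = N\<close> the bound is
  \<open>fact N\<close> up to a geometric factor, which no fixed function of compact support satisfies for all \<open>N\<close>, as it would be
  analytic.\<close>

lemma norm_nderiv_cutoff: "\<exists>S\<ge>0. \<forall>N k s. 1 \<le> N \<longrightarrow> k \<le> N \<longrightarrow> norm (nderiv k (cutoff N) s) \<le> (2 * real N) ^ k * S"
proof -
  obtain S where S: "\<And>s. norm (autocorr s) \<le> S" using smooth_in_bounded[OF smooth_in_autocorr] by blast
  have *: "norm (nderiv k ((pair_avg (1/N) ^^ n) autocorr) s) \<le> (2 * real N) ^ k * S" if "1 \<le> N" "k \<le> n" for N k n :: nat and s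
    using that(2)
  proof (induction n arbitrary: k s)
    case 0
    then show ?case using S by simp
  next
    case (Suc n)
    have sm: "smooth ((pair_avg (1/N) ^^ n) autocorr)"
      by (rule smooth_in_smooth, rule smooth_in_pair_avg_power) simp
    have N: "1 / real N \<noteq> 0" using that by simp
    show ?case
    proof (cases k)
      case 0
      have "norm (nderiv 0 ((pair_avg (1/N) ^^ n) autocorr) s) \<le> S" for s using Suc.IH[of 0] by simp
      from norm_nderiv_pair_avg(1)[OF sm N this] show ?thesis by (simp add: 0)
    next
      case (Suc k')
      have "norm (nderiv k' ((pair_avg (1/N) ^^ n) autocorr) s) \<le> (2 * real N) ^ k' * S" for s
        using Suc.prems Suc.IH[of k'] \<open>k = Suc k'\<close> by simp
      from norm_nderiv_pair_avg(2)[OF sm N this] show ?thesis by (simp add: Suc mult_ac)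
    qed
  qed
  have "0 \<le> S" by (rule order_trans[OF norm_ge_zero S])
  then show ?thesis unfolding cutoff_def by (intro exI[of _ S] conjI allI impI *)
qed

lemma kernel_nonneg: "0 \<le> kernel N t"
  by (simp add: kernel_def)

lemma kernel_continuous:
  assumes "1 \<le> N"
  shows "continuous_on UNIV (kernel N)"
proof -
  have "continuous_on UNIV (\<lambda>t. Re (fourier (cutoff N) t))"
    by (intro continuous_intros continuous_fourier[OF smooth_in_cutoff[OF assms]])
  then show ?thesis by (simp add: fourier_cutoff)
qed

text \<open>The averages only multiply the transform by factors of modulus at most one, so the decay of
  the bump's transform serves all \<open>N\<close>.\<close>

lemma kernel_decay: "\<exists>C>0. \<forall>N t. kernel N t \<le> C / (1 + \<bar>t\<bar>) ^ L"
proof -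
  obtain C0 where C0: "\<And>t. norm (bump_hat t) \<le> C0 / (1 + \<bar>t\<bar>) ^ 0" using bump_hat_decay[of 0] by blast
  obtain C1 where C1: "\<And>t. norm (bump_hat t) \<le> C1 / (1 + \<bar>t\<bar>) ^ L" using bump_hat_decay[of L] by blast
  have "kernel N t \<le> (C0 * C1) / (1 + \<bar>t\<bar>) ^ L" for N t
  proof -
    have "kernel N t \<le> 1 * norm (bump_hat t) ^ 2"
      unfolding kernel_def by (intro mult_right_mono power_le_one norm_box_hat_le) auto
    also have "\<dots> = norm (bump_hat t) * norm (bump_hat t)" by (simp add: power2_eq_square)
    also have "\<dots> \<le> C0 * (C1 / (1 + \<bar>t\<bar>) ^ L)"
      using C0[of t] C1[of t] order_trans[OF norm_ge_zero C0[of t]] by (intro mult_mono) auto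
    finally show ?thesis by simp
  qed
  moreover have "(C0 * C1) / (1 + \<bar>t\<bar>) ^ L \<le> (\<bar>C0 * C1\<bar> + 1) / (1 + \<bar>t\<bar>) ^ L" for t
    by (intro divide_right_mono) auto
  ultimately have "\<forall>N t. kernel N t \<le> (\<bar>C0 * C1\<bar> + 1) / (1 + \<bar>t\<bar>) ^ L"
    using order_trans by blast
  then show ?thesis by (intro exI[of _ "\<bar>C0 * C1\<bar> + 1"]) auto
qed

lemma integrable_inverse_square: "integrable lborel (\<lambda>t::real. C / (1 + \<bar>t\<bar>) ^ 2)"
proof -
  have "integrable lborel (\<lambda>t::real. inverse (1 + t ^ 2))"
    using integrable_inverse_1_plus_square by (simp add: set_integrable_def)
  then have "integrable lborel (\<lambda>t::real. \<bar>C\<bar> * inverse (1 + t ^ 2))"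
    by simp
  then show ?thesis
  proof (rule Bochner_Integration.integrable_bound)
    show "AE t in lborel. norm (C / (1 + \<bar>t\<bar>) ^ 2) \<le> norm (\<bar>C\<bar> * inverse (1 + t ^ 2))"
    proof (rule AE_I2)
      fix t :: real
      have "1 + t ^ 2 \<le> (1 + \<bar>t\<bar>) ^ 2" by (simp add: power2_eq_square algebra_simps)
      moreover have "0 < 1 + t ^ 2" by (simp add: add_pos_nonneg)
      ultimately have "\<bar>C\<bar> / (1 + \<bar>t\<bar>) ^ 2 \<le> \<bar>C\<bar> / (1 + t ^ 2)"
        by (intro divide_left_mono) auto
      then show "norm (C / (1 + \<bar>t\<bar>) ^ 2) \<le> norm (\<bar>C\<bar> * inverse (1 + t ^ 2))"
        by (simp add: abs_mult divide_inverse)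
    qed
  qed simp
qed

lemma kernel_integrable:
  assumes "1 \<le> N"
  shows "integrable lborel (kernel N)"
proof -
  obtain C where C: "\<And>t. kernel N t \<le> C / (1 + \<bar>t\<bar>) ^ 2" using kernel_decay[of 2] by blast
  show ?thesis
  proof (rule Bochner_Integration.integrable_bound[OF integrable_inverse_square])
    show "kernel N \<in> borel_measurable lborel"
      using borel_measurable_continuous_onI[OF kernel_continuous[OF assms]] by simp
    show "AE t in lborel. norm (kernel N t) \<le> norm (C / (1 + \<bar>t\<bar>) ^ 2)"
    proof (rule AE_I2)
      fix t
      have "norm (kernel N t) = kernel N t" by (simp add: kernel_nonneg)
      also have "\<dots> \<le> C / (1 + \<bar>t\<bar>) ^ 2" by (rule C)
      also have "\<dots> \<le> norm (C / (1 + \<bar>t\<bar>) ^ 2)" by (simp add: divide_right_mono)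
      finally show "norm (kernel N t) \<le> norm (C / (1 + \<bar>t\<bar>) ^ 2)" .
    qed
  qed
qed

text \<open>The factor of the \<open>N\<close> averages at \<open>t\<close> is at least \<open>(1 - \<bar>t\<bar> / N) ^ (2 * N)\<close>, which by Bernoulli's
  inequality stays away from zero near the origin, uniformly in \<open>N\<close>.\<close>

lemma kernel_mass: "\<exists>c>0. \<forall>N\<ge>1. c \<le> integral\<^sup>L lborel (kernel N)"
proof (intro exI[of _ "bump_mass ^ 2 / 16"] conjI allI impI)
  show "0 < bump_mass ^ 2 / 16" using bump_mass_pos by simp
  fix N :: nat assume N: "1 \<le> N"
  \<comment> \<open>For \<open>\<bar>t\<bar> \<le> 1/4\<close> the averages contribute at least \<open>1 / 2\<close>, the squared transform of the bump \<open>(bump_mass / 2)\<^sup>2\<close>.\<close>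
  have "bump_mass ^ 2 / 8 * indicator {- (1/4)..1/4} t \<le> kernel N t" for t
  proof (cases "t \<in> {- (1/4)..1/4::real}")
    case True
    then have t: "\<bar>t\<bar> \<le> 1/4" by auto
    have tN: "\<bar>t / N\<bar> \<le> 1" using t N by (simp add: field_simps)
    have "1/2 \<le> 1 + real (2 * N) * (- \<bar>t / N\<bar>)" using t N by simp
    also have "\<dots> \<le> (1 + - \<bar>t / N\<bar>) ^ (2 * N)" using tN by (intro Bernoulli_inequality) simp
    also have "\<dots> \<le> norm (box_hat (t / N)) ^ (2 * N)"
      using norm_box_hat_ge[of "t / N"] tN by (intro power_mono) auto
    finally have 1: "1/2 \<le> norm (box_hat (t / N)) ^ (2 * N)" .
    have "bump_mass / 2 \<le> norm (bump_hat t)" using t by (intro bump_hat_lower) simp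
    then have "(bump_mass / 2) ^ 2 \<le> norm (bump_hat t) ^ 2" using bump_mass_pos by (intro power_mono) auto
    with 1 have "1/2 * (bump_mass / 2) ^ 2 \<le> kernel N t"
      unfolding kernel_def by (intro mult_mono) auto
    then show ?thesis using True by (simp add: power2_eq_square)
  qed (simp add: kernel_nonneg)
  moreover have "integrable lborel (\<lambda>t::real. bump_mass ^ 2 / 8 * indicator {- (1/4)..1/4} t)"
    by (intro integrable_mult_right integrable_real_indicator emeasure_bounded_finite) auto
  ultimately have "integral\<^sup>L lborel (\<lambda>t::real. bump_mass ^ 2 / 8 * indicator {- (1/4)..1/4} t) \<le> integral\<^sup>L lborel (kernel N)"
    by (intro integral_mono kernel_integrable[OF N])
  then show "bump_mass ^ 2 / 16 \<le> integral\<^sup>L lborel (kernel N)" by simp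
qed

section \<open>Norming functionals\<close>

definition sublinear :: "('a::real_vector \<Rightarrow> real) \<Rightarrow> bool" where
  "sublinear p \<longleftrightarrow> (\<forall>x y. p (x + y) \<le> p x + p y) \<and> (\<forall>r>0. \<forall>x. p (r *\<^sub>R x) \<le> r * p x)"

lemma sublinear_add: "sublinear p \<Longrightarrow> p (x + y) \<le> p x + p y"
  by (simp add: sublinear_def)

lemma sublinear_scale:
  assumes "sublinear p" "0 < r"
  shows "p (r *\<^sub>R x) = r * p x"
proof (rule antisym)
  show "p (r *\<^sub>R x) \<le> r * p x" using assms by (simp add: sublinear_def)
  have "p (inverse r *\<^sub>R (r *\<^sub>R x)) \<le> inverse r * p (r *\<^sub>R x)"
    using assms by (simp only: sublinear_def positive_imp_inverse_positive)
  then show "r * p x \<le> p (r *\<^sub>R x)" using assms(2) by (simp add: field_simps)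
qed

lemma sublinear_0: "sublinear p \<Longrightarrow> p 0 = 0"
  using sublinear_scale[of p 2 0] by simp

lemma sublinear_minus: "sublinear p \<Longrightarrow> - p (- x) \<le> p x"
  using sublinear_add[of p x "- x"] sublinear_0[of p] by simp

text \<open>The largest sublinear function that lies below \<open>p\<close> and has value at most \<open>- p y\<close> at \<open>- y\<close>. It lets a
  minimal sublinear function be compared with a smaller one.\<close>

definition tilt :: "('a::real_vector \<Rightarrow> real) \<Rightarrow> 'a \<Rightarrow> 'a \<Rightarrow> real" where
  "tilt p y x = (INF t\<in>{0..}. p (x + t *\<^sub>R y) - t * p y)"

lemma tilt_lower:
  assumes "sublinear p" "0 \<le> t"
  shows "- p (- x) \<le> p (x + t *\<^sub>R y) - t * p y"
proof -
  have "p (t *\<^sub>R y) = t * p y"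
    using sublinear_scale[OF assms(1), of t y] sublinear_0[OF assms(1)] assms(2) by (cases "t = 0") auto
  moreover have "p (t *\<^sub>R y) \<le> p (x + t *\<^sub>R y) + p (- x)"
    using sublinear_add[OF assms(1), of "x + t *\<^sub>R y" "- x"] by simp
  ultimately show ?thesis by simp
qed

lemma tilt_le:
  assumes "sublinear p" "0 \<le> t"
  shows "tilt p y x \<le> p (x + t *\<^sub>R y) - t * p y"
  unfolding tilt_def
  by (rule cINF_lower) (use assms tilt_lower[OF assms(1)] in \<open>auto intro!: bdd_belowI2\<close>)

lemma sublinear_tilt:
  assumes "sublinear p"
  shows "sublinear (tilt p y)"
  unfolding sublinear_def
proof (intro conjI allI impI)
  fix x1 x2
  have *: "tilt p y (x1 + x2) \<le> (p (x1 + s *\<^sub>R y) - s * p y) + (p (x2 + t *\<^sub>R y) - t * p y)"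
    if "0 \<le> s" "0 \<le> t" for s t
  proof -
    have "tilt p y (x1 + x2) \<le> p (x1 + x2 + (s + t) *\<^sub>R y) - (s + t) * p y"
      using that by (intro tilt_le assms) simp
    also have "p (x1 + x2 + (s + t) *\<^sub>R y) \<le> p (x1 + s *\<^sub>R y) + p (x2 + t *\<^sub>R y)"
      using sublinear_add[OF assms, of "x1 + s *\<^sub>R y" "x2 + t *\<^sub>R y"] by (simp add: algebra_simps)
    finally show ?thesis by (simp add: algebra_simps)
  qed
  have "tilt p y (x1 + x2) - (p (x1 + s *\<^sub>R y) - s * p y) \<le> tilt p y x2" if "0 \<le> s" for s
    unfolding tilt_def[of p y x2]
    by (rule cINF_greatest) (use *[OF that] in \<open>auto simp: algebra_simps\<close>)
  then have "tilt p y (x1 + x2) - tilt p y x2 \<le> tilt p y x1"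
    unfolding tilt_def[of p y x1]
    by (intro cINF_greatest) (force simp: algebra_simps)+
  then show "tilt p y (x1 + x2) \<le> tilt p y x1 + tilt p y x2" by simp
next
  fix r :: real and x assume r: "0 < r"
  have "tilt p y (r *\<^sub>R x) / r \<le> p (x + t *\<^sub>R y) - t * p y" if "0 \<le> t" for t
  proof -
    have "tilt p y (r *\<^sub>R x) \<le> p (r *\<^sub>R x + (r * t) *\<^sub>R y) - (r * t) * p y"
      using that r by (intro tilt_le assms) simp
    also have "p (r *\<^sub>R x + (r * t) *\<^sub>R y) = r * p (x + t *\<^sub>R y)"
      using sublinear_scale[OF assms r, of "x + t *\<^sub>R y"] by (simp add: scaleR_add_right)
    finally show ?thesis using r by (simp add: field_simps)
  qed
  then have "tilt p y (r *\<^sub>R x) / r \<le> tilt p y x"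
    unfolding tilt_def[of p y x] by (intro cINF_greatest) auto
  then show "tilt p y (r *\<^sub>R x) \<le> r * tilt p y x" using r by (simp add: field_simps)
qed

text \<open>Zorn's lemma; the infimum of a chain is sublinear because two members of the chain can be replaced by the
  smaller one, and it is finite because every member is bounded below by \<open>- q (- x)\<close>.\<close>

lemma minimal_sublinear_below:
  assumes q: "sublinear (q :: 'a::real_vector \<Rightarrow> real)"
  obtains p where "sublinear p" "p \<le> q" "\<And>p'. sublinear p' \<Longrightarrow> p' \<le> p \<Longrightarrow> p' = p"
proof -
  define A where "A = {p. sublinear p \<and> p \<le> q}"
  have "\<exists>m\<in>A. \<forall>a\<in>A. a \<le> m \<longrightarrow> a = m"
  proof (rule predicate_Zorn[where P="\<lambda>a b. b \<le> a"])
    show "partial_order_on A (relation_of (\<lambda>a b. b \<le> a) A)"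
      by (rule partial_order_on_relation_ofI) auto
    fix C assume "C \<in> Chains (relation_of (\<lambda>a b. b \<le> a) A)"
    then have CA: "C \<subseteq> A" and chain: "\<And>a b. a \<in> C \<Longrightarrow> b \<in> C \<Longrightarrow> a \<le> b \<or> b \<le> a"
      by (auto simp: Chains_def relation_of_def)
    show "\<exists>u\<in>A. \<forall>a\<in>C. u \<le> a"
    proof (cases "C = {}")
      case True
      then show ?thesis using q by (auto simp: A_def intro!: bexI[of _ q])
    next
      case False
      define u where "u x = (INF p\<in>C. p x)" for x
      have sub: "sublinear p" "p x \<le> q x" if "p \<in> C" for p x
        using that CA by (auto simp: A_def le_fun_def)
      have "- q (- x) \<le> p x" if "p \<in> C" for p x
        using sublinear_minus[OF sub(1)[OF that], of x] sub(2)[OF that, of "- x"] by simp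
      then have bdd: "bdd_below ((\<lambda>p. p x) ` C)" for x by (intro bdd_belowI2)
      have u_le: "u x \<le> p x" if "p \<in> C" for p x
        unfolding u_def by (rule cINF_lower[OF bdd that])
      have "sublinear u"
        unfolding sublinear_def
      proof (intro conjI allI impI)
        fix x y
        have *: "u (x + y) \<le> p1 x + p2 y" if p12: "p1 \<in> C" "p2 \<in> C" for p1 p2
        proof -
          obtain p where p: "p \<in> C" "p \<le> p1" "p \<le> p2"
            using chain[OF p12] p12 by blast
          have "u (x + y) \<le> p (x + y)" using p(1) by (rule u_le)
          also have "\<dots> \<le> p x + p y" by (rule sublinear_add[OF sub(1)[OF p(1)]])
          also have "\<dots> \<le> p1 x + p2 y" using p(2,3) by (intro add_mono) (auto simp: le_fun_def)
          finally show ?thesis .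
        qed
        have "u (x + y) - p1 x \<le> u y" if "p1 \<in> C" for p1
          unfolding u_def[of y] by (rule cINF_greatest[OF False]) (use *[OF that] in \<open>simp add: algebra_simps\<close>)
        then have "u (x + y) - u y \<le> u x"
          unfolding u_def[of x] by (intro cINF_greatest[OF False]) (simp add: algebra_simps)
        then show "u (x + y) \<le> u x + u y" by simp
      next
        fix r :: real and x assume r: "0 < r"
        have "u (r *\<^sub>R x) / r \<le> p x" if "p \<in> C" for p
          using u_le[OF that, of "r *\<^sub>R x"] sublinear_scale[OF sub(1)[OF that] r, of x] r by (simp add: field_simps)
        then have "u (r *\<^sub>R x) / r \<le> u x"
          unfolding u_def[of x] by (intro cINF_greatest[OF False])
        then show "u (r *\<^sub>R x) \<le> r * u x" using r by (simp add: field_simps)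
      qed
      moreover have "u \<le> q"
        using False u_le sub(2) unfolding le_fun_def by (meson all_not_in_conv order_trans)
      ultimately show ?thesis using u_le by (intro bexI[of _ u]) (auto simp: A_def le_fun_def)
    qed
  qed
  then obtain m where "m \<in> A" and m: "\<And>a. a \<in> A \<Longrightarrow> a \<le> m \<Longrightarrow> a = m" by blast
  show ?thesis
  proof (rule that)
    show "sublinear m" "m \<le> q" using \<open>m \<in> A\<close> by (auto simp: A_def)
    show "p' = m" if "sublinear p'" "p' \<le> m" for p'
      using that \<open>m \<le> q\<close> by (intro m) (auto simp: A_def intro: order_trans)
  qed
qed

lemma sublinear_norm: "sublinear (norm :: 'a::real_normed_vector \<Rightarrow> real)"
  by (simp add: sublinear_def norm_triangle_ineq)

text \<open>A minimal sublinear function coincides with all its tilts, which makes it additive and therefore linear.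
  Starting below the norm tilted in the direction \<open>x\<close> forces the value \<open>norm x\<close> at \<open>x\<close>.\<close>

lemma real_norming_functional:
  fixes x :: "'a::real_normed_vector"
  obtains \<phi> where "linear \<phi>" "\<And>y. \<phi> y \<le> norm y" "\<phi> x = norm x"
proof -
  obtain p where p: "sublinear p" "p \<le> tilt norm x"
    and min: "\<And>p'. sublinear p' \<Longrightarrow> p' \<le> p \<Longrightarrow> p' = p"
    using minimal_sublinear_below[OF sublinear_tilt[OF sublinear_norm, of x]] by metis
  have add: "p (z + y) = p z + p y" for z y
  proof (rule antisym)
    show "p (z + y) \<le> p z + p y" by (rule sublinear_add[OF p(1)])
    have "tilt p y = p"
      using tilt_le[OF p(1), of 0 y] by (intro min sublinear_tilt p) (auto simp: le_fun_def)
    then show "p z + p y \<le> p (z + y)"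
      using tilt_le[OF p(1), of 1 y z] by simp
  qed
  have minus: "p (- z) = - p z" for z
    using add[of z "- z"] sublinear_0[OF p(1)] by simp
  have scale: "p (r *\<^sub>R z) = r * p z" for r z
  proof (cases r "0::real" rule: linorder_cases)
    case less
    then show ?thesis using sublinear_scale[OF p(1), of "- r" "- z"] minus by simp
  qed (simp_all add: sublinear_0[OF p(1)] sublinear_scale[OF p(1)])
  have le: "p y \<le> norm y" for y
    using p(2) tilt_le[OF sublinear_norm, of 0 x y] by (force simp: le_fun_def intro: order_trans)
  have "p (- x) \<le> - norm x"
    using p(2) tilt_le[OF sublinear_norm, of 1 x "- x"] by (force simp: le_fun_def intro: order_trans)
  with minus[of x] le[of x] have "p x = norm x" by simp
  moreover have "linear p" by (rule linearI) (simp_all add: add scale)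
  ultimately show ?thesis using that[of p] le by blast
qed

definition functional :: "('x::complex_banach \<Rightarrow> complex) \<Rightarrow> bool" where
  "functional \<Phi> \<longleftrightarrow> (\<forall>x y. \<Phi> (x + y) = \<Phi> x + \<Phi> y) \<and> (\<forall>c x. \<Phi> (c *\<^sub>C x) = c * \<Phi> x) \<and>
    (\<forall>x. norm (\<Phi> x) \<le> norm x)"

lemma functional_bounded_linear: "functional \<Phi> \<Longrightarrow> bounded_linear \<Phi>"
  by (rule bounded_linear_intro[where K=1])
     (simp_all add: functional_def, metis scaleC_of_real scaleR_conv_of_real)

lemma functional_scaleC: "functional \<Phi> \<Longrightarrow> \<Phi> (c *\<^sub>C x) = c * \<Phi> x"
  and functional_norm: "functional \<Phi> \<Longrightarrow> norm (\<Phi> x) \<le> norm x"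
  by (simp_all add: functional_def)

text \<open>The usual complexification \<open>\<phi> y - i * \<phi> (i y)\<close> of a real functional; its norm does not increase because
  its values can be rotated to be real.\<close>

lemma norming_functional:
  fixes x :: "'x::complex_banach"
  obtains \<Phi> where "functional \<Phi>" "norm (\<Phi> x) = norm x"
proof -
  obtain \<phi> where \<phi>: "linear \<phi>" "\<And>y. \<phi> y \<le> norm y" "\<phi> x = norm x"
    using real_norming_functional[of x] by blast
  define \<Phi> where "\<Phi> y = Complex (\<phi> y) (- \<phi> (\<i> *\<^sub>C y))" for y
  have add: "\<Phi> (y + z) = \<Phi> y + \<Phi> z" for y z
    by (simp add: \<Phi>_def linear_add[OF \<phi>(1)] scaleC_add_right complex_eq_iff)
  have decomp: "\<phi> (c *\<^sub>C y) = Re c * \<phi> y + Im c * \<phi> (\<i> *\<^sub>C y)" for c y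
  proof -
    have "c *\<^sub>C y = of_real (Re c) *\<^sub>C y + (of_real (Im c) * \<i>) *\<^sub>C y"
      unfolding scaleC_add_left[symmetric] by (simp add: complex_eq[of c, symmetric] mult.commute)
    also have "\<dots> = Re c *\<^sub>R y + Im c *\<^sub>R (\<i> *\<^sub>C y)"
      by (simp only: scaleC_of_real scaleC_scaleC[symmetric])
    finally show ?thesis by (simp only: linear_add[OF \<phi>(1)] linear_scale[OF \<phi>(1)] real_scaleR_def)
  qed
  have scale: "\<Phi> (c *\<^sub>C y) = c * \<Phi> y" for c y
    using decomp[of c y] decomp[of "\<i> * c" y] by (simp add: \<Phi>_def complex_eq_iff scaleC_scaleC)
  have le: "norm (\<Phi> y) \<le> norm y" for y
  proof (cases "\<Phi> y = 0")
    case False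
    define c where "c = cnj (sgn (\<Phi> y))"
    have "norm c = 1" using False by (simp add: c_def norm_sgn)
    have "c = cnj (\<Phi> y) / of_real (norm (\<Phi> y))"
      by (simp add: c_def sgn_eq)
    then have "c * \<Phi> y = (\<Phi> y * cnj (\<Phi> y)) / of_real (norm (\<Phi> y))" by simp
    also have "\<dots> = of_real (norm (\<Phi> y))"
      using False unfolding complex_norm_square[symmetric] by (simp add: power2_eq_square)
    finally have "c * \<Phi> y = of_real (norm (\<Phi> y))" .
    then have "norm (\<Phi> y) = \<phi> (c *\<^sub>C y)"
      by (metis scale \<Phi>_def complex.sel(1) Re_complex_of_real)
    also have "\<dots> \<le> norm (c *\<^sub>C y)" by (rule \<phi>)
    also have "\<dots> = norm y" using \<open>norm c = 1\<close> by (simp add: norm_scaleC)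
    finally show ?thesis .
  qed simp
  have "norm x \<le> norm (\<Phi> x)"
    using complex_Re_le_cmod[of "\<Phi> x"] \<phi>(3) by (simp add: \<Phi>_def)
  with le have "norm (\<Phi> x) = norm x" by (simp add: antisym)
  moreover have "functional \<Phi>" using add scale le by (simp add: functional_def)
  ultimately show ?thesis using that by blast
qed

text \<open>One norming functional for each point of \<open>D\<close>. Bounds are extended to the closure by approximation,
  and are stated with values in \<open>ennreal\<close> so that \<open>B = \<infinity>\<close> can express the absence of a bound.\<close>

lemma countable_norming_family:
  fixes D :: "'x::complex_banach set"
  assumes "countable D"
  obtains \<F> where "countable \<F>" "\<And>\<Phi>. \<Phi> \<in> \<F> \<Longrightarrow> functional \<Phi>"
    "\<And>x B. x \<in> closure D \<Longrightarrow> (\<And>\<Phi>. \<Phi> \<in> \<F> \<Longrightarrow> ennreal (norm (\<Phi> x)) \<le> B) \<Longrightarrow> ennreal (norm x) \<le> B"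
proof -
  define N where "N d = (SOME \<Phi>. functional \<Phi> \<and> norm (\<Phi> d) = norm d)" for d :: 'x
  have "\<exists>\<Phi>. functional \<Phi> \<and> norm (\<Phi> d) = norm d" for d :: 'x
    using norming_functional[of d] by metis
  then have N: "functional (N d)" "norm (N d d) = norm d" for d
    unfolding N_def by (metis (mono_tags, lifting) someI_ex)+
  show ?thesis
  proof (rule that[of "N ` D"])
    show "countable (N ` D)" using assms by simp
    show "functional \<Phi>" if "\<Phi> \<in> N ` D" for \<Phi> using that N by auto
    fix x B assume x: "x \<in> closure D" and B: "\<And>\<Phi>. \<Phi> \<in> N ` D \<Longrightarrow> ennreal (norm (\<Phi> x)) \<le> B"
    show "ennreal (norm x) \<le> B"
    proof (rule ennreal_le_epsilon)
      fix e :: real assume "0 < e" "B < top"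
      obtain d where d: "d \<in> D" "dist d x < e / 2"
        using x \<open>0 < e\<close> unfolding closure_approachable by (metis half_gt_zero)
      have "norm (N d (d - x)) \<le> norm (d - x)" by (rule functional_norm[OF N(1)])
      moreover have "N d (d - x) = N d d - N d x"
        using functional_bounded_linear[OF N(1)] by (simp add: bounded_linear.linear linear_diff)
      ultimately have "norm d \<le> norm (N d x) + norm (d - x)"
        using N(2)[of d] norm_triangle_sub[of "N d d" "N d x"] by simp
      moreover have "norm x \<le> norm d + norm (d - x)"
        using norm_triangle_sub[of x d] by (simp add: norm_minus_commute)
      ultimately have "norm x \<le> norm (N d x) + e"
        using d(2) by (simp add: dist_norm)
      then have "ennreal (norm x) \<le> ennreal (norm (N d x)) + ennreal e"
        using \<open>0 < e\<close> by (simp flip: ennreal_plus)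
      also have "\<dots> \<le> B + ennreal e" using B d(1) by (intro add_right_mono) auto
      finally show "ennreal (norm x) \<le> B + ennreal e" .
    qed
  qed
qed

section \<open>Bochner integrals and functionals\<close>

text \<open>In a nonseparable space sums and products of measurable functions need not be measurable. They are when one of
  the functions takes only finitely many values.\<close>

lemma measurable_simple_combine:
  assumes s: "simple_function M s" and f: "\<And>y. (\<lambda>x. f y x) \<in> measurable M N"
  shows "(\<lambda>x. f (s x) x) \<in> measurable M N"
proof (rule measurable_compose_countable'[where I="s ` space M"])
  show "s \<in> measurable M (count_space (s ` space M))"
    using measurable_simple_function[OF s] by (auto simp: measurable_def)
  show "countable (s ` space M)"
    using s by (simp add: simple_function_def countable_finite)
qed (rule f)

lemma norm_diff_simple_measurable:
  fixes f :: "'a \<Rightarrow> 'b::real_normed_vector"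
  assumes f: "f \<in> borel_measurable M" and s: "simple_function M s"
  shows "(\<lambda>x. norm (f x - s x)) \<in> borel_measurable M"
proof (rule measurable_simple_combine[OF s])
  fix y :: 'b
  have "(\<lambda>z. norm (z - y)) \<in> borel_measurable borel"
    by (intro borel_measurable_continuous_onI continuous_intros)
  then show "(\<lambda>x. norm (f x - y)) \<in> borel_measurable M"
    by (rule measurable_compose[OF f])
qed

lemma simple_bochner_integral_distance:
  fixes f :: "'a \<Rightarrow> 'b::real_normed_vector"
  assumes f: "f \<in> borel_measurable M"
    and s: "Bochner_Integration.simple_bochner_integrable M s"
    and t: "Bochner_Integration.simple_bochner_integrable M t"
  shows "ennreal (norm (Bochner_Integration.simple_bochner_integral M s - Bochner_Integration.simple_bochner_integral M t)) \<le>
    (\<integral>\<^sup>+ x. norm (f x - s x) \<partial>M) + (\<integral>\<^sup>+ x. norm (f x - t x) \<partial>M)"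
    (is "ennreal (norm (?s - ?t)) \<le> ?S + ?T")
proof -
  have st: "simple_function M s" "simple_function M t"
    using s t by (auto elim: Bochner_Integration.simple_bochner_integrable.cases)
  have "ennreal (norm (?s - ?t)) = norm (Bochner_Integration.simple_bochner_integral M (\<lambda>x. s x - t x))"
    using s t by (subst simple_bochner_integral_diff) auto
  also have "\<dots> \<le> Bochner_Integration.simple_bochner_integral M (\<lambda>x. norm (s x - t x))"
    by (intro ennreal_leI simple_bochner_integral_norm_bound simple_bochner_integrable_compose2[of "(-)"] s t) simp
  also have "\<dots> = (\<integral>\<^sup>+x. norm (s x - t x) \<partial>M)"
    by (intro simple_bochner_integral_eq_nn_integral simple_bochner_integrable_compose2[of "\<lambda>x y. norm (x - y)"] s t) auto
  also have "\<dots> \<le> (\<integral>\<^sup>+x. ennreal (norm (f x - s x)) + ennreal (norm (f x - t x)) \<partial>M)"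
  proof (rule nn_integral_mono)
    fix x
    have "norm (s x - t x) \<le> norm (f x - s x) + norm (f x - t x)"
      by (metis dual_order.refl norm_diff_triangle_le norm_minus_commute)
    then show "ennreal (norm (s x - t x)) \<le> ennreal (norm (f x - s x)) + ennreal (norm (f x - t x))"
      by (simp flip: ennreal_plus)
  qed
  also have "\<dots> = ?S + ?T"
    by (intro nn_integral_add measurable_compose[OF _ measurable_ennreal] norm_diff_simple_measurable f st)
  finally show ?thesis .
qed

text \<open>Truncating the approximating simple functions at twice the norm of \<open>f\<close> gives integrable simple functions and
  makes dominated convergence applicable.\<close>

lemma bochner_integrableI:
  fixes f :: "'a \<Rightarrow> 'b::banach"
  assumes f: "f \<in> borel_measurable M" and sm: "strongly_measurable M f"
    and fin: "(\<integral>\<^sup>+ x. ennreal (norm (f x)) \<partial>M) < \<infinity>"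
  shows "bochner_integrable M f"
proof -
  obtain s where s: "\<And>i. simple_function M (s i)" and lim: "AE x in M. (\<lambda>i. s i x) \<longlonglongrightarrow> f x"
    using sm unfolding strongly_measurable_def by blast
  have nf[measurable]: "(\<lambda>x. norm (f x)) \<in> borel_measurable M"
    by (rule measurable_compose[OF f]) (intro borel_measurable_continuous_onI continuous_intros)
  define t where "t i x = (if norm (s i x) \<le> 2 * norm (f x) then s i x else 0)" for i x
  have t: "simple_function M (t i)" for i
    unfolding t_def
  proof (rule simple_function_If[OF s])
    have [measurable]: "(\<lambda>x. norm (s i x)) \<in> borel_measurable M"
      by (rule borel_measurable_simple_function[OF simple_function_compose1[OF s]])
    show "{x \<in> space M. norm (s i x) \<le> 2 * norm (f x)} \<in> sets M" by measurable
  qed simp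
  have t_le: "norm (t i x) \<le> 2 * norm (f x)" for i x by (simp add: t_def)
  have tint: "Bochner_Integration.simple_bochner_integrable M (t i)" for i
  proof (rule simple_bochner_integrableI_bounded[OF t])
    have "(\<integral>\<^sup>+ x. ennreal (norm (t i x)) \<partial>M) \<le> (\<integral>\<^sup>+ x. 2 * ennreal (norm (f x)) \<partial>M)"
      using t_le by (intro nn_integral_mono) (simp add: ennreal_mult'[symmetric] flip: ennreal_numeral)
    also have "\<dots> = 2 * (\<integral>\<^sup>+ x. ennreal (norm (f x)) \<partial>M)" by (rule nn_integral_cmult) simp
    also have "\<dots> < \<infinity>" using fin by (simp add: ennreal_mult_less_top)
    finally show "(\<integral>\<^sup>+ x. ennreal (norm (t i x)) \<partial>M) < \<infinity>" .
  qed
  have "(\<lambda>i. \<integral>\<^sup>+ x. ennreal (norm (f x - t i x)) \<partial>M) \<longlonglongrightarrow> (\<integral>\<^sup>+ x. 0 \<partial>M)"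
  proof (rule nn_integral_dominated_convergence[where w="\<lambda>x. 3 * ennreal (norm (f x))"])
    show "(\<lambda>x. ennreal (norm (f x - t i x))) \<in> borel_measurable M" for i
      by (intro measurable_compose[OF _ measurable_ennreal] norm_diff_simple_measurable f t)
    have "(\<integral>\<^sup>+ x. 3 * ennreal (norm (f x)) \<partial>M) = 3 * (\<integral>\<^sup>+ x. ennreal (norm (f x)) \<partial>M)"
      by (rule nn_integral_cmult) simp
    then show "(\<integral>\<^sup>+ x. 3 * ennreal (norm (f x)) \<partial>M) < \<infinity>" using fin by (simp add: ennreal_mult_less_top)
    show "AE x in M. ennreal (norm (f x - t i x)) \<le> 3 * ennreal (norm (f x))" for i
    proof (rule AE_I2)
      fix x
      have "norm (f x - t i x) \<le> 3 * norm (f x)"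
        using norm_triangle_ineq4[of "f x" "t i x"] t_le[of i x] by linarith
      then show "ennreal (norm (f x - t i x)) \<le> 3 * ennreal (norm (f x))"
        by (simp add: ennreal_mult'[symmetric] flip: ennreal_numeral)
    qed
    show "AE x in M. (\<lambda>i. ennreal (norm (f x - t i x))) \<longlonglongrightarrow> 0"
      using lim
    proof eventually_elim
      case (elim x)
      have "(\<lambda>i. t i x) \<longlonglongrightarrow> f x"
      proof (cases "f x = 0")
        case True
        then have "t i x = 0" for i by (simp add: t_def)
        then show ?thesis using True by simp
      next
        case False
        then have "eventually (\<lambda>i. norm (s i x) < 2 * norm (f x)) sequentially"
          by (intro order_tendstoD[OF tendsto_norm[OF elim]]) simp
        then have "eventually (\<lambda>i. s i x = t i x) sequentially"
          by eventually_elim (simp add: t_def)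
        with elim show ?thesis by (rule Lim_transform_eventually)
      qed
      then have "(\<lambda>i. norm (f x - t i x)) \<longlonglongrightarrow> norm (f x - f x)"
        by (intro tendsto_intros)
      then show ?case using tendsto_ennrealI by fastforce
    qed
  qed (use f in simp_all)
  then have conv: "(\<lambda>i. \<integral>\<^sup>+ x. ennreal (norm (f x - t i x)) \<partial>M) \<longlonglongrightarrow> 0" by simp
  have "Cauchy (\<lambda>i. Bochner_Integration.simple_bochner_integral M (t i))"
  proof (rule CauchyI)
    fix e :: real assume e: "0 < e"
    then have "0 < ennreal (e / 2)" by simp
    from order_tendstoD(2)[OF conv this] obtain m
      where m: "\<And>n. n \<ge> m \<Longrightarrow> (\<integral>\<^sup>+ x. ennreal (norm (f x - t n x)) \<partial>M) < ennreal (e / 2)"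
      by (auto simp: eventually_sequentially)
    show "\<exists>m. \<forall>n\<ge>m. \<forall>k\<ge>m. norm (Bochner_Integration.simple_bochner_integral M (t n) - Bochner_Integration.simple_bochner_integral M (t k)) < e"
    proof (intro exI[of _ m] allI impI)
      fix n k assume "m \<le> n" "m \<le> k"
      have "ennreal (norm (Bochner_Integration.simple_bochner_integral M (t n) - Bochner_Integration.simple_bochner_integral M (t k)))
          \<le> (\<integral>\<^sup>+ x. norm (f x - t n x) \<partial>M) + (\<integral>\<^sup>+ x. norm (f x - t k x) \<partial>M)"
        by (rule simple_bochner_integral_distance[OF f tint tint])
      also have "\<dots> < ennreal (e / 2) + ennreal (e / 2)"
        using m[OF \<open>m \<le> n\<close>] m[OF \<open>m \<le> k\<close>] by (rule add_strict_mono)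
      also have "\<dots> = ennreal e" using e by (simp flip: ennreal_plus)
      finally show "norm (Bochner_Integration.simple_bochner_integral M (t n) - Bochner_Integration.simple_bochner_integral M (t k)) < e"
        using e by (simp add: ennreal_less_iff)
    qed
  qed
  then obtain x where "(\<lambda>i. Bochner_Integration.simple_bochner_integral M (t i)) \<longlonglongrightarrow> x"
    using Cauchy_convergent convergent_def by blast
  then show ?thesis
    unfolding bochner_integrable_def has_bochner_int_def using f tint conv by blast
qed

lemma has_bochner_int_functional:
  assumes \<Phi>: "functional \<Phi>" and "has_bochner_int M f x"
  shows "has_bochner_integral M (\<lambda>y. \<Phi> (f y)) (\<Phi> x)"
proof -
  interpret bounded_linear \<Phi> by (rule functional_bounded_linear[OF \<Phi>])
  obtain s where f: "f \<in> borel_measurable M"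
    and s: "\<And>i. Bochner_Integration.simple_bochner_integrable M (s i)"
    and conv: "(\<lambda>i. \<integral>\<^sup>+ y. ennreal (norm (f y - s i y)) \<partial>M) \<longlonglongrightarrow> 0"
    and lim: "(\<lambda>i. Bochner_Integration.simple_bochner_integral M (s i)) \<longlonglongrightarrow> x"
    using assms(2) unfolding has_bochner_int_def by blast
  show ?thesis
  proof (rule has_bochner_integral.intros)
    show "(\<lambda>y. \<Phi> (f y)) \<in> borel_measurable M"
      by (rule measurable_compose[OF f borel_measurable_continuous_onI[OF continuous_on[OF continuous_on_id]]])
    show "Bochner_Integration.simple_bochner_integrable M (\<lambda>y. \<Phi> (s i y))" for i
      using simple_bochner_integrable_compose2[of "\<lambda>x y. \<Phi> x" M "s i" "s i"] s zero by simp
    show "(\<lambda>i. Bochner_Integration.simple_bochner_integral M (\<lambda>y. \<Phi> (s i y))) \<longlonglongrightarrow> \<Phi> x"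
      using tendsto[OF lim] by (simp add: simple_bochner_integral_linear[OF linear_axioms s])
    show "(\<lambda>i. \<integral>\<^sup>+ y. ennreal (norm (\<Phi> (f y) - \<Phi> (s i y))) \<partial>M) \<longlonglongrightarrow> 0"
    proof (rule tendsto_sandwich[OF _ _ tendsto_const conv])
      show "eventually (\<lambda>i. (\<integral>\<^sup>+ y. ennreal (norm (\<Phi> (f y) - \<Phi> (s i y))) \<partial>M) \<le> (\<integral>\<^sup>+ y. ennreal (norm (f y - s i y)) \<partial>M)) sequentially"
        by (intro always_eventually allI nn_integral_mono ennreal_leI) (simp add: functional_norm[OF \<Phi>] flip: diff)
    qed simp
  qed
qed

text \<open>Functionals also show that the integral is unique, so that \<open>bochner_int\<close> really is the value.\<close>

lemma bochner_int_functional: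
  assumes \<Phi>: "functional \<Phi>" and f: "bochner_integrable M f"
  shows "integrable M (\<lambda>y. \<Phi> (f y))" and "\<Phi> (bochner_int M f) = integral\<^sup>L M (\<lambda>y. \<Phi> (f y))"
proof -
  have unique: "x = y" if x: "has_bochner_int M f x" and y: "has_bochner_int M f y" for x y
  proof -
    obtain \<Psi> where \<Psi>: "functional \<Psi>" "norm (\<Psi> (x - y)) = norm (x - y)" by (rule norming_functional)
    have "\<Psi> x = \<Psi> y"
      by (rule has_bochner_integral_eq[OF has_bochner_int_functional[OF \<Psi>(1) x] has_bochner_int_functional[OF \<Psi>(1) y]])
    then have "\<Psi> (x - y) = 0"
      using functional_bounded_linear[OF \<Psi>(1)] by (simp add: bounded_linear.linear linear_diff)
    with \<Psi>(2) show ?thesis by simp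
  qed
  obtain x where x: "has_bochner_int M f x" using f unfolding bochner_integrable_def by blast
  then have "bochner_int M f = x"
    unfolding bochner_int_def using f unique by (auto intro: the_equality)
  with has_bochner_int_functional[OF \<Phi> x]
  show "integrable M (\<lambda>y. \<Phi> (f y))" "\<Phi> (bochner_int M f) = integral\<^sup>L M (\<lambda>y. \<Phi> (f y))"
    by (simp_all add: has_bochner_integral_iff)
qed

text \<open>The countable set collects the values of the approximating simple functions; the distance of \<open>f\<close> to it has
  integral zero.\<close>

lemma bochner_integrable_imp_essentially_separable:
  fixes f :: "'a \<Rightarrow> 'b::real_normed_vector"
  assumes "bochner_integrable M f"
  obtains D where "countable D" "AE x in M. f x \<in> closure D" "0 \<in> D"
proof -
  obtain s where f: "f \<in> borel_measurable M"
    and s: "\<And>i. Bochner_Integration.simple_bochner_integrable M (s i)"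
    and conv: "(\<lambda>i. \<integral>\<^sup>+ y. ennreal (norm (f y - s i y)) \<partial>M) \<longlonglongrightarrow> 0"
    using assms unfolding bochner_integrable_def has_bochner_int_def by blast
  define D where "D = insert 0 (\<Union>i::nat. s i ` space M)"
  have sf: "simple_function M (s i)" for i
    using s by (auto elim: Bochner_Integration.simple_bochner_integrable.cases)
  have "countable D"
    unfolding D_def by (intro countable_insert countable_UN countableI_type countable_finite simple_functionD(1)[OF sf])
  have D: "D \<noteq> {}" by (simp add: D_def)
  have inf: "infdist (f x) D \<le> norm (f x - s i x)" if "x \<in> space M" for x i
    using infdist_le[of "s i x" D "f x"] that by (auto simp: D_def dist_norm)
  have meas: "(\<lambda>x. infdist (f x) D) \<in> borel_measurable M"
    by (rule measurable_compose[OF f]) (intro borel_measurable_continuous_onI continuous_intros)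
  have "(\<integral>\<^sup>+ x. ennreal (infdist (f x) D) \<partial>M) \<le> 0"
    by (rule tendsto_lowerbound[OF conv]) (auto intro!: always_eventually nn_integral_mono ennreal_leI inf)
  then have "(\<integral>\<^sup>+ x. ennreal (infdist (f x) D) \<partial>M) = 0" by simp
  then have "AE x in M. ennreal (infdist (f x) D) = 0"
    using meas by (subst (asm) nn_integral_0_iff_AE) auto
  then have "AE x in M. f x \<in> closure D"
    by eventually_elim (simp add: in_closure_iff_infdist_zero[OF D] infdist_nonneg antisym)
  moreover have "0 \<in> D" by (simp add: D_def)
  ultimately show ?thesis using that \<open>countable D\<close> by blast
qed

text \<open>The \<open>i\<close>-th approximation takes the closest among the first \<open>i + 1\<close> points of a dense sequence.\<close>

lemma strongly_measurableI_separable: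
  fixes f :: "'a \<Rightarrow> 'b::real_normed_vector"
  assumes f: "f \<in> borel_measurable M" and "countable D" "D \<noteq> {}" and AE: "AE x in M. f x \<in> closure D"
  shows "strongly_measurable M f"
proof -
  define d where "d = from_nat_into D"
  define s where "s = rec_nat (\<lambda>_. d 0) (\<lambda>i s x. if norm (f x - d (Suc i)) < norm (f x - s x) then d (Suc i) else s x)"
  have s0: "s 0 = (\<lambda>_. d 0)" and sS: "s (Suc i) = (\<lambda>x. if norm (f x - d (Suc i)) < norm (f x - s i x) then d (Suc i) else s i x)" for i
    unfolding s_def by simp_all
  have simp: "simple_function M (s i)" for i
  proof (induction i)
    case (Suc i)
    have [measurable]: "(\<lambda>x. norm (f x - d (Suc i))) \<in> borel_measurable M" "(\<lambda>x. norm (f x - s i x)) \<in> borel_measurable M"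
      by (intro norm_diff_simple_measurable[OF f] Suc simple_function_const)+
    show ?case
      unfolding sS by (intro simple_function_If Suc simple_function_const) measurable
  qed (simp add: s0)
  have best: "norm (f x - s i x) \<le> norm (f x - d k)" if "k \<le> i" for i k x
    using that
  proof (induction i)
    case (Suc i)
    then show ?case by (cases "k = Suc i") (auto simp: sS)
  qed (simp add: s0)
  have "AE x in M. (\<lambda>i. s i x) \<longlonglongrightarrow> f x"
    using AE
  proof eventually_elim
    case (elim x)
    show ?case
    proof (rule metric_LIMSEQ_I)
      fix e :: real assume "0 < e"
      then obtain y where "y \<in> D" "dist y (f x) < e" using elim closure_approachable by blast
      then obtain k where k: "norm (f x - d k) < e"
        using from_nat_into_surj[OF \<open>countable D\<close>] by (metis d_def dist_commute dist_norm)
      show "\<exists>n0. \<forall>n\<ge>n0. dist (s n x) (f x) < e"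
        using best[of k _ x] k by (intro exI[of _ k]) (auto simp: dist_norm norm_minus_commute intro: le_less_trans)
    qed
  qed
  with simp show ?thesis unfolding strongly_measurable_def by blast
qed

lemma tendsto_scaleC:
  fixes x :: "nat \<Rightarrow> 'x::complex_banach"
  assumes "c \<longlonglongrightarrow> c'" "x \<longlonglongrightarrow> x'"
  shows "(\<lambda>i. c i *\<^sub>C x i) \<longlonglongrightarrow> c' *\<^sub>C x'"
proof -
  have neg: "c *\<^sub>C (- y) = - (c *\<^sub>C y)" "(- c) *\<^sub>C y = - (c *\<^sub>C y)" for c and y :: 'x
    by (metis scaleC_scaleC mult.commute of_real_1 of_real_minus scaleC_of_real scaleR_minus1_left mult_minus1)+
  have "bounded_bilinear (scaleC :: complex \<Rightarrow> 'x \<Rightarrow> 'x)"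
  proof
    show "\<exists>K. \<forall>a b. norm (a *\<^sub>C (b::'x)) \<le> norm a * norm b * K"
      by (intro exI[of _ 1]) (simp add: norm_scaleC)
    show "(r *\<^sub>R a) *\<^sub>C b = r *\<^sub>R (a *\<^sub>C b)" for r a and b :: 'x
      by (metis scaleC_of_real scaleC_scaleC scaleR_conv_of_real)
    show "a *\<^sub>C (r *\<^sub>R b) = r *\<^sub>R (a *\<^sub>C b)" for r a and b :: 'x
      by (metis scaleC_of_real scaleC_scaleC mult.commute)
  qed (simp_all add: scaleC_add_left scaleC_add_right)
  from bounded_bilinear.tendsto[OF this assms] show ?thesis .
qed

lemma scaleC_measurable:
  fixes f :: "'a \<Rightarrow> 'x::complex_banach"
  assumes c: "c \<in> borel_measurable M" and f: "f \<in> borel_measurable M" and sm: "strongly_measurable M f"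
  shows "(\<lambda>x. c x *\<^sub>C f x) \<in> borel_measurable M" "strongly_measurable M (\<lambda>x. c x *\<^sub>C f x)"
proof -
  obtain C where C: "\<And>i. simple_function M (C i)" "\<And>x. x \<in> space M \<Longrightarrow> (\<lambda>i. C i x) \<longlonglongrightarrow> c x"
    using borel_measurable_implies_sequence_metric[OF c, of 0] by blast
  obtain s where s: "\<And>i. simple_function M (s i)" "AE x in M. (\<lambda>i. s i x) \<longlonglongrightarrow> f x"
    using sm unfolding strongly_measurable_def by blast
  show "(\<lambda>x. c x *\<^sub>C f x) \<in> borel_measurable M"
  proof (rule borel_measurable_LIMSEQ_metric)
    show "(\<lambda>x. C i x *\<^sub>C f x) \<in> borel_measurable M" for i
    proof (rule measurable_simple_combine[OF C(1)])
      fix y :: complex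
      have "continuous_on UNIV (\<lambda>z::'x. y *\<^sub>C z)"
        by (auto simp: continuous_on_sequentially o_def intro: tendsto_scaleC)
      then show "(\<lambda>x. y *\<^sub>C f x) \<in> borel_measurable M"
        by (intro measurable_compose[OF f] borel_measurable_continuous_onI)
    qed
    show "(\<lambda>i. C i x *\<^sub>C f x) \<longlonglongrightarrow> c x *\<^sub>C f x" if "x \<in> space M" for x
      by (intro tendsto_scaleC C(2) that tendsto_const)
  qed
  have "AE x in M. (\<lambda>i. C i x *\<^sub>C s i x) \<longlonglongrightarrow> c x *\<^sub>C f x"
    using s(2) AE_space by eventually_elim (intro tendsto_scaleC C(2))
  then show "strongly_measurable M (\<lambda>x. c x *\<^sub>C f x)"
    unfolding strongly_measurable_def
    using simple_function_compose2[OF C(1) s(1), of scaleC] by (intro exI[of _ "\<lambda>i x. C i x *\<^sub>C s i x"]) auto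
qed

lemma loc_integrable_essentially_separable:
  fixes f :: "real \<Rightarrow> 'b::real_normed_vector"
  assumes f: "loc_integrable U f" and U: "U = (\<Union>n::nat. K n)" and K: "\<And>n. compact (K n)"
  shows "f \<in> borel_measurable (lebesgue_on U)"
    and "\<exists>D. countable D \<and> 0 \<in> D \<and> (AE x in lebesgue_on U. f x \<in> closure D)"
proof -
  have Km: "K n \<in> sets lebesgue" for n
    by (intro sets_completionI_sets) (simp add: borel_closed compact_imp_closed K)
  then have Um: "U \<in> sets lebesgue" unfolding U by auto
  have int: "bochner_integrable (lebesgue_on (K n)) f" for n
    using f K unfolding loc_integrable_def U by blast
  then have fm: "f \<in> borel_measurable (lebesgue_on (K n))" for n
    unfolding bochner_integrable_def has_bochner_int_def by blast
  show "f \<in> borel_measurable (lebesgue_on U)"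
  proof (rule measurableI)
    fix A :: "'b set" assume A: "A \<in> sets borel"
    have "f -` A \<inter> K n \<in> sets lebesgue" for n
      using measurable_sets[OF fm[of n] A] Km[of n] by (simp add: sets_restrict_space_iff)
    then have "(\<Union>n. f -` A \<inter> K n) \<in> sets lebesgue" by (intro sets.countable_nat_UN) auto
    moreover have "f -` A \<inter> U = (\<Union>n. f -` A \<inter> K n)" by (auto simp: U)
    ultimately have "f -` A \<inter> U \<in> sets lebesgue" by (simp only:)
    then show "f -` A \<inter> space (lebesgue_on U) \<in> sets (lebesgue_on U)"
      using Um by (simp add: sets_restrict_space_iff)
  qed simp
  have "\<forall>n. \<exists>D. countable D \<and> (AE x in lebesgue_on (K n). f x \<in> closure D) \<and> 0 \<in> D"
    using bochner_integrable_imp_essentially_separable[OF int] by metis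
  then obtain D where D: "\<And>n. countable (D n)" "\<And>n. AE x in lebesgue_on (K n). f x \<in> closure (D n)" "\<And>n. 0 \<in> D n"
    by metis
  have "AE x in lebesgue. x \<in> K n \<longrightarrow> f x \<in> closure (D n)" for n
    using D(2)[of n] Km[of n] by (simp add: AE_restrict_space_iff)
  then have "AE x in lebesgue. \<forall>n. x \<in> K n \<longrightarrow> f x \<in> closure (D n)" by (simp add: AE_all_countable)
  then have "AE x in lebesgue. x \<in> U \<longrightarrow> f x \<in> closure (\<Union>n. D n)"
    by eventually_elim (metis U UN_iff UN_upper UNIV_I closure_mono subsetD)
  then have "AE x in lebesgue_on U. f x \<in> closure (\<Union>n. D n)"
    using Um by (simp add: AE_restrict_space_iff)
  then show "\<exists>D. countable D \<and> 0 \<in> D \<and> (AE x in lebesgue_on U. f x \<in> closure D)"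
    using D by (intro exI[of _ "\<Union>n. D n"]) auto
qed

section \<open>Mollification\<close>

text \<open>By outer regularity \<open>A\<close> lies in an open \<open>T\<close> of almost the same measure, and most points of \<open>A\<close> keep a
  fixed distance from the complement of \<open>T\<close>. Outside of the small remainder \<open>R\<close> and its translate a small shift
  does not change membership in \<open>A\<close>.\<close>

lemma translate_indicator_L1:
  fixes A :: "real set"
  assumes A: "A \<in> sets lborel" "emeasure lborel A < \<infinity>" and e: "0 < (e::real)"
  obtains d where "0 < d"
    "\<And>s. \<bar>s\<bar> < d \<Longrightarrow> (\<integral>\<^sup>+ x. ennreal \<bar>indicator A (x + s) - indicator A x\<bar> \<partial>lborel) \<le> ennreal e"
proof -
  have e4: "0 < e / 4" using e by simp
  have "A \<in> sets lebesgue" using A by simp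
  from sets_lebesgue_outer_open[OF this e4] obtain T
    where T: "open T" "A \<subseteq> T" "emeasure lebesgue (T - A) < ennreal (e / 4)" by blast
  have TA: "emeasure lborel (T - A) < ennreal (e / 4)"
    using T A by (simp add: emeasure_completion[symmetric] main_part_sets)
  \<comment> \<open>The points of \<open>T\<close> at distance at least \<open>1 / (n + 1)\<close> from its complement.\<close>
  define U where "U n = {x. ball x (1 / real (Suc n)) \<subseteq> T}" for n
  have "closed (U n)" for n
  proof -
    have "- U n = (\<Union>y\<in>- T. ball y (1 / real (Suc n)))"
      by (auto simp: U_def ball_def dist_commute)
    then show ?thesis by (auto simp: closed_def)
  qed
  then have Um[measurable]: "U n \<in> sets borel" for n by (rule borel_closed)
  define B where "B n = A \<inter> U n" for n
  have Bm[measurable]: "B n \<in> sets lborel" for n using A Um unfolding B_def by auto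
  have U_mono: "U n \<subseteq> U (Suc n)" for n
  proof -
    have "1 / real (Suc (Suc n)) \<le> 1 / real (Suc n)" by (simp add: field_simps)
    then show ?thesis unfolding U_def using subset_ball by blast
  qed
  have "A \<subseteq> (\<Union>n. B n)"
  proof
    fix x assume "x \<in> A"
    then obtain r where r: "0 < r" "ball x r \<subseteq> T" using T(1,2) open_contains_ball by blast
    obtain n where "1 / real (Suc n) < r" using nat_approx_posE[OF r(1)] by blast
    then have "x \<in> B n" using r \<open>x \<in> A\<close> subset_ball[of "1 / real (Suc n)" r x] by (auto simp: B_def U_def)
    then show "x \<in> (\<Union>n. B n)" by blast
  qed
  then have empty: "(\<Inter>n. A - B n) = {}" by auto
  have "(\<lambda>n. emeasure lborel (A - B n)) \<longlonglongrightarrow> emeasure lborel (\<Inter>n. A - B n)"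
  proof (rule Lim_emeasure_decseq)
    show "decseq (\<lambda>n. A - B n)" using U_mono by (auto simp: decseq_Suc_iff B_def)
    show "range (\<lambda>n. A - B n) \<subseteq> sets lborel" using A Bm by (auto intro: sets.Diff)
    show "emeasure lborel (A - B n) \<noteq> \<infinity>" for n
      using emeasure_mono[of "A - B n" A lborel] A by (auto simp: top_unique)
  qed
  then have "(\<lambda>n. emeasure lborel (A - B n)) \<longlonglongrightarrow> 0" by (simp only: empty emeasure_empty)
  from order_tendstoD(2)[OF this, of "ennreal (e / 4)"] e4 obtain n
    where n: "emeasure lborel (A - B n) < ennreal (e / 4)"
    by (auto simp: eventually_sequentially)
  define R where "R = T - B n"
  have R[measurable]: "R \<in> sets borel" using T(1) Bm[of n] by (auto simp: R_def)
  have "R = (T - A) \<union> (A - B n)" using T(2) by (auto simp: R_def B_def)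
  moreover have "T - A \<in> sets lborel" using T(1) A by auto
  moreover have "A - B n \<in> sets lborel" using A Bm by auto
  ultimately have "emeasure lborel R \<le> emeasure lborel (T - A) + emeasure lborel (A - B n)"
    by (simp add: emeasure_subadditive)
  also have "\<dots> \<le> ennreal (e / 4) + ennreal (e / 4)"
    using TA n by (intro add_mono) auto
  also have "\<dots> = ennreal (e / 2)" using e by (simp flip: ennreal_plus)
  finally have mR: "emeasure lborel R \<le> ennreal (e / 2)" .
  show ?thesis
  proof (rule that[of "1 / real (Suc n)"])
    fix s :: real assume s: "\<bar>s\<bar> < 1 / real (Suc n)"
    have near: "y \<in> T" if "x \<in> B n" "\<bar>y - x\<bar> < 1 / real (Suc n)" for x y
      using that by (auto simp: B_def U_def ball_def dist_real_def subset_iff abs_minus_commute)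
    have "ennreal \<bar>indicator A (x + s) - indicator A x\<bar> \<le> indicator R x + indicator R (0 + 1 * (x + s))" for x
    proof (cases "(x + s \<in> A) = (x \<in> A)")
      case False
      have "x \<in> R \<or> x + s \<in> R"
        using False near[of x "x + s"] near[of "x + s" x] s T(2) by (auto simp: R_def B_def)
      then show ?thesis by (auto simp: indicator_def)
    qed (simp add: indicator_def)
    then have "(\<integral>\<^sup>+ x. ennreal \<bar>indicator A (x + s) - indicator A x\<bar> \<partial>lborel)
        \<le> (\<integral>\<^sup>+ x. indicator R x + indicator R (x + s) \<partial>lborel)"
      by (intro nn_integral_mono) simp
    also have "\<dots> = (\<integral>\<^sup>+ x. indicator R x \<partial>lborel) + (\<integral>\<^sup>+ x. indicator R (x + s) \<partial>lborel)"
      by (intro nn_integral_add) auto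
    also have "(\<integral>\<^sup>+ x. indicator R (x + s) \<partial>lborel) = (\<integral>\<^sup>+ x. indicator R x \<partial>lborel)"
      using nn_integral_real_affine[of "indicator R" 1 s] by (simp add: add.commute)
    also have "(\<integral>\<^sup>+ x. indicator R x \<partial>lborel) = emeasure lborel R" by simp
    also have "emeasure lborel R + emeasure lborel R \<le> ennreal (e / 2) + ennreal (e / 2)"
      by (intro add_mono mR)
    also have "\<dots> = ennreal e" using e by (simp flip: ennreal_plus)
    finally show "(\<integral>\<^sup>+ x. ennreal \<bar>indicator A (x + s) - indicator A x\<bar> \<partial>lborel) \<le> ennreal e" .
  qed simp
qed

text \<open>Continuity of translation in \<open>L\<^sup>1\<close> passes from indicator functions to sums and limits.\<close>

lemma translate_L1:
  fixes h :: "real \<Rightarrow> complex"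
  assumes "integrable lborel h" and "0 < (e::real)"
  shows "\<exists>d>0. \<forall>s. \<bar>s\<bar> < d \<longrightarrow> (\<integral>\<^sup>+ x. ennreal (norm (h (x + s) - h x)) \<partial>lborel) \<le> ennreal e"
  using assms
proof (induction arbitrary: e rule: integrable_induct)
  case (base A c)
  have "0 < e / (norm c + 1)" using base by (simp add: add_nonneg_pos)
  from translate_indicator_L1[OF base(1,2) this] obtain d where d: "0 < d"
    "\<And>s. \<bar>s\<bar> < d \<Longrightarrow> (\<integral>\<^sup>+ x. ennreal \<bar>indicator A (x + s) - indicator A x\<bar> \<partial>lborel) \<le> ennreal (e / (norm c + 1))"
    by blast
  have [measurable]: "A \<in> sets borel" using base by simp
  have "(\<integral>\<^sup>+ x. ennreal (norm (indicator A (x + s) *\<^sub>R c - indicator A x *\<^sub>R c)) \<partial>lborel) \<le> ennreal e" if "\<bar>s\<bar> < d" for s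
  proof -
    have "(\<integral>\<^sup>+ x. ennreal (norm (indicator A (x + s) *\<^sub>R c - indicator A x *\<^sub>R c)) \<partial>lborel)
      = (\<integral>\<^sup>+ x. ennreal (norm c) * ennreal \<bar>indicator A (x + s) - indicator A x\<bar> \<partial>lborel)"
      by (intro nn_integral_cong) (simp add: scaleR_diff_left[symmetric] ennreal_mult'[symmetric] mult.commute)
    also have "\<dots> = ennreal (norm c) * (\<integral>\<^sup>+ x. ennreal \<bar>indicator A (x + s) - indicator A x\<bar> \<partial>lborel)"
      by (intro nn_integral_cmult) measurable
    also have "\<dots> \<le> ennreal (norm c) * ennreal (e / (norm c + 1))"
      by (intro mult_left_mono d that) simp
    also have "\<dots> = ennreal (norm c * (e / (norm c + 1)))"
      by (rule ennreal_mult'[symmetric]) simp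
    finally have le: "(\<integral>\<^sup>+ x. ennreal (norm (indicator A (x + s) *\<^sub>R c - indicator A x *\<^sub>R c)) \<partial>lborel) \<le> \<dots>" .
    have "norm c / (norm c + 1) \<le> 1" by (simp add: divide_le_eq_1 add_nonneg_pos)
    then have "e * (norm c / (norm c + 1)) \<le> e * 1" using base(3) by (intro mult_left_mono) auto
    then have "ennreal (norm c * (e / (norm c + 1))) \<le> ennreal e" by (intro ennreal_leI) (simp add: mult.commute)
    with le show ?thesis by (rule order_trans)
  qed
  then show ?case using d(1) by blast
next
  case (add f g)
  have [measurable]: "f \<in> borel_measurable borel" "g \<in> borel_measurable borel"
    using add by (simp_all add: borel_measurable_integrable)
  have e2: "0 < e / 2" using add by simp
  from add.IH(1)[OF e2] obtain d1 where d1: "0 < d1" "\<And>s. \<bar>s\<bar> < d1 \<Longrightarrow> (\<integral>\<^sup>+ x. ennreal (norm (f (x + s) - f x)) \<partial>lborel) \<le> ennreal (e / 2)" by blast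
  from add.IH(2)[OF e2] obtain d2 where d2: "0 < d2" "\<And>s. \<bar>s\<bar> < d2 \<Longrightarrow> (\<integral>\<^sup>+ x. ennreal (norm (g (x + s) - g x)) \<partial>lborel) \<le> ennreal (e / 2)" by blast
  have "(\<integral>\<^sup>+ x. ennreal (norm (f (x + s) + g (x + s) - (f x + g x))) \<partial>lborel) \<le> ennreal e" if "\<bar>s\<bar> < min d1 d2" for s
  proof -
    have "(\<integral>\<^sup>+ x. ennreal (norm (f (x + s) + g (x + s) - (f x + g x))) \<partial>lborel)
      \<le> (\<integral>\<^sup>+ x. ennreal (norm (f (x + s) - f x)) + ennreal (norm (g (x + s) - g x)) \<partial>lborel)"
      by (intro nn_integral_mono) (auto simp: norm_diff_triangle_ineq ennreal_leI simp flip: ennreal_plus)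
    also have "\<dots> = (\<integral>\<^sup>+ x. ennreal (norm (f (x + s) - f x)) \<partial>lborel) + (\<integral>\<^sup>+ x. ennreal (norm (g (x + s) - g x)) \<partial>lborel)"
      by (intro nn_integral_add) measurable
    also have "\<dots> \<le> ennreal (e / 2) + ennreal (e / 2)"
      using that by (intro add_mono d1 d2) auto
    also have "\<dots> = ennreal e" using add by (simp flip: ennreal_plus)
    finally show ?thesis .
  qed
  then show ?case using d1(1) d2(1) by (intro exI[of _ "min d1 d2"]) auto
next
  case (lim f s)
  have [measurable]: "f \<in> borel_measurable borel" "\<And>i. s i \<in> borel_measurable borel"
    using lim by (simp_all add: borel_measurable_integrable)
  have "(\<lambda>i. (\<integral>\<^sup>+x. norm (f x - s i x) \<partial>lborel)) \<longlonglongrightarrow> 0"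
  proof (rule nn_integral_dominated_convergence_norm[where w="\<lambda>x. 2 * norm (f x)"])
    show "(\<integral>\<^sup>+x. ennreal (2 * norm (f x)) \<partial>lborel) < \<infinity>"
      using lim.hyps(4) by (simp add: integrable_iff_bounded ennreal_mult' nn_integral_cmult ennreal_mult_less_top)
  qed (use lim.hyps in auto)
  from order_tendstoD(2)[OF this, of "ennreal (e / 3)"] \<open>0 < e\<close> obtain i
    where i: "(\<integral>\<^sup>+x. norm (f x - s i x) \<partial>lborel) < ennreal (e / 3)"
    by (auto simp: eventually_sequentially)
  have "0 < e / 3" using \<open>0 < e\<close> by simp
  from lim.IH[OF this, of i] obtain d where d: "0 < d"
    "\<And>t. \<bar>t\<bar> < d \<Longrightarrow> (\<integral>\<^sup>+ x. ennreal (norm (s i (x + t) - s i x)) \<partial>lborel) \<le> ennreal (e / 3)" by blast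
  have "(\<integral>\<^sup>+ x. ennreal (norm (f (x + t) - f x)) \<partial>lborel) \<le> ennreal e" if "\<bar>t\<bar> < d" for t
  proof -
    have "norm (f (x + t) - f x) \<le> norm (f (x + t) - s i (x + t)) + norm (s i (x + t) - s i x) + norm (f x - s i x)" for x
      using norm_triangle_ineq[of "f (x + t) - s i (x + t)" "s i (x + t) - s i x"]
        norm_triangle_ineq[of "f (x + t) - s i x" "s i x - f x"] by (simp add: norm_minus_commute)
    then have "(\<integral>\<^sup>+ x. ennreal (norm (f (x + t) - f x)) \<partial>lborel)
      \<le> (\<integral>\<^sup>+ x. ennreal (norm (f (x + t) - s i (x + t))) + ennreal (norm (s i (x + t) - s i x)) + ennreal (norm (f x - s i x)) \<partial>lborel)"
      by (intro nn_integral_mono) (auto simp: ennreal_leI simp flip: ennreal_plus)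
    also have "\<dots> = (\<integral>\<^sup>+ x. ennreal (norm (f (x + t) - s i (x + t))) \<partial>lborel) + (\<integral>\<^sup>+ x. ennreal (norm (s i (x + t) - s i x)) \<partial>lborel) + (\<integral>\<^sup>+ x. ennreal (norm (f x - s i x)) \<partial>lborel)"
      by (subst nn_integral_add, measurable, subst nn_integral_add, measurable)
    also have "(\<integral>\<^sup>+ x. ennreal (norm (f (x + t) - s i (x + t))) \<partial>lborel) = (\<integral>\<^sup>+ x. ennreal (norm (f x - s i x)) \<partial>lborel)"
      using nn_integral_real_affine[of "\<lambda>x. ennreal (norm (f x - s i x))" 1 t] by (simp add: add.commute)
    also have "(\<integral>\<^sup>+ x. ennreal (norm (f x - s i x)) \<partial>lborel) + (\<integral>\<^sup>+ x. ennreal (norm (s i (x + t) - s i x)) \<partial>lborel) + (\<integral>\<^sup>+ x. ennreal (norm (f x - s i x)) \<partial>lborel)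
      \<le> ennreal (e / 3) + ennreal (e / 3) + ennreal (e / 3)"
      using i by (intro add_mono d that) auto
    also have "\<dots> = ennreal e" using \<open>0 < e\<close> by (simp flip: ennreal_plus)
    finally show ?thesis .
  qed
  then show ?case using d(1) by blast
qed

text \<open>The mollifiers live on \<open>[0, \<delta>]\<close>, to the right of the origin, so that mollifying at \<open>t > 0\<close> uses no values
  at negative times.\<close>

definition moll :: "real \<Rightarrow> real \<Rightarrow> real" where
  "moll \<delta> s = bump (s / \<delta>) / (\<delta> * bump_mass)"

lemma moll_nonneg: "0 < \<delta> \<Longrightarrow> 0 \<le> moll \<delta> s"
  using bump_mass_pos by (simp add: moll_def bump_nonneg)

lemma bump_outside: "s \<notin> {0..1} \<Longrightarrow> bump s = 0"
  using smooth_in_outside[OF smooth_in_bump, of s] by simp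

lemma moll_outside: "0 < \<delta> \<Longrightarrow> s \<notin> {0..\<delta>} \<Longrightarrow> moll \<delta> s = 0"
  by (auto simp: moll_def bump_outside field_simps)

lemma bump_measurable [measurable]: "bump \<in> borel_measurable borel"
  by (rule borel_measurable_continuous_onI[OF continuous_bump])

lemma moll_measurable [measurable]: "moll \<delta> \<in> borel_measurable borel"
  unfolding moll_def[abs_def] by measurable

lemma has_bochner_integral_moll_1: "has_bochner_integral lborel (moll 1) 1"
proof -
  have "has_bochner_integral lebesgue bump bump_mass"
    unfolding bump_mass_def by (rule continuous_in_has_bochner_integral[OF continuous_bump bump_outside])
  then have "has_bochner_integral lborel bump bump_mass"
    by (simp add: has_bochner_integral_iff integrable_completion integral_completion)
  then have "has_bochner_integral lborel (\<lambda>s. bump s / bump_mass) (bump_mass / bump_mass)"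
    by (rule has_bochner_integral_divide_zero)
  then show ?thesis using bump_mass_pos by (simp add: moll_def[abs_def])
qed

lemma moll_scale: "0 < \<delta> \<Longrightarrow> moll \<delta> s = moll 1 (s / \<delta>) / \<delta>"
  by (simp add: moll_def)

lemma moll_bounded: "\<exists>C. \<forall>s. \<bar>moll 1 s\<bar> \<le> C"
proof -
  obtain C where "\<And>s. norm (of_real (bump s) :: complex) \<le> C"
    using smooth_in_bounded[OF smooth_in_bump] by blast
  then have "\<bar>moll 1 s\<bar> \<le> C / bump_mass" for s
    using bump_mass_pos by (simp add: moll_def divide_right_mono)
  then show ?thesis by blast
qed

definition mollify :: "real \<Rightarrow> (real \<Rightarrow> complex) \<Rightarrow> real \<Rightarrow> complex" where
  "mollify \<delta> h t = (LINT s|lborel. moll \<delta> (s - t) *\<^sub>R h s)"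

lemma mollify_eq:
  assumes "0 < \<delta>"
  shows "mollify \<delta> h t = (LINT u|lborel. moll 1 u *\<^sub>R h (t + \<delta> * u))"
proof -
  have "mollify \<delta> h t = \<bar>\<delta>\<bar> *\<^sub>R (LINT u|lborel. moll \<delta> (t + \<delta> * u - t) *\<^sub>R h (t + \<delta> * u))"
    unfolding mollify_def by (rule lborel_integral_real_affine) (use assms in simp)
  also have "\<dots> = (LINT u|lborel. \<delta> *\<^sub>R (moll \<delta> (t + \<delta> * u - t) *\<^sub>R h (t + \<delta> * u)))"
    using assms by (simp del: scaleR_scaleR)
  also have "\<dots> = (LINT u|lborel. moll 1 u *\<^sub>R h (t + \<delta> * u))"
    using assms by (intro Bochner_Integration.integral_cong) (auto simp: moll_scale[OF assms])
  finally show ?thesis .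
qed

lemma integrable_moll_mult:
  fixes h :: "real \<Rightarrow> complex"
  assumes "integrable lborel h" "0 < \<delta>"
  shows "integrable lborel (\<lambda>u. moll 1 u *\<^sub>R h (t + \<delta> * u))"
proof -
  obtain C where C: "\<And>s. \<bar>moll 1 s\<bar> \<le> C" using moll_bounded by blast
  have [measurable]: "h \<in> borel_measurable borel" using assms by (simp add: borel_measurable_integrable)
  have "integrable lborel (\<lambda>u. C *\<^sub>R h (t + \<delta> * u))"
    by (intro integrable_scaleR_right lborel_integrable_real_affine) (use assms in auto)
  then show ?thesis
  proof (rule Bochner_Integration.integrable_bound)
    show "AE u in lborel. norm (moll 1 u *\<^sub>R h (t + \<delta> * u)) \<le> norm (C *\<^sub>R h (t + \<delta> * u))"
      using C by (auto intro!: AE_I2 mult_right_mono intro: order_trans[OF _ abs_ge_self])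
  qed measurable
qed

lemma mollify_L1:
  fixes h :: "real \<Rightarrow> complex"
  assumes h: "integrable lborel h" and e: "0 < (e::real)"
  shows "\<exists>d>0. \<forall>\<delta>. 0 < \<delta> \<longrightarrow> \<delta> < d \<longrightarrow> (\<integral>\<^sup>+ t. ennreal (norm (mollify \<delta> h t - h t)) \<partial>lborel) \<le> ennreal e"
proof -
  obtain d where d: "0 < d" "\<And>s. \<bar>s\<bar> < d \<Longrightarrow> (\<integral>\<^sup>+ x. ennreal (norm (h (x + s) - h x)) \<partial>lborel) \<le> ennreal e"
    using translate_L1[OF h e] by blast
  have hm[measurable]: "h \<in> borel_measurable borel" using h by (simp add: borel_measurable_integrable)
  have "(\<integral>\<^sup>+ t. ennreal (norm (mollify \<delta> h t - h t)) \<partial>lborel) \<le> ennreal e" if \<delta>: "0 < \<delta>" "\<delta> < d" for \<delta>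
  proof -
    have "ennreal (norm (mollify \<delta> h t - h t)) \<le> (\<integral>\<^sup>+ u. ennreal (moll 1 u) * ennreal (norm (h (t + \<delta> * u) - h t)) \<partial>lborel)" for t
    proof -
      have i2: "has_bochner_integral lborel (\<lambda>u. moll 1 u *\<^sub>R h t) (1 *\<^sub>R h t)"
        by (intro has_bochner_integral_scaleR_left has_bochner_integral_moll_1)
      have "mollify \<delta> h t - h t = (LINT u|lborel. moll 1 u *\<^sub>R h (t + \<delta> * u)) - (LINT u|lborel. moll 1 u *\<^sub>R h t)"
        using i2 by (simp add: mollify_eq[OF \<delta>(1)] has_bochner_integral_iff)
      also have "\<dots> = (LINT u|lborel. moll 1 u *\<^sub>R h (t + \<delta> * u) - moll 1 u *\<^sub>R h t)"
        using i2 integrable_moll_mult[OF h \<delta>(1)] by (simp add: has_bochner_integral_iff)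
      finally have eq: "mollify \<delta> h t - h t = (LINT u|lborel. moll 1 u *\<^sub>R h (t + \<delta> * u) - moll 1 u *\<^sub>R h t)" .
      have "integrable lborel (\<lambda>u. moll 1 u *\<^sub>R h (t + \<delta> * u) - moll 1 u *\<^sub>R h t)"
        using i2 integrable_moll_mult[OF h \<delta>(1), of t] by (simp add: has_bochner_integral_iff)
      then have "ennreal (norm (mollify \<delta> h t - h t)) \<le> (\<integral>\<^sup>+ u. ennreal (norm (moll 1 u *\<^sub>R h (t + \<delta> * u) - moll 1 u *\<^sub>R h t)) \<partial>lborel)"
        unfolding eq by (rule integral_norm_bound_ennreal)
      also have "\<dots> = (\<integral>\<^sup>+ u. ennreal (moll 1 u) * ennreal (norm (h (t + \<delta> * u) - h t)) \<partial>lborel)"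
        by (intro nn_integral_cong) (simp add: scaleR_diff_right[symmetric] ennreal_mult'[symmetric] moll_nonneg)
      finally show ?thesis .
    qed
    then have "(\<integral>\<^sup>+ t. ennreal (norm (mollify \<delta> h t - h t)) \<partial>lborel)
      \<le> (\<integral>\<^sup>+ t. \<integral>\<^sup>+ u. ennreal (moll 1 u) * ennreal (norm (h (t + \<delta> * u) - h t)) \<partial>lborel \<partial>lborel)"
      by (intro nn_integral_mono)
    also have "\<dots> = (\<integral>\<^sup>+ u. \<integral>\<^sup>+ t. ennreal (moll 1 u) * ennreal (norm (h (t + \<delta> * u) - h t)) \<partial>lborel \<partial>lborel)"
      by (rule lborel_pair.Fubini') measurable
    also have "\<dots> \<le> (\<integral>\<^sup>+ u. ennreal (moll 1 u) * ennreal e \<partial>lborel)"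
    proof (rule nn_integral_mono)
      fix u :: real
      show "(\<integral>\<^sup>+ t. ennreal (moll 1 u) * ennreal (norm (h (t + \<delta> * u) - h t)) \<partial>lborel) \<le> ennreal (moll 1 u) * ennreal e"
      proof (cases "u \<in> {0..1}")
        case True
        then have "\<delta> * u \<le> \<delta>" "0 \<le> \<delta> * u" using \<delta> by (simp_all add: mult_left_le)
        then have "\<bar>\<delta> * u\<bar> < d" using \<delta>(2) by linarith
        then show ?thesis
          by (subst nn_integral_cmult, measurable) (intro mult_left_mono d(2), auto)
      qed (simp add: moll_outside)
    qed
    also have "\<dots> = (\<integral>\<^sup>+ u. ennreal (moll 1 u) \<partial>lborel) * ennreal e"
      by (rule nn_integral_multc) measurable
    also have "(\<integral>\<^sup>+ u. ennreal (moll 1 u) \<partial>lborel) = 1"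
      using has_bochner_integral_moll_1 by (subst nn_integral_eq_integral) (auto simp: has_bochner_integral_iff moll_nonneg)
    finally show ?thesis by simp
  qed
  then show ?thesis using d(1) by blast
qed

text \<open>Convergence in \<open>L\<^sup>1\<close> gives almost everywhere convergence along a subsequence.\<close>

lemma mollify_AE:
  fixes h :: "real \<Rightarrow> complex"
  assumes h: "integrable lborel h"
  obtains \<delta> :: "nat \<Rightarrow> real" where "\<And>k. 0 < \<delta> k" "\<delta> \<longlonglongrightarrow> 0" "AE t in lborel. (\<lambda>k. mollify (\<delta> k) h t) \<longlonglongrightarrow> h t"
proof -
  have hm[measurable]: "h \<in> borel_measurable borel" using h by (simp add: borel_measurable_integrable)
  have mm[measurable]: "mollify \<delta> h \<in> borel_measurable borel" for \<delta>
    unfolding mollify_def[abs_def] by measurable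
  obtain d where d: "\<And>k::nat. 0 < d k"
    "\<And>k \<delta>. 0 < \<delta> \<Longrightarrow> \<delta> < d k \<Longrightarrow> (\<integral>\<^sup>+ t. ennreal (norm (mollify \<delta> h t - h t)) \<partial>lborel) \<le> ennreal (1 / real (Suc k))"
  proof -
    have "\<forall>k::nat. \<exists>d>0. \<forall>\<delta>. 0 < \<delta> \<longrightarrow> \<delta> < d \<longrightarrow> (\<integral>\<^sup>+ t. ennreal (norm (mollify \<delta> h t - h t)) \<partial>lborel) \<le> ennreal (1 / real (Suc k))"
      by (intro allI mollify_L1[OF h]) simp
    from choice[OF this] show ?thesis using that by blast
  qed
  define \<delta> where "\<delta> k = min (d k) (1 / real (Suc k)) / 2" for k
  have \<delta>: "0 < \<delta> k" "\<delta> k < d k" "\<delta> k \<le> 1 / real (Suc k)" for k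
    using d(1)[of k] by (auto simp: \<delta>_def min_def field_simps)
  have lim: "(\<lambda>k. 1 / real (Suc k)) \<longlonglongrightarrow> 0"
    using LIMSEQ_inverse_real_of_nat by (simp add: inverse_eq_divide)
  define u where "u k t = mollify (\<delta> k) h t - h t" for k t
  have nn: "(\<integral>\<^sup>+ t. ennreal (norm (u k t)) \<partial>lborel) \<le> ennreal (1 / real (Suc k))" for k
    unfolding u_def by (rule d(2)[OF \<delta>(1,2)])
  have um[measurable]: "u k \<in> borel_measurable borel" for k unfolding u_def by measurable
  have ui: "integrable lborel (u k)" for k
    unfolding integrable_iff_bounded using nn[of k] by (auto intro: le_less_trans)
  have "(LINT t|lborel. norm (u k t)) \<le> 1 / real (Suc k)" for k
    using nn[of k] ui[of k] by (subst (asm) nn_integral_eq_integral) auto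
  then have "(\<lambda>k. LINT t|lborel. norm (u k t)) \<longlonglongrightarrow> 0"
    by (intro tendsto_sandwich[OF _ _ tendsto_const lim]) auto
  from tendsto_L1_AE_subseq[OF ui this] obtain r :: "nat \<Rightarrow> nat"
    where r: "strict_mono r" "AE t in lborel. (\<lambda>k. u (r k) t) \<longlonglongrightarrow> 0" by blast
  show ?thesis
  proof (rule that[of "\<delta> \<circ> r"])
    have "\<delta> \<longlonglongrightarrow> 0"
      by (rule tendsto_sandwich[OF _ _ tendsto_const lim]) (use \<delta>(1,3) in \<open>auto intro!: always_eventually less_imp_le\<close>)
    then show "(\<delta> \<circ> r) \<longlonglongrightarrow> 0" by (rule LIMSEQ_subseq_LIMSEQ[OF _ r(1)])
    show "AE t in lborel. (\<lambda>k. mollify ((\<delta> \<circ> r) k) h t) \<longlonglongrightarrow> h t"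
      using r(2) by eventually_elim (simp add: u_def LIM_zero_iff)
  qed (simp add: \<delta>(1))
qed

lemma borel_representative:
  fixes h :: "real \<Rightarrow> complex"
  assumes "h \<in> borel_measurable lebesgue"
  obtains h' where "h' \<in> borel_measurable borel" "AE t in lborel. h t = h' t"
proof -
  obtain a where a: "a \<in> borel_measurable lborel" "AE t in lborel. Re (h t) = a t"
    using completion_ex_borel_measurable_real[of "\<lambda>t. Re (h t)" lborel] assms by auto
  obtain b where b: "b \<in> borel_measurable lborel" "AE t in lborel. Im (h t) = b t"
    using completion_ex_borel_measurable_real[of "\<lambda>t. Im (h t)" lborel] assms by auto
  show ?thesis
  proof (rule that[of "\<lambda>t. Complex (a t) (b t)"])
    have "(\<lambda>t. of_real (a t) + \<i> * of_real (b t)) \<in> borel_measurable borel" using a(1) b(1) by simp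
    then show "(\<lambda>t. Complex (a t) (b t)) \<in> borel_measurable borel" by (simp add: complex_eq[symmetric] Complex_eq)
    show "AE t in lborel. h t = Complex (a t) (b t)"
      using a(2) b(2) by eventually_elim (simp add: complex_eq_iff)
  qed
qed

text \<open>The scales \<open>\<delta> k\<close> serve all points of a compact interval at once, because a difference involves several points.\<close>

lemma mollify_local:
  fixes h :: "real \<Rightarrow> complex"
  assumes h: "h \<in> borel_measurable lebesgue" and li: "\<And>b. set_integrable lebesgue {-b..b} h"
  obtains Z where "Z \<in> null_sets lebesgue"
    "\<And>b. \<exists>\<delta>::nat \<Rightarrow> real. (\<forall>k. 0 < \<delta> k) \<and> \<delta> \<longlonglongrightarrow> 0 \<and>
       (\<forall>t\<in>{-b..b} - Z. (\<lambda>k. LINT s|lebesgue. moll (\<delta> k) (s - t) *\<^sub>R h s) \<longlonglongrightarrow> h t)"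
proof -
  obtain h' where h'm[measurable]: "h' \<in> borel_measurable borel" and AEh: "AE t in lborel. h t = h' t"
    using borel_representative[OF h] by blast
  have AEh': "AE t in lebesgue. h t = h' t" using AEh by (rule AE_completion)
  define H where "H n t = indicator {- (real n + 1)..real n + 1} t *\<^sub>R h' t" for n :: nat and t
  have Hm[measurable]: "H n \<in> borel_measurable borel" for n unfolding H_def by measurable
  have HI: "integrable lborel (H n)" for n
  proof -
    have "integrable lebesgue (\<lambda>t. indicator {- (real n + 1)..real n + 1} t *\<^sub>R h t)"
      using li[of "real n + 1"] by (simp add: set_integrable_def)
    then have "integrable lebesgue (H n)"
    proof (rule Bochner_Integration.integrable_bound)
      show "H n \<in> borel_measurable lebesgue" by (rule measurable_completion) simp
      show "AE t in lebesgue. norm (H n t) \<le> norm (indicator {- (real n + 1)..real n + 1} t *\<^sub>R h t)"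
        using AEh' by eventually_elim (simp add: H_def)
    qed
    then show ?thesis by (simp add: integrable_completion)
  qed
  have "\<forall>n. \<exists>\<delta>. (\<forall>k. 0 < \<delta> k) \<and> \<delta> \<longlonglongrightarrow> 0 \<and> (AE t in lborel. (\<lambda>k. mollify (\<delta> k) (H n) t) \<longlonglongrightarrow> H n t)"
    using mollify_AE[OF HI] by metis
  then obtain \<delta> where \<delta>: "\<And>n k. 0 < \<delta> n k" "\<And>n. \<delta> n \<longlonglongrightarrow> 0"
    "\<And>n. AE t in lborel. (\<lambda>k. mollify (\<delta> n k) (H n) t) \<longlonglongrightarrow> H n t" by metis
  have "AE t in lborel. h t = h' t \<and> (\<forall>n. (\<lambda>k. mollify (\<delta> n k) (H n) t) \<longlonglongrightarrow> H n t)"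
    using AEh \<delta>(3) by (simp add: AE_all_countable)
  then obtain Z where Z: "Z \<in> null_sets lborel"
    "\<And>t. t \<notin> Z \<Longrightarrow> h t = h' t \<and> (\<forall>n. (\<lambda>k. mollify (\<delta> n k) (H n) t) \<longlonglongrightarrow> H n t)"
    by (auto simp: eventually_ae_filter)
  show ?thesis
  proof (rule that[of Z])
    show "Z \<in> null_sets lebesgue" using Z(1) by (rule null_sets_completionI)
    fix b :: real
    obtain n :: nat where n: "b \<le> real n" using real_arch_simple by blast
    show "\<exists>\<delta>::nat \<Rightarrow> real. (\<forall>k. 0 < \<delta> k) \<and> \<delta> \<longlonglongrightarrow> 0 \<and>
       (\<forall>t\<in>{-b..b} - Z. (\<lambda>k. LINT s|lebesgue. moll (\<delta> k) (s - t) *\<^sub>R h s) \<longlonglongrightarrow> h t)"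
    proof (intro exI[of _ "\<delta> n"] conjI ballI allI \<delta>(1) \<delta>(2))
      fix t assume t: "t \<in> {-b..b} - Z"
      have "eventually (\<lambda>k. \<delta> n k < 1) sequentially"
        using order_tendstoD(2)[OF \<delta>(2)] by simp
      then have "eventually (\<lambda>k. mollify (\<delta> n k) (H n) t = (LINT s|lebesgue. moll (\<delta> n k) (s - t) *\<^sub>R h s)) sequentially"
      proof eventually_elim
        case (elim k)
        have "mollify (\<delta> n k) (H n) t = (LINT s|lebesgue. moll (\<delta> n k) (s - t) *\<^sub>R H n s)"
          unfolding mollify_def by (subst integral_completion) auto
        also have "\<dots> = (LINT s|lebesgue. moll (\<delta> n k) (s - t) *\<^sub>R h s)"
        proof (rule integral_cong_AE)
          show "(\<lambda>s. moll (\<delta> n k) (s - t) *\<^sub>R H n s) \<in> borel_measurable lebesgue"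
            by (rule measurable_completion) simp
          have "(\<lambda>s. moll (\<delta> n k) (s - t)) \<in> borel_measurable lebesgue" by (rule measurable_completion) simp
          then show "(\<lambda>s. moll (\<delta> n k) (s - t) *\<^sub>R h s) \<in> borel_measurable lebesgue"
            using h by (rule borel_measurable_scaleR)
          show "AE s in lebesgue. moll (\<delta> n k) (s - t) *\<^sub>R H n s = moll (\<delta> n k) (s - t) *\<^sub>R h s"
            using AEh'
          proof eventually_elim
            case (elim s)
            show ?case
            proof (cases "s - t \<in> {0..\<delta> n k}")
              case True
              then have "s \<in> {- (real n + 1)..real n + 1}" using t n \<open>\<delta> n k < 1\<close> by auto
              then show ?thesis using elim by (simp add: H_def)
            qed (simp add: moll_outside[OF \<delta>(1)])
          qed
        qed
        finally show ?case .
      qed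
      moreover have "(\<lambda>k. mollify (\<delta> n k) (H n) t) \<longlonglongrightarrow> H n t" using Z(2) t by blast
      moreover have "H n t = h t" using t n Z(2)[of t] by (auto simp: H_def)
      ultimately show "(\<lambda>k. LINT s|lebesgue. moll (\<delta> n k) (s - t) *\<^sub>R h s) \<longlonglongrightarrow> h t"
        using Lim_transform_eventually by fastforce
    qed
  qed
qed

section \<open>Finite differences of a function with a weak derivative\<close>

text \<open>The \<open>m\<close>-th forward difference of \<open>u\<close> at \<open>t\<close> with step \<open>\<tau>\<close>.\<close>

definition dif :: "nat \<Rightarrow> real \<Rightarrow> (real \<Rightarrow> complex) \<Rightarrow> real \<Rightarrow> complex" where
  "dif m \<tau> u t = (\<Sum>k\<le>m. of_nat (m choose k) * ((-1) ^ (m - k) * u (t + real k * \<tau>)))"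

lemma dif_0 [simp]: "dif 0 \<tau> u t = u t"
  by (simp add: dif_def)

lemma dif_Suc: "dif (Suc m) \<tau> u t = dif m \<tau> u (t + \<tau>) - dif m \<tau> u t"
proof -
  have "dif (Suc m) \<tau> u t =
      (\<Sum>k\<le>m. of_nat (m choose k) * ((-1) ^ (m - k) * u (t + real (Suc k) * \<tau>) + (-1) ^ (Suc m - k) * u (t + real k * \<tau>)))"
    unfolding dif_def
    by (rule binomial_Suc_sum[of m "\<lambda>k l. (-1) ^ l * u (t + real k * \<tau>)", symmetric])
  also have "\<dots> = (\<Sum>k\<le>m. of_nat (m choose k) * ((-1) ^ (m - k) * u (t + \<tau> + real k * \<tau>)) - of_nat (m choose k) * ((-1) ^ (m - k) * u (t + real k * \<tau>)))"
    by (intro sum.cong refl) (simp add: Suc_diff_le algebra_simps)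
  finally show ?thesis by (simp add: dif_def sum_subtractf)
qed

lemma dif_Suc': "dif (Suc m) \<tau> u t = dif m \<tau> (\<lambda>t. u (t + \<tau>) - u t) t"
proof (induction m arbitrary: t)
  case (Suc m)
  show ?case unfolding dif_Suc[of "Suc m"] dif_Suc[of m \<tau> "\<lambda>t. u (t + \<tau>) - u t"] Suc ..
qed (simp add: dif_Suc)

lemma dif_split: "u t = (-1) ^ m * (dif m \<tau> u t - (\<Sum>k=1..m. of_nat (m choose k) * ((-1) ^ (m - k) * u (t + real k * \<tau>))))"
proof -
  have "{..m} = insert 0 {1..m}" by auto
  then have "dif m \<tau> u t = (-1) ^ m * u t + (\<Sum>k=1..m. of_nat (m choose k) * ((-1) ^ (m - k) * u (t + real k * \<tau>)))"
    unfolding dif_def by simp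
  then show ?thesis by (simp add: mult.assoc[symmetric] power_mult_distrib[symmetric])
qed

lemma norm_dif_coeff: "k \<le> m \<Longrightarrow> norm (of_nat (m choose k) * ((-1) ^ (m - k) * z) :: complex) \<le> 2 ^ m * norm z"
proof -
  have "real (m choose k) \<le> 2 ^ m" using binomial_le_pow2 by (metis of_nat_le_iff of_nat_numeral of_nat_power)
  then show ?thesis by (simp add: norm_mult norm_power mult_right_mono)
qed

text \<open>Induction on \<open>m\<close>: the first difference of \<open>u\<close> grows one degree slower, and summing it along unit steps
  down to \<open>(0, 1]\<close> gains one degree. The set \<open>S\<close> will be the complement of a null set, stable under these steps.\<close>

lemma growth_from_unit_differences:
  fixes u :: "real \<Rightarrow> complex"
  assumes S: "\<And>t. t \<in> S \<Longrightarrow> 0 < t \<and> t + 1 \<in> S" "\<And>t. t \<in> S \<Longrightarrow> 1 < t \<Longrightarrow> t - 1 \<in> S"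
    and A: "0 \<le> A" "\<And>t. t \<in> S \<Longrightarrow> norm (dif m 1 u t) \<le> A" "\<And>t. t \<in> S \<Longrightarrow> t \<le> real m \<Longrightarrow> norm (u t) \<le> A"
    and t: "t \<in> S"
  shows "norm (u t) \<le> 2 ^ m * A * (1 + t) ^ m"
  using A t
proof (induction m arbitrary: u A t)
  case 0
  then show ?case by simp
next
  case (Suc m)
  note prems = Suc.prems
  define v where "v t = u (t + 1) - u t" for t
  define D where "D = 2 ^ Suc m * A"
  have D: "A \<le> D" "0 \<le> D"
    using Suc.prems(1) mult_right_mono[OF one_le_power[of "2::real" "Suc m"], of A] by (simp_all add: D_def)
  have v: "norm (v t) \<le> D * (1 + t) ^ m" if "t \<in> S" for t
  proof -
    have "norm (v t) \<le> 2 ^ m * (2 * A) * (1 + t) ^ m"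
    proof (rule Suc.IH[OF _ _ _ that])
      show "0 \<le> 2 * A" using Suc.prems(1) by simp
      show "norm (dif m 1 v s) \<le> 2 * A" if "s \<in> S" for s
        using Suc.prems(1) Suc.prems(2)[OF that] unfolding v_def dif_Suc' by simp
      show "norm (v s) \<le> 2 * A" if "s \<in> S" "s \<le> real m" for s
        using norm_triangle_ineq4[of "u (s + 1)" "u s"] Suc.prems(3)[of "s + 1"] Suc.prems(3)[of s] S(1)[OF that(1)] that
        by (simp add: v_def)
    qed
    then show ?thesis by (simp add: D_def mult_ac)
  qed
  have *: "norm (u t) \<le> A + real n * (D * (1 + t) ^ m)" if "t \<in> S" "t \<le> real n + 1" for n t
    using that
  proof (induction n arbitrary: t)
    case 0
    then show ?case using prems(3)[of t] by simp
  next
    case (Suc n)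
    have t0: "0 < t" using S(1) Suc.prems by blast
    show ?case
    proof (cases "t \<le> 1")
      case True
      then have "norm (u t) \<le> A" using Suc.prems \<open>t \<in> S\<close> by (intro prems(3)) auto
      moreover have "0 \<le> real (Suc n) * (D * (1 + t) ^ m)" using D t0 by simp
      ultimately show ?thesis by linarith
    next
      case False
      then have S1: "t - 1 \<in> S" using S(2) Suc.prems by simp
      have mono: "D * t ^ m \<le> D * (1 + t) ^ m"
        using t0 D by (intro mult_left_mono power_mono) auto
      have "norm (u t) \<le> norm (u (t - 1)) + norm (v (t - 1))"
        using norm_triangle_ineq[of "u (t - 1)" "v (t - 1)"] by (simp add: v_def)
      also have "norm (u (t - 1)) \<le> A + real n * (D * t ^ m)"
        using Suc.IH[OF S1] Suc.prems by simp
      also have "norm (v (t - 1)) \<le> D * t ^ m" using v[OF S1] by simp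
      finally have "norm (u t) \<le> A + real (Suc n) * (D * t ^ m)" by (simp add: algebra_simps)
      also have "\<dots> \<le> A + real (Suc n) * (D * (1 + t) ^ m)"
        by (intro add_left_mono mult_left_mono mono) simp
      finally show ?thesis .
    qed
  qed
  have t: "0 < t" using S(1) Suc.prems(4) by blast
  define n where "n = nat \<lfloor>t\<rfloor>"
  have n: "t \<le> real n + 1" "real n \<le> t" unfolding n_def using t by linarith+
  have "norm (u t) \<le> A + real n * (D * (1 + t) ^ m)" by (rule *[OF Suc.prems(4) n(1)])
  also have "\<dots> \<le> D * (1 + t) ^ m + t * (D * (1 + t) ^ m)"
  proof (rule add_mono)
    have "D * 1 \<le> D * (1 + t) ^ m" using D t by (intro mult_left_mono one_le_power) auto
    then show "A \<le> D * (1 + t) ^ m" using D by simp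
    show "real n * (D * (1 + t) ^ m) \<le> t * (D * (1 + t) ^ m)"
      using n D t by (intro mult_right_mono) auto
  qed
  also have "\<dots> = D * (1 + t) ^ Suc m" by (simp add: algebra_simps)
  finally show ?case by (simp add: D_def)
qed

lemma AE_affine_avoid:
  assumes "Z \<in> null_sets lebesgue" "c \<noteq> (0::real)"
  shows "AE x in lebesgue. t + c * x \<notin> Z"
proof -
  have Z: "Z \<in> sets lebesgue" using assms by auto
  have "(\<integral>\<^sup>+x. indicator Z x \<partial>lebesgue) = ennreal \<bar>c\<bar> * (\<integral>\<^sup>+x. indicator Z (t + c * x) \<partial>lebesgue)"
    by (rule nn_integral_real_affine_lebesgue[OF _ assms(2)]) (use Z in simp)
  moreover have "(\<integral>\<^sup>+x. indicator Z x \<partial>lebesgue) = 0"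
    by (simp only: nn_integral_indicator[OF Z] null_setsD1[OF assms(1)])
  ultimately have 0: "(\<integral>\<^sup>+x. indicator Z (t + c * x) \<partial>lebesgue) = 0" using assms(2) by simp
  have "(\<lambda>x. indicator Z (t + c * x) :: ennreal) \<in> borel_measurable lebesgue"
    by (rule measurable_compose[OF lebesgue_affine_measurable[of "\<lambda>_. c" t, simplified]]) (use assms Z in auto)
  from 0 nn_integral_0_iff_AE[OF this] have "AE x in lebesgue. indicator Z (t + c * x) = (0::ennreal)" by simp
  then show ?thesis by eventually_elim (auto simp: indicator_def split: if_splits)
qed

text \<open>The scalar situation: \<open>\<gamma>\<close> is the \<open>m\<close>-th weak derivative of \<open>h\<close> on the positive half-line. All estimates involve
  only the majorant \<open>G\<close>, so that they will hold for all functionals of a vector-valued function at once.\<close>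

locale weakly_differentiable =
  fixes m :: nat and h \<gamma> :: "real \<Rightarrow> complex" and G :: "real \<Rightarrow> real"
  assumes m: "1 \<le> m"
    and h_meas: "h \<in> borel_measurable lebesgue" and h_loc: "\<And>b. set_integrable lebesgue {-b..b} h"
    and \<gamma>_meas: "\<gamma> \<in> borel_measurable lebesgue" and \<gamma>_le: "\<And>t. norm (\<gamma> t) \<le> G t"
    and G_meas: "G \<in> borel_measurable lebesgue" and G_loc: "\<And>b. set_integrable lebesgue {-b..b} G"
    and weak: "\<And>a b \<phi>. 0 < a \<Longrightarrow> smooth_in a b \<phi> \<Longrightarrow>
      (LINT t|lebesgue. nderiv m \<phi> t * h t) = (-1) ^ m * (LINT t|lebesgue. \<phi> t * \<gamma> t)"
begin

lemma G_nonneg: "0 \<le> G t"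
  using \<gamma>_le norm_ge_zero order_trans by blast

lemma loc_integrable_Icc:
  assumes "\<And>b. set_integrable lebesgue {-b..b} u"
  shows "set_integrable lebesgue {a..b::real} (u :: real \<Rightarrow> 'b::euclidean_space)"
  by (rule set_integrable_subset[OF assms[of "max \<bar>a\<bar> \<bar>b\<bar>"]]) auto

lemma integrable_smooth_mult:
  assumes \<phi>: "smooth_in a b \<phi>" and u: "\<And>b. set_integrable lebesgue {-b..b} u" "u \<in> borel_measurable lebesgue"
  shows "integrable lebesgue (\<lambda>t. \<phi> t * u t)"
proof -
  obtain C where C: "\<And>t. norm (\<phi> t) \<le> C" using smooth_in_bounded[OF \<phi>] by blast
  have "integrable lebesgue (\<lambda>t. C *\<^sub>R (indicator {a..b} t *\<^sub>R u t))"
    using loc_integrable_Icc[OF u(1), of a b] by (intro integrable_scaleR_right) (simp add: set_integrable_def)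
  then show ?thesis
  proof (rule Bochner_Integration.integrable_bound)
    have "\<phi> \<in> borel_measurable lebesgue"
      using integrable_smooth_in[OF \<phi>] by (rule borel_measurable_integrable)
    then show "(\<lambda>t. \<phi> t * u t) \<in> borel_measurable lebesgue"
      using u(2) by (rule borel_measurable_times)
    show "AE t in lebesgue. norm (\<phi> t * u t) \<le> norm (C *\<^sub>R (indicator {a..b} t *\<^sub>R u t))"
    proof (rule AE_I2)
      fix t
      show "norm (\<phi> t * u t) \<le> norm (C *\<^sub>R (indicator {a..b} t *\<^sub>R u t))"
      proof (cases "t \<in> {a..b}")
        case True
        have "norm (\<phi> t * u t) \<le> \<bar>C\<bar> * norm (u t)"
          unfolding norm_mult by (intro mult_right_mono order_trans[OF C abs_ge_self]) simp
        then show ?thesis using True by simp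
      qed (simp add: smooth_in_outside[OF \<phi>])
    qed
  qed
qed

lemma smooth_in_moll:
  assumes "0 < \<delta>"
  shows "smooth_in t (t + \<delta>) (\<lambda>s. of_real (moll \<delta> (s - t)))"
  unfolding smooth_in_def
proof (intro conjI allI impI)
  have "smooth (\<lambda>s. complex_of_real (bump (1 / \<delta> * s + - t / \<delta>)))"
    using smooth_affine[OF smooth_in_smooth[OF smooth_in_bump], of "1 / \<delta>" "- t / \<delta>"] by blast
  then have "smooth (\<lambda>s. complex_of_real (bump (1 / \<delta> * s + - t / \<delta>)) * of_real (1 / (\<delta> * bump_mass)))"
    by (rule smooth_bounded_linear[OF _ bounded_linear_mult_left, THEN conjunct1])
  moreover have "complex_of_real (moll \<delta> (s - t)) = of_real (bump (1 / \<delta> * s + - t / \<delta>)) * of_real (1 / (\<delta> * bump_mass))" for s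
    by (simp add: moll_def diff_divide_distrib)
  ultimately show "smooth (\<lambda>s. complex_of_real (moll \<delta> (s - t)))" by simp
  show "complex_of_real (moll \<delta> (s - t)) = 0" if "s \<notin> {t..t + \<delta>}" for s
    using that assms moll_outside[of \<delta> "s - t"] by auto
qed

text \<open>A mollifier has mass one, so its average over an interval of length \<open>\<bar>\<tau>\<bar>\<close> is at most \<open>1 / \<bar>\<tau>\<bar>\<close>,
  independently of \<open>\<delta>\<close>.\<close>

lemma norm_wavg_moll:
  assumes "0 < \<delta>" "\<tau> \<noteq> 0"
  shows "norm (wavg (\<lambda>_. 1) \<tau> (\<lambda>s. of_real (moll \<delta> (s - t))) s) \<le> 1 / \<bar>\<tau>\<bar>"
proof -
  define v where "v y = moll \<delta> (s + \<tau> * y - t)" for y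
  have cm: "continuous_on UNIV (\<lambda>s. complex_of_real (moll \<delta> (s - t)))"
    by (rule smooth_in_continuous[OF smooth_in_moll[OF assms(1)]])
  have "continuous_on {0..1} (\<lambda>y. complex_of_real (v y))"
    unfolding v_def by (rule continuous_on_compose2[OF cm]) (auto intro!: continuous_intros)
  then have ci: "continuous_on {0..1} v" using continuous_on_Re by fastforce
  have vm: "v \<in> borel_measurable borel" unfolding v_def by measurable
  have "norm (wavg (\<lambda>_. 1) \<tau> (\<lambda>s. of_real (moll \<delta> (s - t))) s) = norm (integral {0..1} (\<lambda>y. complex_of_real (v y)))"
    by (simp add: wavg_def v_def)
  also have "integral {0..1} (\<lambda>y. complex_of_real (v y)) = of_real (integral {0..1} v)"
    using integral_linear[OF integrable_continuous_real[OF ci] bounded_linear_of_real] by (simp add: o_def)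
  also have "norm (complex_of_real (integral {0..1} v)) = integral {0..1} v"
    using integral_nonneg[OF integrable_continuous_real[OF ci]] by (simp add: v_def moll_nonneg[OF assms(1)])
  also have "\<dots> \<le> 1 / \<bar>\<tau>\<bar>"
  proof -
    have "((\<lambda>y. if y \<in> {0..1} then v y else 0) has_integral integral {0..1} v) UNIV"
      by (simp only: has_integral_restrict_UNIV integrable_integral[OF integrable_continuous_real[OF ci]])
    then have "ennreal (integral {0..1} v) = (\<integral>\<^sup>+ y. ennreal (if y \<in> {0..1} then v y else 0) \<partial>lborel)"
      by (intro nn_integral_has_integral_lborel[symmetric]) (use vm in \<open>auto simp: v_def moll_nonneg[OF assms(1)]\<close>)
    also have "\<dots> \<le> (\<integral>\<^sup>+ y. ennreal (v y) \<partial>lborel)"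
      by (intro nn_integral_mono) (auto simp: indicator_def)
    also have "\<dots> = (\<integral>\<^sup>+ y. ennreal (moll \<delta> (s - t + \<tau> * y)) \<partial>lborel)"
      by (simp add: v_def algebra_simps)
    finally have 1: "ennreal (integral {0..1} v) \<le> (\<integral>\<^sup>+ y. ennreal (moll \<delta> (s - t + \<tau> * y)) \<partial>lborel)" .
    have "(\<integral>\<^sup>+ y. ennreal (moll \<delta> y) \<partial>lborel) = ennreal \<bar>\<delta>\<bar> * (\<integral>\<^sup>+ y. ennreal (moll \<delta> (0 + \<delta> * y)) \<partial>lborel)"
      by (rule nn_integral_real_affine) (use assms in auto)
    also have "\<dots> = (\<integral>\<^sup>+ y. ennreal \<bar>\<delta>\<bar> * ennreal (moll \<delta> (0 + \<delta> * y)) \<partial>lborel)"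
      by (intro nn_integral_cmult[symmetric]) measurable
    also have "\<dots> = (\<integral>\<^sup>+ y. ennreal (moll 1 y) \<partial>lborel)"
      using assms by (intro nn_integral_cong) (simp add: ennreal_mult'[symmetric] moll_scale[OF assms(1)])
    also have "\<dots> = 1"
      using has_bochner_integral_moll_1 by (subst nn_integral_eq_integral) (auto simp: has_bochner_integral_iff moll_nonneg)
    finally have "ennreal \<bar>\<tau>\<bar> * (\<integral>\<^sup>+ y. ennreal (moll \<delta> (s - t + \<tau> * y)) \<partial>lborel) = 1"
      using nn_integral_real_affine[of "\<lambda>y. ennreal (moll \<delta> y)" \<tau> "s - t"] assms by simp
    then have "ennreal \<bar>\<tau>\<bar> * ennreal (integral {0..1} v) \<le> 1"
      using mult_left_mono[OF 1, of "ennreal \<bar>\<tau>\<bar>"] by simp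
    then have "\<bar>\<tau>\<bar> * integral {0..1} v \<le> 1"
      by (simp add: ennreal_mult'[symmetric] flip: ennreal_1)
    then show ?thesis using assms(2) by (simp add: field_simps)
  qed
  finally show ?thesis .
qed

abbreviation avg_power :: "real \<Rightarrow> nat \<Rightarrow> (real \<Rightarrow> complex) \<Rightarrow> real \<Rightarrow> complex" where
  "avg_power \<tau> n \<equiv> wavg (\<lambda>_. 1) \<tau> ^^ n"

lemma smooth_avg_power: "smooth v \<Longrightarrow> smooth (avg_power \<tau> n v)"
  by (induction n) (auto intro: smooth_wavg)

lemma smooth_in_avg_power:
  assumes "smooth_in a b v"
  shows "smooth_in (a - real n * max \<tau> 0) (b - real n * min \<tau> 0) (avg_power \<tau> n v)"
proof (induction n)
  case (Suc n)
  have "smooth_in (a - real n * max \<tau> 0 - max \<tau> 0) (b - real n * min \<tau> 0 - min \<tau> 0) (wavg (\<lambda>_. 1) \<tau> (avg_power \<tau> n v))"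
    by (rule smooth_in_wavg[OF _ Suc]) simp
  then show ?case by (simp add: algebra_simps)
qed (use assms in simp)

lemma nderiv_avg_power:
  assumes "smooth v" "\<tau> \<noteq> 0"
  shows "nderiv n (avg_power \<tau> n v) s = dif n \<tau> v s /\<^sub>R \<tau> ^ n"
proof (induction n arbitrary: s)
  case (Suc n)
  have "nderiv (Suc n) (avg_power \<tau> (Suc n) v) s = (nderiv n (avg_power \<tau> n v) (s + \<tau>) - nderiv n (avg_power \<tau> n v) s) /\<^sub>R \<tau>"
    using nderiv_wavg_1[OF smooth_avg_power[OF assms(1)] assms(2)] by simp
  then show ?case unfolding Suc dif_Suc by (simp add: scaleR_diff_right)
qed simp

lemma norm_avg_power:
  assumes "smooth v" "\<And>s. norm (wavg (\<lambda>_. 1) \<tau> v s) \<le> C"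
  shows "norm (avg_power \<tau> (Suc n) v s) \<le> C"
proof (induction n arbitrary: s)
  case (Suc n)
  show ?case
    using norm_wavg_le[OF smooth_continuous0[OF smooth_avg_power[OF assms(1), of "Suc n" \<tau>]] Suc] by simp
qed (use assms in simp)

text \<open>The \<open>m\<close>-fold box average \<open>\<phi>\<close> of a mollifier is a test function whose \<open>m\<close>-th derivative is an \<open>m\<close>-th difference
  quotient of that mollifier. Testing the weak derivative against it gives the \<open>m\<close>-th difference of the mollified
  function, and \<open>\<phi>\<close> itself is bounded by \<open>1 / \<bar>\<sigma>\<bar>\<close>.\<close>

lemma mollified_difference:
  assumes \<delta>: "0 < \<delta>" and \<sigma>: "\<sigma> \<noteq> 0" "\<delta> \<le> \<bar>\<sigma>\<bar>" and a: "0 < a" "a \<le> t" "a \<le> t + real m * \<sigma>"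
    and b: "t + \<bar>\<sigma>\<bar> \<le> b" "t + real m * \<sigma> + \<bar>\<sigma>\<bar> \<le> b"
  shows "norm (dif m \<sigma> (\<lambda>t. LINT s|lebesgue. moll \<delta> (s - t) *\<^sub>R h s) t) \<le> \<bar>\<sigma>\<bar> ^ (m - 1) * (LINT s:{a..b}|lebesgue. G s)"
proof -
  \<comment> \<open>Differences of the test function with step \<open>\<tau>\<close> become differences of \<open>h\<close> with step \<open>- \<tau>\<close> under the integral.\<close>
  define \<tau> where "\<tau> = - \<sigma>"
  define \<eta> where "\<eta> s = complex_of_real (moll \<delta> (s - t))" for s
  have \<eta>: "smooth_in t (t + \<delta>) \<eta>" unfolding \<eta>_def by (rule smooth_in_moll[OF \<delta>])
  define \<phi> where "\<phi> = avg_power \<tau> m \<eta>"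
  have "smooth_in (t - real m * max \<tau> 0) (t + \<delta> - real m * min \<tau> 0) \<phi>"
    unfolding \<phi>_def by (rule smooth_in_avg_power[OF \<eta>])
  then have \<phi>: "smooth_in a b \<phi>"
    by (rule smooth_in_mono) (use a b \<sigma> in \<open>auto simp: \<tau>_def max_def min_def\<close>)
  have \<tau>0: "\<tau> \<noteq> 0" using \<sigma> by (simp add: \<tau>_def)
  have \<phi>_le: "norm (\<phi> s) \<le> 1 / \<bar>\<tau>\<bar>" for s
  proof -
    obtain n where n: "m = Suc n" using m by (cases m) auto
    show ?thesis unfolding \<phi>_def n
      by (rule norm_avg_power[OF smooth_in_smooth[OF \<eta>]]) (unfold \<eta>_def, rule norm_wavg_moll[OF \<delta> \<tau>0])
  qed
  define M where "M x = (LINT s|lebesgue. moll \<delta> (s - x) *\<^sub>R h s)" for x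
  have Mi: "integrable lebesgue (\<lambda>s. of_real (moll \<delta> (s - x)) * h s)" for x
    by (rule integrable_smooth_mult[OF smooth_in_moll[OF \<delta>] h_loc h_meas])
  have "(LINT s|lebesgue. dif m \<tau> \<eta> s * h s) =
      (LINT s|lebesgue. (\<Sum>k\<le>m. of_nat (m choose k) * (-1) ^ (m - k) * (of_real (moll \<delta> (s - (t + real k * \<sigma>))) * h s)))"
  proof (intro Bochner_Integration.integral_cong refl)
    fix s
    have "s + real k * \<tau> - t = s - (t + real k * \<sigma>)" for k by (simp add: \<tau>_def)
    then show "dif m \<tau> \<eta> s * h s = (\<Sum>k\<le>m. of_nat (m choose k) * (-1) ^ (m - k) * (of_real (moll \<delta> (s - (t + real k * \<sigma>))) * h s))"
      by (simp only: dif_def sum_distrib_right \<eta>_def mult.assoc)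
  qed
  also have "\<dots> = (\<Sum>k\<le>m. of_nat (m choose k) * (-1) ^ (m - k) * (LINT s|lebesgue. of_real (moll \<delta> (s - (t + real k * \<sigma>))) * h s))"
    by (subst Bochner_Integration.integral_sum) (simp_all add: Mi)
  also have "\<dots> = dif m \<sigma> M t"
    by (simp add: dif_def M_def scaleR_conv_of_real mult.assoc)
  finally have 1: "(LINT s|lebesgue. dif m \<tau> \<eta> s * h s) = dif m \<sigma> M t" .
  have "(LINT s|lebesgue. nderiv m \<phi> s * h s) = (LINT s|lebesgue. of_real (inverse (\<tau> ^ m)) * (dif m \<tau> \<eta> s * h s))"
    by (intro Bochner_Integration.integral_cong refl)
       (simp only: \<phi>_def nderiv_avg_power[OF smooth_in_smooth[OF \<eta>] \<tau>0] scaleR_conv_of_real mult.assoc)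
  also have "\<dots> = of_real (inverse (\<tau> ^ m)) * dif m \<sigma> M t"
    unfolding 1[symmetric] by (rule integral_mult_right_zero)
  finally have 2: "of_real (inverse (\<tau> ^ m)) * dif m \<sigma> M t = (-1) ^ m * (LINT s|lebesgue. \<phi> s * \<gamma> s)"
    using weak[OF a(1) \<phi>] by simp
  have "dif m \<sigma> M t = of_real (\<tau> ^ m) * (of_real (inverse (\<tau> ^ m)) * dif m \<sigma> M t)"
    using \<tau>0 by (simp add: mult.assoc[symmetric] flip: of_real_mult)
  also have "norm \<dots> = \<bar>\<tau>\<bar> ^ m * norm (LINT s|lebesgue. \<phi> s * \<gamma> s)"
    unfolding 2 by (simp add: norm_mult norm_power power_abs)
  finally have 3: "norm (dif m \<sigma> M t) = \<bar>\<tau>\<bar> ^ m * norm (LINT s|lebesgue. \<phi> s * \<gamma> s)" .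
  have "norm (LINT s|lebesgue. \<phi> s * \<gamma> s) \<le> (LINT s|lebesgue. 1 / \<bar>\<tau>\<bar> * (indicator {a..b} s *\<^sub>R G s))"
  proof (rule Bochner_Integration.integral_norm_bound_integral)
    have \<gamma>_loc: "set_integrable lebesgue {-b..b} \<gamma>" for b
      unfolding set_integrable_def
    proof (rule Bochner_Integration.integrable_bound)
      show "integrable lebesgue (\<lambda>x. indicator {-b..b} x *\<^sub>R G x)" using G_loc by (simp add: set_integrable_def)
      show "(\<lambda>x. indicator {- b..b} x *\<^sub>R \<gamma> x) \<in> borel_measurable lebesgue"
        using \<gamma>_meas by (intro borel_measurable_scaleR borel_measurable_indicator) auto
      show "AE x in lebesgue. norm (indicator {- b..b} x *\<^sub>R \<gamma> x) \<le> norm (indicator {- b..b} x *\<^sub>R G x)"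
        using \<gamma>_le by (auto intro!: AE_I2 order_trans[OF _ abs_ge_self] simp: indicator_def)
    qed
    show "integrable lebesgue (\<lambda>s. \<phi> s * \<gamma> s)" by (rule integrable_smooth_mult[OF \<phi> \<gamma>_loc \<gamma>_meas])
    show "integrable lebesgue (\<lambda>s. 1 / \<bar>\<tau>\<bar> * (indicator {a..b} s *\<^sub>R G s))"
      using loc_integrable_Icc[OF G_loc, of a b] by (intro integrable_mult_right) (simp add: set_integrable_def)
    show "norm (\<phi> s * \<gamma> s) \<le> 1 / \<bar>\<tau>\<bar> * (indicator {a..b} s *\<^sub>R G s)" for s
    proof (cases "s \<in> {a..b}")
      case True
      then show ?thesis using mult_mono[OF \<phi>_le[of s] \<gamma>_le[of s]] by (simp add: norm_mult)
    qed (simp add: smooth_in_outside[OF \<phi>])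
  qed
  also have "\<dots> = 1 / \<bar>\<tau>\<bar> * (LINT s:{a..b}|lebesgue. G s)"
    unfolding set_lebesgue_integral_def by (rule integral_mult_right_zero)
  finally have "norm (dif m \<sigma> M t) \<le> \<bar>\<tau>\<bar> ^ m * (1 / \<bar>\<tau>\<bar> * (LINT s:{a..b}|lebesgue. G s))"
    unfolding 3 by (rule mult_left_mono) simp
  also have "\<dots> = \<bar>\<sigma>\<bar> ^ (m - 1) * (LINT s:{a..b}|lebesgue. G s)"
    using m \<sigma> by (cases m) (auto simp: \<tau>_def)
  finally show ?thesis unfolding M_def .
qed

text \<open>Let the mollification parameter tend to zero. A single null set is enough for all steps and base points, which
  allows integrating the inequality over the step.\<close>

lemma difference_inequality:
  obtains Z where "Z \<in> null_sets lebesgue"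
    "\<And>t \<sigma> a b. (\<And>k. k \<le> m \<Longrightarrow> t + real k * \<sigma> \<notin> Z) \<Longrightarrow> \<sigma> \<noteq> 0 \<Longrightarrow> 0 < a \<Longrightarrow> a \<le> t \<Longrightarrow> a \<le> t + real m * \<sigma> \<Longrightarrow>
      t + \<bar>\<sigma>\<bar> \<le> b \<Longrightarrow> t + real m * \<sigma> + \<bar>\<sigma>\<bar> \<le> b \<Longrightarrow>
      norm (dif m \<sigma> h t) \<le> \<bar>\<sigma>\<bar> ^ (m - 1) * (LINT s:{a..b}|lebesgue. G s)"
proof -
  obtain Z where Z: "Z \<in> null_sets lebesgue"
    "\<And>b. \<exists>\<delta>::nat \<Rightarrow> real. (\<forall>k. 0 < \<delta> k) \<and> \<delta> \<longlonglongrightarrow> 0 \<and>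
       (\<forall>t\<in>{-b..b} - Z. (\<lambda>k. LINT s|lebesgue. moll (\<delta> k) (s - t) *\<^sub>R h s) \<longlonglongrightarrow> h t)"
    using mollify_local[OF h_meas h_loc] by blast
  show ?thesis
  proof (rule that[OF Z(1)])
    fix t \<sigma> a b assume nodes: "\<And>k. k \<le> m \<Longrightarrow> t + real k * \<sigma> \<notin> Z" and \<sigma>: "\<sigma> \<noteq> 0"
      and a: "0 < a" "a \<le> t" "a \<le> t + real m * \<sigma>" and b: "t + \<bar>\<sigma>\<bar> \<le> b" "t + real m * \<sigma> + \<bar>\<sigma>\<bar> \<le> b"
    define B where "B = \<bar>t\<bar> + real m * \<bar>\<sigma>\<bar>"
    obtain \<delta> where \<delta>: "\<And>k::nat. 0 < \<delta> k" "\<delta> \<longlonglongrightarrow> 0"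
      "\<And>t. t \<in> {-B..B} - Z \<Longrightarrow> (\<lambda>k. LINT s|lebesgue. moll (\<delta> k) (s - t) *\<^sub>R h s) \<longlonglongrightarrow> h t"
      using Z(2)[of B] by blast
    have node: "t + real k * \<sigma> \<in> {-B..B} - Z" if "k \<le> m" for k
    proof -
      have "\<bar>real k * \<sigma>\<bar> \<le> real m * \<bar>\<sigma>\<bar>" using that by (simp add: abs_mult mult_right_mono)
      then show ?thesis using nodes[OF that] by (auto simp: B_def abs_le_iff)
    qed
    have "(\<lambda>k. dif m \<sigma> (\<lambda>t. LINT s|lebesgue. moll (\<delta> k) (s - t) *\<^sub>R h s) t) \<longlonglongrightarrow> dif m \<sigma> h t"
      unfolding dif_def by (intro tendsto_sum tendsto_mult tendsto_const \<delta>(3) node) simp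
    then have lim: "(\<lambda>k. norm (dif m \<sigma> (\<lambda>t. LINT s|lebesgue. moll (\<delta> k) (s - t) *\<^sub>R h s) t)) \<longlonglongrightarrow> norm (dif m \<sigma> h t)"
      by (rule tendsto_norm)
    have "eventually (\<lambda>k. \<delta> k < \<bar>\<sigma>\<bar>) sequentially"
      using order_tendstoD(2)[OF \<delta>(2)] \<sigma> by simp
    then have "eventually (\<lambda>k. norm (dif m \<sigma> (\<lambda>t. LINT s|lebesgue. moll (\<delta> k) (s - t) *\<^sub>R h s) t)
        \<le> \<bar>\<sigma>\<bar> ^ (m - 1) * (LINT s:{a..b}|lebesgue. G s)) sequentially"
      by eventually_elim (intro mollified_difference \<delta> \<sigma> a b, simp)
    with lim show "norm (dif m \<sigma> h t) \<le> \<bar>\<sigma>\<bar> ^ (m - 1) * (LINT s:{a..b}|lebesgue. G s)"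
      by (intro tendsto_upperbound[OF lim]) auto
  qed
qed

end

section \<open>Polynomial growth\<close>

context weakly_differentiable
begin

lemma h_affine_measurable: "c \<noteq> 0 \<Longrightarrow> (\<lambda>x. h (t + c * x)) \<in> borel_measurable lebesgue"
  by (rule measurable_compose[OF lebesgue_affine_measurable[of "\<lambda>_. c" t, simplified] h_meas]) auto

lemma nn_integral_affine_window:
  assumes k: "1 \<le> k" "k \<le> m"
  shows "(\<integral>\<^sup>+ \<sigma>. ennreal (norm (h (t + real k * \<sigma>))) * indicator {0<..<1::real} \<sigma> \<partial>lebesgue)
    \<le> (\<integral>\<^sup>+ s. ennreal (norm (h s)) * indicator {t..t + real m + 1} s \<partial>lebesgue)"
proof -
  define F where "F s = ennreal (norm (h s)) * indicator {t..t + real m + 1} s" for s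
  have F: "F \<in> borel_measurable lebesgue"
    unfolding F_def using h_meas
    by (intro borel_measurable_times_ennreal measurable_compose[OF _ measurable_ennreal] borel_measurable_norm borel_measurable_indicator) auto
  have "(\<integral>\<^sup>+ \<sigma>. ennreal (norm (h (t + real k * \<sigma>))) * indicator {0<..<1::real} \<sigma> \<partial>lebesgue) \<le> (\<integral>\<^sup>+ \<sigma>. F (t + real k * \<sigma>) \<partial>lebesgue)"
  proof (rule nn_integral_mono)
    fix \<sigma>
    show "ennreal (norm (h (t + real k * \<sigma>))) * indicator {0<..<1::real} \<sigma> \<le> F (t + real k * \<sigma>)"
    proof (cases "\<sigma> \<in> {0<..<1}")
      case True
      have "real k * \<sigma> \<le> real m * 1" using k True by (intro mult_mono) auto
      then show ?thesis using True k by (simp add: F_def)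
    qed simp
  qed
  also have "\<dots> \<le> ennreal \<bar>real k\<bar> * (\<integral>\<^sup>+ \<sigma>. F (t + real k * \<sigma>) \<partial>lebesgue)"
    using k mult_right_mono[of 1 "ennreal (real k)" "\<integral>\<^sup>+ \<sigma>. F (t + real k * \<sigma>) \<partial>lebesgue"] by simp
  also have "\<dots> = (\<integral>\<^sup>+ s. F s \<partial>lebesgue)"
    by (rule nn_integral_real_affine_lebesgue[OF F, symmetric]) (use k in simp)
  finally show ?thesis by (simp add: F_def)
qed

text \<open>Integrating the difference inequality over all steps \<open>\<sigma>\<close> in \<open>(0, 1)\<close> replaces the values of \<open>h\<close> at the shifted points by its
  local \<open>L\<^sup>1\<close> norm.\<close>

lemma local_bound:
  "AE t in lebesgue. 0 < t \<longrightarrow> ennreal (norm (h t)) \<le> ennreal (LINT s:{t..t + real m + 1}|lebesgue. G s) +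
     ennreal (real m * 2 ^ m) * (\<integral>\<^sup>+ s. ennreal (norm (h s)) * indicator {t..t + real m + 1} s \<partial>lebesgue)"
proof -
  obtain Z where Z: "Z \<in> null_sets lebesgue"
    "\<And>t \<sigma> a b. (\<And>k. k \<le> m \<Longrightarrow> t + real k * \<sigma> \<notin> Z) \<Longrightarrow> \<sigma> \<noteq> 0 \<Longrightarrow> 0 < a \<Longrightarrow> a \<le> t \<Longrightarrow> a \<le> t + real m * \<sigma> \<Longrightarrow>
      t + \<bar>\<sigma>\<bar> \<le> b \<Longrightarrow> t + real m * \<sigma> + \<bar>\<sigma>\<bar> \<le> b \<Longrightarrow>
      norm (dif m \<sigma> h t) \<le> \<bar>\<sigma>\<bar> ^ (m - 1) * (LINT s:{a..b}|lebesgue. G s)"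
    using difference_inequality by blast
  have "AE t in lebesgue. t \<notin> Z" using Z(1) by (rule AE_not_in)
  then show ?thesis
  proof eventually_elim
    case (elim t)
    show ?case
    proof
      assume t: "0 < t"
      have unit: "(\<integral>\<^sup>+ \<sigma>. c * indicator {0<..<1::real} \<sigma> \<partial>lebesgue) = c" for c
        by (subst nn_integral_cmult_indicator) auto
      define I where "I = (LINT s:{t..t + real m + 1}|lebesgue. G s)"
      have I: "0 \<le> I"
        unfolding I_def set_lebesgue_integral_def
        by (intro Bochner_Integration.integral_nonneg) (simp add: G_nonneg)
      define W where "W = (\<integral>\<^sup>+ s. ennreal (norm (h s)) * indicator {t..t + real m + 1} s \<partial>lebesgue)"
      have "AE \<sigma> in lebesgue. \<forall>k\<in>{1..m}. t + real k * \<sigma> \<notin> Z"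
        by (intro AE_finite_allI AE_affine_avoid[OF Z(1)]) auto
      then have "AE \<sigma> in lebesgue. ennreal (norm (h t)) * indicator {0<..<1::real} \<sigma>
          \<le> ennreal I * indicator {0<..<1::real} \<sigma> + (\<Sum>k=1..m. ennreal (2 ^ m) * (ennreal (norm (h (t + real k * \<sigma>))) * indicator {0<..<1::real} \<sigma>))"
      proof eventually_elim
        case (elim \<sigma>)
        show ?case
        proof (cases "\<sigma> \<in> {0<..<1}")
          case True
          have nodes: "t + real k * \<sigma> \<notin> Z" if "k \<le> m" for k
            using that elim \<open>t \<notin> Z\<close> by (cases "k = 0") auto
          have m\<sigma>: "real m * \<sigma> \<le> real m" "0 \<le> real m * \<sigma>" using True by (auto simp: mult_left_le)
          have "norm (dif m \<sigma> h t) \<le> \<bar>\<sigma>\<bar> ^ (m - 1) * I"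
            unfolding I_def by (rule Z(2)[OF nodes]) (use True t m\<sigma> in auto)
          also have "\<dots> \<le> 1 * I" using True I by (intro mult_right_mono power_le_one) auto
          finally have d: "norm (dif m \<sigma> h t) \<le> I" by simp
          have "norm (h t) = norm (dif m \<sigma> h t - (\<Sum>k=1..m. of_nat (m choose k) * ((-1) ^ (m - k) * h (t + real k * \<sigma>))))"
            by (subst dif_split[of h t m \<sigma>]) (simp add: norm_mult norm_power)
          also have "\<dots> \<le> I + (\<Sum>k=1..m. 2 ^ m * norm (h (t + real k * \<sigma>)))"
            by (intro order_trans[OF norm_triangle_ineq4] add_mono d order_trans[OF norm_sum] sum_mono norm_dif_coeff) simp
          finally have "ennreal (norm (h t)) \<le> ennreal (I + (\<Sum>k=1..m. 2 ^ m * norm (h (t + real k * \<sigma>))))"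
            by (rule ennreal_leI)
          also have "\<dots> = ennreal I + (\<Sum>k=1..m. ennreal (2 ^ m) * ennreal (norm (h (t + real k * \<sigma>))))"
            using I by (simp add: ennreal_plus sum_nonneg ennreal_mult'[symmetric] flip: sum_ennreal)
          finally show ?thesis using True by simp
        qed simp
      qed
      then have "(\<integral>\<^sup>+ \<sigma>. ennreal (norm (h t)) * indicator {0<..<1::real} \<sigma> \<partial>lebesgue)
          \<le> (\<integral>\<^sup>+ \<sigma>. ennreal I * indicator {0<..<1::real} \<sigma> + (\<Sum>k=1..m. ennreal (2 ^ m) * (ennreal (norm (h (t + real k * \<sigma>))) * indicator {0<..<1::real} \<sigma>)) \<partial>lebesgue)"
        by (rule nn_integral_mono_AE)
      also have "\<dots> = (\<integral>\<^sup>+ \<sigma>. ennreal I * indicator {0<..<1::real} \<sigma> \<partial>lebesgue) +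
          (\<Sum>k=1..m. ennreal (2 ^ m) * (\<integral>\<^sup>+ \<sigma>. ennreal (norm (h (t + real k * \<sigma>))) * indicator {0<..<1::real} \<sigma> \<partial>lebesgue))"
      proof -
        have meas: "(\<lambda>\<sigma>. ennreal (norm (h (t + real k * \<sigma>))) * indicator {0<..<1::real} \<sigma>) \<in> borel_measurable lebesgue" if "k \<in> {1..m}" for k
          using that h_affine_measurable[of "real k" t]
          by (intro borel_measurable_times_ennreal measurable_compose[OF _ measurable_ennreal] borel_measurable_norm borel_measurable_indicator) auto
        have meas1: "(\<lambda>\<sigma>::real. ennreal I * indicator {0<..<1::real} \<sigma>) \<in> borel_measurable lebesgue"
          by (intro borel_measurable_times_ennreal borel_measurable_indicator) auto
        have meas2: "(\<lambda>\<sigma>. ennreal (2 ^ m) * (ennreal (norm (h (t + real k * \<sigma>))) * indicator {0<..<1::real} \<sigma>)) \<in> borel_measurable lebesgue" if "k \<in> {1..m}" for k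
          using meas[OF that] by simp
        have "(\<integral>\<^sup>+ \<sigma>. (\<Sum>k=1..m. ennreal (2 ^ m) * (ennreal (norm (h (t + real k * \<sigma>))) * indicator {0<..<1::real} \<sigma>)) \<partial>lebesgue)
          = (\<Sum>k=1..m. \<integral>\<^sup>+ \<sigma>. ennreal (2 ^ m) * (ennreal (norm (h (t + real k * \<sigma>))) * indicator {0<..<1::real} \<sigma>) \<partial>lebesgue)"
          by (rule nn_integral_sum[OF meas2])
        also have "\<dots> = (\<Sum>k=1..m. ennreal (2 ^ m) * (\<integral>\<^sup>+ \<sigma>. ennreal (norm (h (t + real k * \<sigma>))) * indicator {0<..<1::real} \<sigma> \<partial>lebesgue))"
          by (intro sum.cong refl nn_integral_cmult meas)
        finally show ?thesis
          by (subst nn_integral_add[OF meas1 borel_measurable_sum[OF meas2]]) simp_all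
      qed
      also have "\<dots> \<le> ennreal I * 1 + (\<Sum>k=1..m. ennreal (2 ^ m) * W)"
        unfolding W_def
        by (intro add_mono sum_mono mult_left_mono nn_integral_affine_window) (auto simp: unit)
      also have "\<dots> = ennreal I + ennreal (real m * 2 ^ m) * W"
        by (simp add: ennreal_mult' mult.assoc ennreal_of_nat_eq_real_of_nat)
      also have "(\<integral>\<^sup>+ \<sigma>. ennreal (norm (h t)) * indicator {0<..<1::real} \<sigma> \<partial>lebesgue) = ennreal (norm (h t))"
        by (rule unit)
      finally show "ennreal (norm (h t)) \<le> ennreal (LINT s:{t..t + real m + 1}|lebesgue. G s) +
          ennreal (real m * 2 ^ m) * (\<integral>\<^sup>+ s. ennreal (norm (h s)) * indicator {t..t + real m + 1} s \<partial>lebesgue)"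
        by (simp add: I_def W_def)
    qed
  qed
qed

text \<open>Unit steps from a point of the half-line reach an interval of length \<open>m\<close> where \<open>local_bound\<close> applies; the differences
  met on the way are bounded by \<open>difference_inequality\<close> with step one.\<close>

lemma polynomial_growth:
  assumes CG: "0 \<le> CG" "\<And>t. 0 < t \<Longrightarrow> (LINT s:{t..t + real m + 1}|lebesgue. G s) \<le> CG"
    and Ch: "0 \<le> Ch" "(\<integral>\<^sup>+ s. ennreal (norm (h s)) * indicator {0..2 * real m + 1} s \<partial>lebesgue) \<le> ennreal Ch"
  shows "AE t in lebesgue. 0 < t \<longrightarrow> norm (h t) \<le> 2 ^ m * (CG + real m * 2 ^ m * Ch) * (1 + t) ^ m"
proof -
  define A where "A = CG + real m * 2 ^ m * Ch"
  have A: "0 \<le> A" "CG \<le> A" using CG Ch by (auto simp: A_def)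
  obtain Z where Z: "Z \<in> null_sets lebesgue"
    "\<And>t \<sigma> a b. (\<And>k. k \<le> m \<Longrightarrow> t + real k * \<sigma> \<notin> Z) \<Longrightarrow> \<sigma> \<noteq> 0 \<Longrightarrow> 0 < a \<Longrightarrow> a \<le> t \<Longrightarrow> a \<le> t + real m * \<sigma> \<Longrightarrow>
      t + \<bar>\<sigma>\<bar> \<le> b \<Longrightarrow> t + real m * \<sigma> + \<bar>\<sigma>\<bar> \<le> b \<Longrightarrow>
      norm (dif m \<sigma> h t) \<le> \<bar>\<sigma>\<bar> ^ (m - 1) * (LINT s:{a..b}|lebesgue. G s)"
    using difference_inequality by blast
  obtain Y where Y: "Y \<in> null_sets lebesgue"
    "\<And>t. t \<notin> Y \<Longrightarrow> 0 < t \<Longrightarrow> ennreal (norm (h t)) \<le> ennreal (LINT s:{t..t + real m + 1}|lebesgue. G s) +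
     ennreal (real m * 2 ^ m) * (\<integral>\<^sup>+ s. ennreal (norm (h s)) * indicator {t..t + real m + 1} s \<partial>lebesgue)"
    using local_bound by (auto simp: eventually_ae_filter)
  \<comment> \<open>Points all of whose integer translates avoid the null sets; unit steps do not leave this set.\<close>
  define S where "S = {t. 0 < t \<and> (\<forall>k::int. of_int k + 1 * t \<notin> Z \<union> Y)}"
  have S_bound: "norm (h t) \<le> 2 ^ m * A * (1 + t) ^ m" if "t \<in> S" for t
  proof (rule growth_from_unit_differences[OF _ _ A(1) _ _ that])
    fix s assume s: "s \<in> S"
    then have s0: "0 < s" and sk: "\<And>k::int. of_int k + s \<notin> Z \<union> Y" by (auto simp: S_def)
    have "of_int k + 1 * (s + 1) \<notin> Z \<union> Y" for k :: int using sk[of "k + 1"] by (simp add: algebra_simps)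
    then show "0 < s \<and> s + 1 \<in> S" using s0 by (simp add: S_def)
    have "of_int k + 1 * (s - 1) \<notin> Z \<union> Y" for k :: int using sk[of "k - 1"] by (simp add: algebra_simps)
    then show "s - 1 \<in> S" if "1 < s" using that by (simp add: S_def)
    have "s + real k * 1 \<notin> Z" for k :: nat using sk[of "int k"] by (simp add: add.commute)
    then have "norm (dif m 1 h s) \<le> \<bar>1\<bar> ^ (m - 1) * (LINT x:{s..s + real m + 1}|lebesgue. G x)"
      by (intro Z(2)) (use s0 in auto)
    also have "\<dots> \<le> CG" using CG(2)[OF s0] by simp
    finally show "norm (dif m 1 h s) \<le> A" using A by simp
    show "norm (h s) \<le> A" if "s \<le> real m"
    proof -
      have "s \<notin> Y" using sk[of 0] by simp
      then have "ennreal (norm (h s)) \<le> ennreal (LINT x:{s..s + real m + 1}|lebesgue. G x) +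
          ennreal (real m * 2 ^ m) * (\<integral>\<^sup>+ x. ennreal (norm (h x)) * indicator {s..s + real m + 1} x \<partial>lebesgue)"
        using s0 by (rule Y(2))
      also have "\<dots> \<le> ennreal CG + ennreal (real m * 2 ^ m) * ennreal Ch"
      proof (intro add_mono mult_left_mono ennreal_leI CG s0)
        have "(\<integral>\<^sup>+ x. ennreal (norm (h x)) * indicator {s..s + real m + 1} x \<partial>lebesgue)
          \<le> (\<integral>\<^sup>+ x. ennreal (norm (h x)) * indicator {0..2 * real m + 1} x \<partial>lebesgue)"
          using s0 that by (intro nn_integral_mono mult_left_mono) (auto simp: indicator_def)
        also note Ch(2)
        finally show "(\<integral>\<^sup>+ x. ennreal (norm (h x)) * indicator {s..s + real m + 1} x \<partial>lebesgue) \<le> ennreal Ch" .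
      qed simp
      also have "\<dots> = ennreal A"
        using CG(1) Ch(1) by (simp add: A_def ennreal_mult'[symmetric] flip: ennreal_plus)
      finally show ?thesis using A(1) by simp
    qed
  qed
  have "AE t in lebesgue. \<forall>k::int. of_int k + 1 * t \<notin> Z \<union> Y"
    unfolding AE_all_countable by (intro allI AE_affine_avoid) (use Z(1) Y(1) in auto)
  then show ?thesis
    by eventually_elim (use S_bound in \<open>auto simp: S_def A_def\<close>)
qed

end

section \<open>Low frequencies\<close>

lemma sum_power_div_fact_le_exp:
  fixes x :: real
  assumes "0 \<le> x"
  shows "(\<Sum>k\<le>n. x ^ k / fact k) \<le> exp x"
proof -
  have "(\<Sum>k\<le>n. x ^ k / fact k) \<le> (\<Sum>k. x ^ k / fact k)"
    using summable_exp[of x] assms by (intro sum_le_suminf) (auto simp: divide_inverse mult.commute)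
  then show ?thesis by (simp add: exp_def divide_inverse mult.commute)
qed

text \<open>After rescaling, the integral is the inverse Fourier transform at \<open>t\<close> of \<open>H\<close> times the cutoff stretched to
  \<open>[- 2 * q, 2 * q]\<close>. By \<open>N\<close>-fold integration by parts it is at most \<open>t ^ (- N)\<close> times the integral of the \<open>N\<close>-th derivative of the product,
  and in the Leibniz sum the factorials combine to \<open>fact N\<close> times an exponential sum.\<close>

lemma low_frequency:
  fixes h H :: "real \<Rightarrow> complex"
  assumes H: "smooth H" "\<And>j s. \<bar>s\<bar> \<le> R \<Longrightarrow> norm (nderiv j H s) \<le> fact j * B * \<mu> ^ j"
    and B: "0 \<le> B" and \<mu>: "2 \<le> \<mu>"
    and transform: "\<And>a b \<phi>. smooth_in a b \<phi> \<Longrightarrow> (LINT s|lebesgue. fourier \<phi> s * h s) = (LINT s|lebesgue. \<phi> s * H s)"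
    and S: "\<And>k s. k \<le> N \<Longrightarrow> norm (nderiv k (cutoff N) s) \<le> (2 * real N) ^ k * S"
    and q: "0 < q" "2 * q \<le> R" "1 / q \<le> real m" and t: "0 < t" and N: "1 \<le> N"
  shows "norm (LINT v|lebesgue. of_real (kernel N v) * h (t + v / q)) \<le> 4 * q * S * B * fact N * (\<mu> * exp (real m) / t) ^ N"
proof -
  have "norm (nderiv 0 (cutoff N) 0) \<le> S" using S[of 0 0] by simp
  then have S0: "0 \<le> S" by (rule order_trans[OF norm_ge_zero])
  define \<zeta> where "\<zeta> x = cutoff N (inverse q * x + 0)" for x
  note \<zeta>_affine = smooth_affine[OF smooth_in_smooth[OF smooth_in_cutoff[OF N]], of "inverse q" 0, folded \<zeta>_def]
  have \<zeta>_sm: "smooth \<zeta>" by (rule \<zeta>_affine[THEN conjunct1])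
  have \<zeta>_nd: "nderiv k \<zeta> = (\<lambda>x. inverse q ^ k *\<^sub>R nderiv k (cutoff N) (inverse q * x + 0))" for k
    by (rule \<zeta>_affine[THEN conjunct2, THEN spec])
  have \<zeta>: "smooth_in (- 2 * q) (2 * q) \<zeta>"
    unfolding smooth_in_def
  proof (intro conjI \<zeta>_sm allI impI)
    fix x assume "x \<notin> {- 2 * q..2 * q}"
    then have "inverse q * x + 0 \<notin> {- 2..2}" using q(1) by (auto simp: field_simps)
    then show "\<zeta> x = 0" unfolding \<zeta>_def by (rule smooth_in_outside[OF smooth_in_cutoff[OF N]])
  qed
  define e where "e x = exp ((\<i> * of_real t) * of_real x)" for x :: real
  define \<phi> where "\<phi> x = e x * \<zeta> x" for x
  have \<phi>: "smooth_in (- 2 * q) (2 * q) \<phi>"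
    unfolding \<phi>_def e_def by (intro smooth_in_mult \<zeta> smooth_exp)
  have \<phi>_hat: "fourier \<phi> s = of_real (q * kernel N (q * (s - t)))" for s
  proof -
    have "fourier \<phi> s = \<bar>q\<bar> *\<^sub>R (LINT x|lebesgue. exp (- \<i> * of_real s * of_real (0 + q * x)) * \<phi> (0 + q * x))"
      unfolding fourier_def by (rule lebesgue_integral_real_affine) (use q in simp)
    also have "(\<lambda>x. exp (- \<i> * of_real s * of_real (0 + q * x)) * \<phi> (0 + q * x)) =
        (\<lambda>x. exp (- \<i> * of_real (q * (s - t)) * of_real x) * cutoff N x)"
    proof
      fix x
      have "exp (- \<i> * of_real s * of_real (0 + q * x)) * exp ((\<i> * of_real t) * of_real (0 + q * x)) =
          exp (- \<i> * of_real (q * (s - t)) * complex_of_real x)"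
        by (simp add: exp_add[symmetric] algebra_simps)
      then show "exp (- \<i> * of_real s * of_real (0 + q * x)) * \<phi> (0 + q * x) =
          exp (- \<i> * of_real (q * (s - t)) * of_real x) * cutoff N x"
        using q(1) by (simp add: \<phi>_def e_def \<zeta>_def mult.assoc[symmetric])
    qed
    also have "\<bar>q\<bar> *\<^sub>R (LINT x|lebesgue. exp (- \<i> * of_real (q * (s - t)) * of_real x) * cutoff N x) = of_real (q * kernel N (q * (s - t)))"
      using fourier_cutoff[of N "q * (s - t)"] q(1) by (simp add: fourier_def scaleR_conv_of_real)
    finally show ?thesis .
  qed
  have "(LINT v|lebesgue. of_real (kernel N v) * h (t + v / q)) =
      \<bar>q\<bar> *\<^sub>R (LINT s|lebesgue. of_real (kernel N (- q * t + q * s)) * h (t + (- q * t + q * s) / q))"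
    by (rule lebesgue_integral_real_affine) (use q in simp)
  also have "\<dots> = (LINT s|lebesgue. \<bar>q\<bar> *\<^sub>R (of_real (kernel N (- q * t + q * s)) * h (t + (- q * t + q * s) / q)))"
    by (rule integral_scaleR_right[symmetric])
  also have "\<dots> = (LINT s|lebesgue. fourier \<phi> s * h s)"
  proof (intro Bochner_Integration.integral_cong refl)
    fix s
    have "t + (- q * t + q * s) / q = s" "- q * t + q * s = q * (s - t)" using q(1) by (simp_all add: field_simps)
    then show "\<bar>q\<bar> *\<^sub>R (of_real (kernel N (- q * t + q * s)) * h (t + (- q * t + q * s) / q)) = fourier \<phi> s * h s"
      using q(1) by (simp only: \<phi>_hat) (simp add: scaleR_conv_of_real)
  qed
  also have "\<dots> = (LINT s|lebesgue. \<phi> s * H s)" by (rule transform[OF \<phi>])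
  also have "\<dots> = fourier (\<lambda>x. \<zeta> x * H x) (- t)"
    unfolding fourier_def by (intro Bochner_Integration.integral_cong refl) (simp add: \<phi>_def e_def mult.assoc)
  finally have J: "(LINT v|lebesgue. of_real (kernel N v) * h (t + v / q)) = fourier (\<lambda>x. \<zeta> x * H x) (- t)" .
  define u where "u x = \<zeta> x * H x" for x
  have u_eq: "u = (\<lambda>x. H x * \<zeta> x)" by (rule ext) (simp add: u_def mult.commute)
  have u: "smooth_in (- 2 * q) (2 * q) u"
    unfolding u_eq by (rule smooth_in_mult[OF \<zeta> H(1)])
  define D where "D = S * B * fact N * (\<mu> * exp (real m)) ^ N"
  have D: "0 \<le> D" using S0 B \<mu> by (simp add: D_def)
  have nd: "norm (nderiv N u s) \<le> D" for s
  proof (cases "s \<in> {- 2 * q..2 * q}")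
    case True
    then have s: "\<bar>s\<bar> \<le> R" using q by auto
    have "nderiv N u s = (\<Sum>k\<le>N. of_nat (N choose k) * (nderiv k \<zeta> s * nderiv (N - k) H s))"
      unfolding u_def by (rule smooth_mult[OF \<zeta>_sm H(1), THEN conjunct2, THEN spec, THEN fun_cong])
    also have "norm \<dots> \<le> (\<Sum>k\<le>N. real (N choose k) * ((inverse q ^ k * ((2 * real N) ^ k * S)) * (fact (N - k) * B * \<mu> ^ (N - k))))"
    proof (rule order_trans[OF norm_sum sum_mono])
      fix k assume k: "k \<in> {..N}"
      have "norm (nderiv k \<zeta> s) \<le> inverse q ^ k * ((2 * real N) ^ k * S)"
        unfolding \<zeta>_nd using q(1) S[of k] k by (simp add: power_abs mult_left_mono)
      then show "norm (of_nat (N choose k) * (nderiv k \<zeta> s * nderiv (N - k) H s)) \<le>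
          real (N choose k) * ((inverse q ^ k * ((2 * real N) ^ k * S)) * (fact (N - k) * B * \<mu> ^ (N - k)))"
        unfolding norm_mult norm_of_nat
        using H(2)[OF s, of "N - k"] q(1) S0 by (intro mult_left_mono mult_mono) auto
    qed
    also have "\<dots> = (\<Sum>k\<le>N. (S * B * fact N * \<mu> ^ N) * ((2 * real N / (q * \<mu>)) ^ k / fact k))"
    proof (intro sum.cong refl)
      fix k assume k: "k \<in> {..N}"
      have 1: "real (N choose k) * fact (N - k) = fact N / fact k"
        using binomial_fact[of k N, where 'a=real] k by (simp add: field_simps)
      have "\<mu> ^ N = \<mu> ^ (N - k) * \<mu> ^ k" using k by (simp add: power_add[symmetric])
      then have 2: "\<mu> ^ (N - k) = \<mu> ^ N / \<mu> ^ k" using \<mu> by simp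
      have "real (N choose k) * ((inverse q ^ k * ((2 * real N) ^ k * S)) * (fact (N - k) * B * \<mu> ^ (N - k)))
        = (real (N choose k) * fact (N - k)) * (inverse q ^ k * (2 * real N) ^ k) * S * B * \<mu> ^ (N - k)"
        by (simp only: ac_simps)
      also have "\<dots> = (S * B * fact N * \<mu> ^ N) * ((2 * real N / (q * \<mu>)) ^ k / fact k)"
        unfolding 1 2 using q(1) \<mu> by (simp add: power_divide power_mult_distrib field_simps)
      finally show "real (N choose k) * ((inverse q ^ k * ((2 * real N) ^ k * S)) * (fact (N - k) * B * \<mu> ^ (N - k)))
        = (S * B * fact N * \<mu> ^ N) * ((2 * real N / (q * \<mu>)) ^ k / fact k)" .
    qed
    also have "\<dots> \<le> (S * B * fact N * \<mu> ^ N) * exp (2 * real N / (q * \<mu>))"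
      unfolding sum_distrib_left[symmetric]
      using S0 B \<mu> q(1) by (intro mult_left_mono sum_power_div_fact_le_exp) auto
    also have "\<dots> \<le> (S * B * fact N * \<mu> ^ N) * exp (real m * real N)"
    proof -
      have "2 * real N / (q * \<mu>) = (1 / q) * (2 / \<mu>) * real N" by simp
      also have "\<dots> \<le> real m * 1 * real N"
        using q \<mu> by (intro mult_mono mult_right_mono) auto
      finally show ?thesis using S0 B \<mu> by (intro mult_left_mono) auto
    qed
    also have "\<dots> = D"
      by (simp add: D_def power_mult_distrib exp_of_nat_mult[symmetric] mult.commute)
    finally show ?thesis .
  next
    case False
    then show ?thesis using D smooth_in_outside[OF smooth_in_nderiv[OF u]] by simp
  qed
  have "t ^ N * norm (fourier u (- t)) \<le> (2 * q - - 2 * q) * D"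
    using norm_fourier_decay[OF u _ nd, of "- t"] q(1) t by simp
  then have "norm (fourier u (- t)) \<le> 4 * q * D / t ^ N"
    using t by (simp add: field_simps)
  also have "\<dots> = 4 * q * S * B * fact N * (\<mu> * exp (real m) / t) ^ N"
    by (simp add: D_def power_divide)
  finally show ?thesis unfolding J u_def .
qed

section \<open>High frequencies\<close>

text \<open>An average of \<open>G\<close> about \<open>t\<close> at scale \<open>1 / r\<close>: \<open>v / r\<close> is the step of the difference and \<open>u\<close> ranges over
  the interval that the difference involves. Only values of \<open>G\<close> at points comparable to \<open>t\<close> enter.\<close>

definition window :: "nat \<Rightarrow> (real \<Rightarrow> real) \<Rightarrow> real \<Rightarrow> real \<Rightarrow> ennreal" where
  "window m G r t = (\<integral>\<^sup>+ v. \<integral>\<^sup>+ u. ennreal (1 / (1 + \<bar>v\<bar>) ^ 2) *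
     (ennreal (G (t + u * (v / r))) * indicator {t / 2..3 * t / 2} (t + u * (v / r)) * indicator {- (real m + 1)..real m + 1} u)
     \<partial>lborel \<partial>lborel)"

definition inverse_square_mass :: real where
  "inverse_square_mass = integral\<^sup>L lborel (\<lambda>v::real. 1 / (1 + \<bar>v\<bar>) ^ 2)"

text \<open>The constant of \<open>far_estimate\<close>; \<open>Cg\<close> stands for the growth of \<open>h\<close> and \<open>Ck\<close> for the decay of the kernels.\<close>

definition far_const :: "nat \<Rightarrow> real \<Rightarrow> real \<Rightarrow> real" where
  "far_const m Cg Ck = Ck * ((real m + 1) * 2 ^ m * Cg * (3 * real m + 3) ^ m) * (2 * (real m + 1)) ^ (m + 2)"

lemma norm_dif_le:
  assumes "\<And>k. k \<le> m \<Longrightarrow> norm (u (t + real k * \<sigma>)) \<le> B"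
  shows "norm (dif m \<sigma> u t) \<le> (real m + 1) * 2 ^ m * B"
proof -
  have "norm (dif m \<sigma> u t) \<le> (\<Sum>k\<le>m. 2 ^ m * B)"
    unfolding dif_def
  proof (rule order_trans[OF norm_sum sum_mono])
    fix k assume "k \<in> {..m}"
    then have k: "k \<le> m" by simp
    show "norm (of_nat (m choose k) * ((-1) ^ (m - k) * u (t + real k * \<sigma>))) \<le> 2 ^ m * B"
      by (rule order_trans[OF norm_dif_coeff[OF k] mult_left_mono[OF assms[OF k]]]) simp
  qed
  then show ?thesis by (simp add: algebra_simps)
qed

lemma nn_integral_inverse_square:
  "(\<integral>\<^sup>+ v. ennreal (1 / (1 + \<bar>v\<bar>) ^ 2) \<partial>lborel) = ennreal inverse_square_mass"
  unfolding inverse_square_mass_def by (rule nn_integral_eq_integral[OF integrable_inverse_square]) simp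

lemma inverse_square_mass_nonneg: "0 \<le> inverse_square_mass"
  unfolding inverse_square_mass_def by (rule Bochner_Integration.integral_nonneg) simp

text \<open>For steps \<open>v / r\<close> comparable to \<open>t\<close> or larger the decay of the kernel \<open>\<theta>\<close> beats both the polynomial growth
  entering the difference \<open>D\<close> and the factor \<open>r ^ m\<close>, since then \<open>r * t\<close> is dominated by \<open>\<bar>v\<bar>\<close>.\<close>

lemma far_estimate:
  assumes r: "1 \<le> r" and t: "1 \<le> t" and v: "r * t / (2 * (real m + 1)) \<le> \<bar>v\<bar>"
    and Ck: "0 \<le> Ck" and Cg: "0 \<le> Cg" and \<theta>: "0 \<le> \<theta>" "\<theta> \<le> Ck / (1 + \<bar>v\<bar>) ^ (2 * m + 4)"
    and D: "0 \<le> D" "D \<le> (real m + 1) * 2 ^ m * (Cg * (1 + (t + real m * (\<bar>v\<bar> / r))) ^ m)"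
  shows "r ^ m * \<theta> * D \<le> far_const m Cg Ck / t ^ 2 * (1 / (1 + \<bar>v\<bar>) ^ 2)"
proof -
  define w where "w = 1 + \<bar>v\<bar>"
  have w: "1 \<le> w" by (simp add: w_def)
  have "\<bar>v\<bar> * 1 \<le> \<bar>v\<bar> * r" using r by (intro mult_left_mono) auto
  then have vr: "\<bar>v\<bar> / r \<le> \<bar>v\<bar>" using r by (simp add: divide_le_eq)
  have rt: "r * t \<le> 2 * (real m + 1) * \<bar>v\<bar>" using v by (simp add: field_simps)
  have "t \<le> r * t" using r t by simp
  then have t2: "t \<le> 2 * (real m + 1) * \<bar>v\<bar>" using rt by linarith
  have "1 + (t + real m * (\<bar>v\<bar> / r)) \<le> 1 + (2 * (real m + 1) * \<bar>v\<bar> + real m * \<bar>v\<bar>)"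
    using t2 mult_left_mono[OF vr, of "real m"] by simp
  also have "\<dots> \<le> (3 * real m + 3) * w" by (simp add: w_def algebra_simps)
  finally have base: "1 + (t + real m * (\<bar>v\<bar> / r)) \<le> (3 * real m + 3) * w" .
  have "0 \<le> real m * (\<bar>v\<bar> / r)" using r by simp
  with base have "(1 + (t + real m * (\<bar>v\<bar> / r))) ^ m \<le> ((3 * real m + 3) * w) ^ m"
    using t by (intro power_mono) auto
  then have D2: "D \<le> (real m + 1) * 2 ^ m * (Cg * ((3 * real m + 3) ^ m * w ^ m))"
    using D(2) Cg unfolding power_mult_distrib by (intro order_trans[OF D(2)] mult_left_mono) auto
  define A where "A = (real m + 1) * 2 ^ m * Cg * (3 * real m + 3) ^ m"
  have A: "0 \<le> A" using Cg by (simp add: A_def)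
  have "r ^ m * \<theta> * D \<le> r ^ m * (Ck / w ^ (2 * m + 4)) * (A * w ^ m)"
    using \<theta> D D2 r Ck w A by (intro mult_mono) (auto simp: A_def w_def mult_ac)
  also have "\<dots> = (Ck * A) * (r ^ m / w ^ (m + 2)) * (1 / w ^ 2)"
  proof -
    have "r ^ m * (Ck / (a * b * c)) * (A * a) = (Ck * A) * (r ^ m / b) * (1 / c)" if "a \<noteq> 0" for a b c :: real
      using that by simp
    moreover have "w ^ (2 * m + 4) = w ^ m * w ^ (m + 2) * w ^ 2"
    proof -
      have "2 * m + 4 = m + (m + 2) + 2" by simp
      then show ?thesis by (simp only: power_add)
    qed
    moreover have "w ^ m \<noteq> 0" using w by simp
    ultimately show ?thesis by (simp only:)
  qed
  also have "\<dots> \<le> (Ck * A) * ((2 * (real m + 1)) ^ (m + 2) / t ^ 2) * (1 / w ^ 2)"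
  proof -
    have "r * t \<le> 2 * (real m + 1) * w" using rt by (simp add: w_def algebra_simps)
    then have "(r * t) ^ (m + 2) \<le> (2 * (real m + 1) * w) ^ (m + 2)" using r t by (intro power_mono) auto
    moreover have "r ^ m * t ^ 2 \<le> (r * t) ^ (m + 2)"
      unfolding power_mult_distrib using r t by (intro mult_mono power_increasing) auto
    ultimately have "r ^ m * t ^ 2 \<le> (2 * (real m + 1)) ^ (m + 2) * w ^ (m + 2)"
      unfolding power_mult_distrib by linarith
    then have "r ^ m / w ^ (m + 2) \<le> (2 * (real m + 1)) ^ (m + 2) / t ^ 2"
      using w t by (simp add: divide_simps mult_ac)
    then show ?thesis using Ck A w by (intro mult_right_mono mult_left_mono) auto
  qed
  finally show ?thesis by (simp add: far_const_def A_def w_def)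
qed

context weakly_differentiable
begin

lemma growth_affine:
  assumes growth: "AE s in lebesgue. norm (h s) \<le> Cg * (1 + \<bar>s\<bar>) ^ m" and r: "0 < r"
  shows "AE v in lebesgue. \<forall>k\<in>{1..m}. norm (h (t + real k * (v / r))) \<le> Cg * (1 + \<bar>t + real k * (v / r)\<bar>) ^ m"
proof (rule AE_finite_allI)
  obtain Y where Y: "Y \<in> null_sets lebesgue" "\<And>s. s \<notin> Y \<Longrightarrow> norm (h s) \<le> Cg * (1 + \<bar>s\<bar>) ^ m"
    using growth by (auto simp: eventually_ae_filter)
  fix k assume "k \<in> {1..m}"
  then have "AE v in lebesgue. t + (real k / r) * v \<notin> Y"
    using r by (intro AE_affine_avoid[OF Y(1)]) auto
  then show "AE v in lebesgue. norm (h (t + real k * (v / r))) \<le> Cg * (1 + \<bar>t + real k * (v / r)\<bar>) ^ m"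
    by eventually_elim (use Y(2) in simp)
qed simp

lemma kernel_mult_integrable:
  assumes growth: "AE s in lebesgue. norm (h s) \<le> Cg * (1 + \<bar>s\<bar>) ^ m" and Cg: "0 \<le> Cg"
    and Ck: "\<And>t. kernel N t \<le> Ck / (1 + \<bar>t\<bar>) ^ (2 * m + 4)" and r: "1 \<le> r" and k: "k \<le> m" and N: "1 \<le> N"
  shows "integrable lebesgue (\<lambda>v. of_real (kernel N v) * h (t + real k * (v / r)))"
proof (cases "k = 0")
  case True
  have "integrable lebesgue (kernel N)"
    using kernel_integrable[OF N] by (simp add: integrable_completion)
  then show ?thesis using True by simp
next
  case False
  then have k1: "k \<in> {1..m}" using k by auto
  have Ck0: "0 \<le> Ck" using order_trans[OF kernel_nonneg Ck[of 0]] by simp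
  define A where "A = Ck * (Cg * ((1 + \<bar>t\<bar>) * (1 + real m)) ^ m)"
  have "integrable lebesgue (\<lambda>v::real. A / (1 + \<bar>v\<bar>) ^ 2)"
    using integrable_inverse_square[of A] by (simp add: integrable_completion)
  then show ?thesis
  proof (rule Bochner_Integration.integrable_bound)
    have hm: "(\<lambda>v. h (t + real k * (v / r))) \<in> borel_measurable lebesgue"
      using h_affine_measurable[of "real k / r" t] False r by simp
    have "(\<lambda>v. complex_of_real (kernel N v)) \<in> borel_measurable lebesgue"
      using borel_measurable_integrable[OF kernel_integrable[OF N]]
      by (intro measurable_completion) simp
    then show "(\<lambda>v. of_real (kernel N v) * h (t + real k * (v / r))) \<in> borel_measurable lebesgue"
      using hm by (rule borel_measurable_times)
    show "AE v in lebesgue. norm (of_real (kernel N v) * h (t + real k * (v / r))) \<le> norm (A / (1 + \<bar>v\<bar>) ^ 2)"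
    proof -
      have "AE v in lebesgue. \<forall>k\<in>{1..m}. norm (h (t + real k * (v / r))) \<le> Cg * (1 + \<bar>t + real k * (v / r)\<bar>) ^ m"
        using r by (intro growth_affine growth) simp
      then show ?thesis
      proof eventually_elim
      case (elim v)
      then have g: "norm (h (t + real k * v / r)) \<le> Cg * (1 + \<bar>t + real k * v / r\<bar>) ^ m"
        using k1 by simp
      define w where "w = 1 + \<bar>v\<bar>"
      have w: "1 \<le> w" by (simp add: w_def)
      have "real k * \<bar>v\<bar> * 1 \<le> real k * \<bar>v\<bar> * r" using r by (intro mult_left_mono) auto
      then have "\<bar>real k * v / r\<bar> \<le> real k * \<bar>v\<bar>"
        using r by (simp add: abs_mult divide_le_eq)
      also have "\<dots> \<le> real m * \<bar>v\<bar>" using k by (intro mult_right_mono) auto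
      finally have "1 + \<bar>t + real k * v / r\<bar> \<le> 1 + (\<bar>t\<bar> + real m * \<bar>v\<bar>)" by linarith
      also have "\<dots> \<le> ((1 + \<bar>t\<bar>) * (1 + real m)) * w"
        by (simp add: w_def algebra_simps)
      finally have "(1 + \<bar>t + real k * v / r\<bar>) ^ m \<le> ((1 + \<bar>t\<bar>) * (1 + real m)) ^ m * w ^ m"
        unfolding power_mult_distrib[symmetric] by (intro power_mono) auto
      then have "Cg * (1 + \<bar>t + real k * v / r\<bar>) ^ m \<le> Cg * (((1 + \<bar>t\<bar>) * (1 + real m)) ^ m * w ^ m)"
        using Cg by (rule mult_left_mono)
      with g have "norm (h (t + real k * v / r)) \<le> Cg * (((1 + \<bar>t\<bar>) * (1 + real m)) ^ m * w ^ m)"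
        by linarith
      then have "kernel N v * norm (h (t + real k * v / r)) \<le> (Ck / w ^ (2 * m + 4)) * (Cg * (((1 + \<bar>t\<bar>) * (1 + real m)) ^ m * w ^ m))"
        using Ck[of v] Ck0 w by (intro mult_mono) (auto simp: w_def)
      also have "\<dots> = A * (w ^ m / w ^ (2 * m + 4))" by (simp add: A_def)
      also have "\<dots> \<le> A * (1 / w ^ 2)"
      proof (rule mult_left_mono)
        have "w ^ m * w ^ 2 \<le> w ^ (2 * m + 4)"
          unfolding power_add[symmetric] using w by (intro power_increasing) auto
        then show "w ^ m / w ^ (2 * m + 4) \<le> 1 / w ^ 2" using w by (simp add: divide_simps)
        show "0 \<le> A" using Ck0 Cg by (simp add: A_def)
      qed
      also have "A * (1 / w ^ 2) = A / w ^ 2" by simp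
      also have "A / w ^ 2 \<le> \<bar>A / w ^ 2\<bar>" by (rule abs_ge_self)
      finally show ?case
        by (simp add: kernel_nonneg w_def norm_mult)
      qed
    qed
  qed
qed

text \<open>For small steps \<open>\<sigma> = v / r\<close> the difference inequality applies. Substituting \<open>s = t + u * \<sigma>\<close> produces the missing power
  of \<open>\<sigma>\<close>, and \<open>r ^ m * \<bar>\<sigma>\<bar> ^ m = \<bar>v\<bar> ^ m\<close> is absorbed by the kernel.\<close>

lemma near_estimate:
  assumes Gb: "G \<in> borel_measurable borel" and r: "1 \<le> r" and v: "v \<noteq> 0" "\<bar>v\<bar> < r * t / (2 * (real m + 1))" and t: "0 < t"
    and Ck: "0 \<le> Ck" and \<theta>: "0 \<le> \<theta>" "\<theta> \<le> Ck / (1 + \<bar>v\<bar>) ^ (2 * m + 4)"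
    and D: "D \<le> \<bar>v / r\<bar> ^ (m - 1) * (LINT s:{t - (real m + 1) * \<bar>v / r\<bar>..t + (real m + 1) * \<bar>v / r\<bar>}|lebesgue. G s)"
  shows "ennreal (r ^ m * \<theta> * D) \<le> ennreal Ck * (\<integral>\<^sup>+ u. ennreal (1 / (1 + \<bar>v\<bar>) ^ 2) *
     (ennreal (G (t + u * (v / r))) * indicator {t / 2..3 * t / 2} (t + u * (v / r)) * indicator {- (real m + 1)..real m + 1} u) \<partial>lborel)"
proof -
  define \<sigma> where "\<sigma> = v / r"
  have \<sigma>: "\<sigma> \<noteq> 0" "(real m + 1) * \<bar>\<sigma>\<bar> \<le> t / 2" using v r by (auto simp: \<sigma>_def field_simps)
  define a b where "a = t - (real m + 1) * \<bar>\<sigma>\<bar>" and "b = t + (real m + 1) * \<bar>\<sigma>\<bar>"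
  define I where "I = (LINT s:{a..b}|lebesgue. G s)"
  have I0: "0 \<le> I"
    unfolding I_def set_lebesgue_integral_def by (intro Bochner_Integration.integral_nonneg) (simp add: G_nonneg)
  define F where "F s = ennreal (G s) * indicator {a..b} s" for s
  have Fm: "F \<in> borel_measurable borel" unfolding F_def using Gb by measurable
  have "ennreal I = (\<integral>\<^sup>+ s. ennreal (indicator {a..b} s *\<^sub>R G s) \<partial>lebesgue)"
    unfolding I_def set_lebesgue_integral_def
    by (rule nn_integral_eq_integral[symmetric]) (use loc_integrable_Icc[OF G_loc, of a b] in \<open>simp_all add: set_integrable_def G_nonneg\<close>)
  also have "\<dots> = (\<integral>\<^sup>+ s. ennreal (indicator {a..b} s *\<^sub>R G s) \<partial>lborel)"
    by (rule nn_integral_completion) (use Gb in measurable)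
  also have "\<dots> = (\<integral>\<^sup>+ s. F s \<partial>lborel)"
    by (intro nn_integral_cong) (simp add: F_def indicator_def)
  also have "\<dots> = ennreal \<bar>\<sigma>\<bar> * (\<integral>\<^sup>+ u. F (t + \<sigma> * u) \<partial>lborel)"
    by (rule nn_integral_real_affine[OF Fm \<sigma>(1)])
  finally have I: "ennreal I = ennreal \<bar>\<sigma>\<bar> * (\<integral>\<^sup>+ u. F (t + \<sigma> * u) \<partial>lborel)" .
  define w where "w = 1 + \<bar>v\<bar>"
  have w: "1 \<le> w" by (simp add: w_def)
  have "r ^ m * \<theta> * D \<le> r ^ m * \<theta> * (\<bar>\<sigma>\<bar> ^ (m - 1) * I)"
    using D r \<theta> by (intro mult_left_mono) (auto simp: I_def a_def b_def \<sigma>_def)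
  also have "\<dots> \<le> r ^ m * (Ck / w ^ (2 * m + 4)) * (\<bar>\<sigma>\<bar> ^ (m - 1) * I)"
    using \<theta> r I0 by (intro mult_right_mono mult_left_mono) (auto simp: w_def)
  finally have 1: "ennreal (r ^ m * \<theta> * D) \<le> ennreal (r ^ m * (Ck / w ^ (2 * m + 4)) * \<bar>\<sigma>\<bar> ^ (m - 1)) * ennreal I"
    using r Ck w by (simp add: ennreal_leI mult.assoc flip: ennreal_mult')
  have eq: "ennreal (r ^ m * (Ck / w ^ (2 * m + 4)) * \<bar>\<sigma>\<bar> ^ (m - 1)) * ennreal I =
      ennreal (r ^ m * (Ck / w ^ (2 * m + 4)) * \<bar>\<sigma>\<bar> ^ (m - 1)) * ennreal \<bar>\<sigma>\<bar> * (\<integral>\<^sup>+ u. F (t + \<sigma> * u) \<partial>lborel)"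
    unfolding I by (simp add: mult.assoc)
  have le2: "ennreal (r ^ m * (Ck / w ^ (2 * m + 4)) * \<bar>\<sigma>\<bar> ^ (m - 1)) * ennreal \<bar>\<sigma>\<bar> \<le> ennreal Ck * ennreal (1 / w ^ 2)"
  proof -
    have "\<bar>\<sigma>\<bar> ^ (m - 1) * \<bar>\<sigma>\<bar> = \<bar>\<sigma>\<bar> ^ m" using m by (cases m) auto
    then have "r ^ m * (Ck / w ^ (2 * m + 4)) * \<bar>\<sigma>\<bar> ^ (m - 1) * \<bar>\<sigma>\<bar> = Ck * ((r * \<bar>\<sigma>\<bar>) ^ m / w ^ (2 * m + 4))"
      by (simp add: power_mult_distrib mult_ac)
    also have "\<dots> \<le> Ck * (1 / w ^ 2)"
    proof (rule mult_left_mono[OF _ Ck])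
      have "r * \<bar>\<sigma>\<bar> = \<bar>v\<bar>" using r by (simp add: \<sigma>_def)
      then have "(r * \<bar>\<sigma>\<bar>) ^ m \<le> w ^ m" by (intro power_mono) (auto simp: w_def)
      then have "(r * \<bar>\<sigma>\<bar>) ^ m * w ^ 2 \<le> w ^ m * w ^ 2" using w by (intro mult_right_mono) auto
      also have "\<dots> = w ^ (m + 2)" by (simp only: power_add)
      also have "\<dots> \<le> w ^ (2 * m + 4)" using w by (intro power_increasing) auto
      finally show "(r * \<bar>\<sigma>\<bar>) ^ m / w ^ (2 * m + 4) \<le> 1 / w ^ 2" using w by (simp add: divide_simps)
    qed
    finally have le: "r ^ m * (Ck / w ^ (2 * m + 4)) * \<bar>\<sigma>\<bar> ^ (m - 1) * \<bar>\<sigma>\<bar> \<le> Ck * (1 / w ^ 2)" .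
    have nn: "0 \<le> r ^ m * (Ck / w ^ (2 * m + 4)) * \<bar>\<sigma>\<bar> ^ (m - 1)" using r Ck w by simp
    show ?thesis
      unfolding ennreal_mult'[OF nn, symmetric] ennreal_mult'[OF Ck, symmetric] by (rule ennreal_leI[OF le])
  qed
  have 2: "ennreal (r ^ m * \<theta> * D) \<le> ennreal Ck * ennreal (1 / w ^ 2) * (\<integral>\<^sup>+ u. F (t + \<sigma> * u) \<partial>lborel)"
    by (rule order_trans[OF 1]) (unfold eq, rule mult_right_mono[OF le2], simp)
  have F_le: "F (t + \<sigma> * u) \<le> ennreal (G (t + u * (v / r))) * indicator {t / 2..3 * t / 2} (t + u * (v / r)) * indicator {- (real m + 1)..real m + 1} u" for u
  proof (cases "t + \<sigma> * u \<in> {a..b}")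
    case True
    then have "\<bar>\<sigma>\<bar> * \<bar>u\<bar> \<le> \<bar>\<sigma>\<bar> * (real m + 1)" by (auto simp: a_def b_def abs_le_iff mult.commute simp flip: abs_mult)
    then have "\<bar>u\<bar> \<le> real m + 1" using \<sigma>(1) by simp
    moreover have "t + \<sigma> * u \<in> {t / 2..3 * t / 2}" using True \<sigma>(2) by (auto simp: a_def b_def)
    ultimately show ?thesis using True by (simp add: F_def \<sigma>_def mult.commute abs_le_iff)
  qed (simp add: F_def)
  have "ennreal Ck * ennreal (1 / w ^ 2) * (\<integral>\<^sup>+ u. F (t + \<sigma> * u) \<partial>lborel)
    = ennreal Ck * (\<integral>\<^sup>+ u. ennreal (1 / w ^ 2) * F (t + \<sigma> * u) \<partial>lborel)"
    using Fm by (subst nn_integral_cmult) (auto simp: mult.assoc)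
  also have "\<dots> \<le> ennreal Ck * (\<integral>\<^sup>+ u. ennreal (1 / w ^ 2) *
     (ennreal (G (t + u * (v / r))) * indicator {t / 2..3 * t / 2} (t + u * (v / r)) * indicator {- (real m + 1)..real m + 1} u) \<partial>lborel)"
    by (intro mult_left_mono nn_integral_mono F_le) simp_all
  finally show ?thesis using 2 unfolding w_def by (rule order_trans[rotated])
qed

text \<open>Integrate the \<open>m\<close>-th difference with step \<open>v / r\<close> against the kernel. The term without shift is \<open>h t\<close> times the mass of the
  kernel, the shifted ones are the low frequency terms, bounded here by \<open>L\<close>. The exceptional null set
  depends neither on the scale \<open>r\<close> nor on \<open>N\<close> and \<open>L\<close>, which may therefore be chosen depending on \<open>t\<close>.\<close>

lemma pointwise_estimate:
  assumes Gb: "G \<in> borel_measurable borel"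
    and growth: "AE s in lebesgue. norm (h s) \<le> Cg * (1 + \<bar>s\<bar>) ^ m" and Cg: "0 \<le> Cg"
    and Ck: "\<And>N t. kernel N t \<le> Ck / (1 + \<bar>t\<bar>) ^ (2 * m + 4)"
    and c0: "\<And>N. 1 \<le> N \<Longrightarrow> c0 \<le> integral\<^sup>L lborel (kernel N)"
  shows "AE t in lebesgue. 1 \<le> t \<longrightarrow> (\<forall>r N L. 1 \<le> r \<longrightarrow> 1 \<le> N \<longrightarrow>
      (\<forall>k\<in>{1..m}. norm (LINT v|lebesgue. of_real (kernel N v) * h (t + real k * (v / r))) \<le> L) \<longrightarrow>
      ennreal (c0 * (r ^ m * norm (h t))) \<le> ennreal Ck * window m G r t +
        ennreal (far_const m Cg Ck * inverse_square_mass / t ^ 2) + ennreal (r ^ m * (real m * 2 ^ m * L)))"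
proof -
  have Ck0: "0 \<le> Ck" using order_trans[OF kernel_nonneg Ck[of 0 0]] by simp
  have far0: "0 \<le> far_const m Cg Ck" using Ck0 Cg by (simp add: far_const_def)
  obtain Z where Z: "Z \<in> null_sets lebesgue"
    "\<And>t \<sigma> a b. (\<And>k. k \<le> m \<Longrightarrow> t + real k * \<sigma> \<notin> Z) \<Longrightarrow> \<sigma> \<noteq> 0 \<Longrightarrow> 0 < a \<Longrightarrow> a \<le> t \<Longrightarrow> a \<le> t + real m * \<sigma> \<Longrightarrow>
      t + \<bar>\<sigma>\<bar> \<le> b \<Longrightarrow> t + real m * \<sigma> + \<bar>\<sigma>\<bar> \<le> b \<Longrightarrow>
      norm (dif m \<sigma> h t) \<le> \<bar>\<sigma>\<bar> ^ (m - 1) * (LINT s:{a..b}|lebesgue. G s)"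
    using difference_inequality by blast
  have "AE t in lebesgue. t \<notin> Z" using Z(1) by (rule AE_not_in)
  with growth show ?thesis
  proof eventually_elim
    case (elim t)
    show ?case
    proof (intro impI allI)
      fix r :: real and N :: nat and L :: real
      assume t: "1 \<le> t" and r: "1 \<le> r" and N: "1 \<le> N"
        and low: "\<forall>k\<in>{1..m}. norm (LINT v|lebesgue. of_real (kernel N v) * h (t + real k * (v / r))) \<le> L"
      define D where "D v = dif m (v / r) h t" for v
      define \<theta> where "\<theta> = kernel N"
      note int = kernel_mult_integrable[OF growth Cg Ck r _ N, where t=t, folded \<theta>_def]
      have eqD: "of_real (\<theta> v) * D v = (\<Sum>k\<le>m. (of_nat (m choose k) * (-1) ^ (m - k)) * (of_real (\<theta> v) * h (t + real k * (v / r))))" for v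
        unfolding D_def dif_def sum_distrib_left by (intro sum.cong refl) (simp only: ac_simps)
      have intD: "integrable lebesgue (\<lambda>v. of_real (\<theta> v) * D v)"
        unfolding eqD by (intro Bochner_Integration.integrable_sum integrable_mult_right int) simp
      define J where "J k = (LINT v|lebesgue. of_real (\<theta> v) * h (t + real k * (v / r)))" for k
      have "(LINT v|lebesgue. of_real (\<theta> v) * D v) = (\<Sum>k\<le>m. of_nat (m choose k) * (-1) ^ (m - k) * J k)"
        unfolding eqD J_def integral_mult_right_zero[symmetric]
        by (intro Bochner_Integration.integral_sum integrable_mult_right int) simp
      also have "\<dots> = (-1) ^ m * J 0 + (\<Sum>k=1..m. of_nat (m choose k) * (-1) ^ (m - k) * J k)"
      proof -
        have "{..m} = insert 0 {1..m}" by auto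
        then show ?thesis by simp
      qed
      finally have "(-1) ^ m * J 0 = (LINT v|lebesgue. of_real (\<theta> v) * D v) - (\<Sum>k=1..m. of_nat (m choose k) * (-1) ^ (m - k) * J k)"
        by simp
      then have "norm (J 0) = norm ((LINT v|lebesgue. of_real (\<theta> v) * D v) - (\<Sum>k=1..m. of_nat (m choose k) * ((-1) ^ (m - k) * J k)))"
        by (metis (no_types, lifting) mult.assoc norm_minus_cancel norm_mult norm_one norm_power power_one mult_1 sum.cong)
      also have "\<dots> \<le> (LINT v|lebesgue. \<theta> v * norm (D v)) + (\<Sum>k=1..m. 2 ^ m * L)"
      proof (intro order_trans[OF norm_triangle_ineq4] add_mono order_trans[OF norm_sum] sum_mono)
        have "norm (LINT v|lebesgue. of_real (\<theta> v) * D v) \<le> (LINT v|lebesgue. norm (of_real (\<theta> v) * D v))"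
          by (rule integral_norm_bound)
        then show "norm (LINT v|lebesgue. of_real (\<theta> v) * D v) \<le> (LINT v|lebesgue. \<theta> v * norm (D v))"
          by (simp add: norm_mult \<theta>_def kernel_nonneg)
        fix k assume k: "k \<in> {1..m}"
        show "norm (of_nat (m choose k) * ((-1) ^ (m - k) * J k)) \<le> 2 ^ m * L"
          using low k by (intro order_trans[OF norm_dif_coeff] mult_left_mono) (auto simp: J_def \<theta>_def)
      qed
      finally have J0: "norm (J 0) \<le> (LINT v|lebesgue. \<theta> v * norm (D v)) + real m * 2 ^ m * L" by simp
      have "J 0 = of_real (integral\<^sup>L lborel (kernel N)) * h t"
      proof -
        have "J 0 = (LINT v|lebesgue. complex_of_real (\<theta> v)) * h t" by (simp add: J_def)
        also have "(LINT v|lebesgue. complex_of_real (\<theta> v)) = of_real (integral\<^sup>L lebesgue \<theta>)"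
          by (rule integral_of_real) (use kernel_integrable[OF N] in \<open>simp add: \<theta>_def integrable_completion\<close>)
        also have "integral\<^sup>L lebesgue \<theta> = integral\<^sup>L lborel (kernel N)"
          unfolding \<theta>_def by (rule integral_completion) (use kernel_integrable[OF N] in \<open>simp add: borel_measurable_integrable\<close>)
        finally show ?thesis .
      qed
      then have "c0 * norm (h t) \<le> norm (J 0)"
        using mult_right_mono[OF order_trans[OF c0[OF N] abs_ge_self] norm_ge_zero[of "h t"]] by (simp add: norm_mult)
      with J0 have "c0 * norm (h t) \<le> (LINT v|lebesgue. \<theta> v * norm (D v)) + real m * 2 ^ m * L" by linarith
      then have "r ^ m * (c0 * norm (h t)) \<le> r ^ m * ((LINT v|lebesgue. \<theta> v * norm (D v)) + real m * 2 ^ m * L)"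
        using r by (intro mult_left_mono) auto
      then have "c0 * (r ^ m * norm (h t)) \<le> r ^ m * (LINT v|lebesgue. \<theta> v * norm (D v)) + r ^ m * (real m * 2 ^ m * L)"
        by (simp add: algebra_simps)
      then have main: "ennreal (c0 * (r ^ m * norm (h t))) \<le> ennreal (r ^ m * (LINT v|lebesgue. \<theta> v * norm (D v))) + ennreal (r ^ m * (real m * 2 ^ m * L))"
      proof -
        assume le: "c0 * (r ^ m * norm (h t)) \<le> r ^ m * (LINT v|lebesgue. \<theta> v * norm (D v)) + r ^ m * (real m * 2 ^ m * L)"
        have L: "0 \<le> L" using low m by (meson atLeastAtMost_iff norm_ge_zero order_refl order_trans)
        have "0 \<le> (LINT v|lebesgue. \<theta> v * norm (D v))"
          by (rule Bochner_Integration.integral_nonneg) (simp add: \<theta>_def kernel_nonneg)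
        have "ennreal (c0 * (r ^ m * norm (h t))) \<le> ennreal (r ^ m * (LINT v|lebesgue. \<theta> v * norm (D v)) + r ^ m * (real m * 2 ^ m * L))"
          by (rule ennreal_leI[OF le])
        also have "\<dots> = ennreal (r ^ m * (LINT v|lebesgue. \<theta> v * norm (D v))) + ennreal (r ^ m * (real m * 2 ^ m * L))"
          by (rule ennreal_plus) (use L r \<open>0 \<le> (LINT v|lebesgue. \<theta> v * norm (D v))\<close> in simp_all)
        finally show ?thesis .
      qed
      have intND: "integrable lebesgue (\<lambda>v. \<theta> v * norm (D v))"
        using integrable_norm[OF intD] by (simp add: norm_mult \<theta>_def kernel_nonneg)
      have "ennreal (r ^ m * (LINT v|lebesgue. \<theta> v * norm (D v))) = ennreal (LINT v|lebesgue. r ^ m * (\<theta> v * norm (D v)))"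
        by simp
      also have "\<dots> = (\<integral>\<^sup>+ v. ennreal (r ^ m * (\<theta> v * norm (D v))) \<partial>lebesgue)"
        by (rule nn_integral_eq_integral[symmetric]) (use intND r in \<open>auto simp: \<theta>_def kernel_nonneg\<close>)
      also have "\<dots> \<le> (\<integral>\<^sup>+ v. ennreal Ck * (\<integral>\<^sup>+ u. ennreal (1 / (1 + \<bar>v\<bar>) ^ 2) *
         (ennreal (G (t + u * (v / r))) * indicator {t / 2..3 * t / 2} (t + u * (v / r)) * indicator {- (real m + 1)..real m + 1} u) \<partial>lborel)
         + ennreal (far_const m Cg Ck / t ^ 2) * ennreal (1 / (1 + \<bar>v\<bar>) ^ 2) \<partial>lebesgue)"
      proof (rule nn_integral_mono_AE)
        have "AE v in lebesgue. \<forall>k\<in>{1..m}. t + (real k / r) * v \<notin> Z"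
          using r by (intro AE_finite_allI AE_affine_avoid[OF Z(1)]) auto
        moreover have "AE v in lebesgue. v \<notin> {0::real}" by (intro AE_not_in) simp
        moreover have "AE v in lebesgue. \<forall>k\<in>{1..m}. norm (h (t + real k * (v / r))) \<le> Cg * (1 + \<bar>t + real k * (v / r)\<bar>) ^ m"
          using r by (intro growth_affine growth) simp
        ultimately show "AE v in lebesgue. ennreal (r ^ m * (\<theta> v * norm (D v))) \<le> ennreal Ck * (\<integral>\<^sup>+ u. ennreal (1 / (1 + \<bar>v\<bar>) ^ 2) *
         (ennreal (G (t + u * (v / r))) * indicator {t / 2..3 * t / 2} (t + u * (v / r)) * indicator {- (real m + 1)..real m + 1} u) \<partial>lborel)
         + ennreal (far_const m Cg Ck / t ^ 2) * ennreal (1 / (1 + \<bar>v\<bar>) ^ 2)"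
        proof eventually_elim
          case (elim v)
          show ?case
          proof (cases "\<bar>v\<bar> < r * t / (2 * (real m + 1))")
            case True
            define \<sigma> where "\<sigma> = v / r"
            have v0: "v \<noteq> 0" using elim by simp
            have "(real m + 1) * \<bar>\<sigma>\<bar> \<le> t / 2" using True r by (auto simp: \<sigma>_def field_simps)
            then have \<sigma>2: "(real m + 1) * \<bar>\<sigma>\<bar> < t" using t by linarith
            have \<sigma>1: "\<sigma> \<noteq> 0" using v0 r by (simp add: \<sigma>_def)
            note \<sigma> = \<sigma>1 \<sigma>2
            have nodes: "t + real k * \<sigma> \<notin> Z" if "k \<le> m" for k
              using that elim(1) \<open>t \<notin> Z\<close> by (cases "k = 0") (auto simp: \<sigma>_def)
            have m\<sigma>: "\<bar>real m * \<sigma>\<bar> = real m * \<bar>\<sigma>\<bar>" "(real m + 1) * \<bar>\<sigma>\<bar> = real m * \<bar>\<sigma>\<bar> + \<bar>\<sigma>\<bar>" by (simp_all add: abs_mult algebra_simps)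
            have b1: "0 \<le> real m * \<bar>\<sigma>\<bar>" by simp
            have "norm (dif m \<sigma> h t) \<le> \<bar>\<sigma>\<bar> ^ (m - 1) * (LINT s:{t - (real m + 1) * \<bar>\<sigma>\<bar>..t + (real m + 1) * \<bar>\<sigma>\<bar>}|lebesgue. G s)"
              by (rule Z(2)[OF nodes \<sigma>(1)]) (use \<sigma>(2) m\<sigma> b1 in \<open>linarith+\<close>)
            then have "ennreal (r ^ m * \<theta> v * norm (D v)) \<le> ennreal Ck * (\<integral>\<^sup>+ u. ennreal (1 / (1 + \<bar>v\<bar>) ^ 2) *
               (ennreal (G (t + u * (v / r))) * indicator {t / 2..3 * t / 2} (t + u * (v / r)) * indicator {- (real m + 1)..real m + 1} u) \<partial>lborel)"
              using t by (intro near_estimate Gb r v0 True Ck0) (auto simp: \<theta>_def kernel_nonneg Ck D_def \<sigma>_def)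
            then show ?thesis by (simp add: mult.assoc add_increasing2)
          next
            case False
            have nodes: "norm (h (t + real k * (v / r))) \<le> Cg * (1 + (t + real m * (\<bar>v\<bar> / r))) ^ m" if "k \<le> m" for k
            proof -
              have "norm (h (t + real k * (v / r))) \<le> Cg * (1 + \<bar>t + real k * (v / r)\<bar>) ^ m"
                using elim(3) that \<open>norm (h t) \<le> Cg * (1 + \<bar>t\<bar>) ^ m\<close> by (cases "k = 0") auto
              also have "\<dots> \<le> Cg * (1 + (t + real m * (\<bar>v\<bar> / r))) ^ m"
              proof (intro mult_left_mono power_mono Cg add_left_mono)
                have "\<bar>real k * (v / r)\<bar> = real k * (\<bar>v\<bar> / r)" using r by (simp add: abs_mult)
                also have "\<dots> \<le> real m * (\<bar>v\<bar> / r)" using that r by (intro mult_right_mono) auto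
                finally show "\<bar>t + real k * (v / r)\<bar> \<le> t + real m * (\<bar>v\<bar> / r)" using t by linarith
              qed simp
              finally show ?thesis .
            qed
            have "norm (D v) \<le> (real m + 1) * 2 ^ m * (Cg * (1 + (t + real m * (\<bar>v\<bar> / r))) ^ m)"
              unfolding D_def by (rule norm_dif_le) (rule nodes)
            then have "r ^ m * \<theta> v * norm (D v) \<le> far_const m Cg Ck / t ^ 2 * (1 / (1 + \<bar>v\<bar>) ^ 2)"
              using False by (intro far_estimate r t Ck0 Cg) (auto simp: \<theta>_def kernel_nonneg Ck)
            then have "ennreal (r ^ m * (\<theta> v * norm (D v))) \<le> ennreal (far_const m Cg Ck / t ^ 2) * ennreal (1 / (1 + \<bar>v\<bar>) ^ 2)"
              using far0 by (subst ennreal_mult'[symmetric]) (auto intro!: ennreal_leI simp: mult.assoc)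
            then show ?thesis by (rule order_trans) (simp add: add_increasing)
          qed
        qed
      qed
      also have "\<dots> = (\<integral>\<^sup>+ v. ennreal Ck * (\<integral>\<^sup>+ u. ennreal (1 / (1 + \<bar>v\<bar>) ^ 2) *
         (ennreal (G (t + u * (v / r))) * indicator {t / 2..3 * t / 2} (t + u * (v / r)) * indicator {- (real m + 1)..real m + 1} u) \<partial>lborel)
         + ennreal (far_const m Cg Ck / t ^ 2) * ennreal (1 / (1 + \<bar>v\<bar>) ^ 2) \<partial>lborel)"
        by (rule nn_integral_completion) (use Gb in measurable)
      also have "\<dots> = ennreal Ck * window m G r t + ennreal (far_const m Cg Ck / t ^ 2) * ennreal inverse_square_mass"
      proof -
        have 1: "(\<lambda>v. \<integral>\<^sup>+ u. ennreal (1 / (1 + \<bar>v\<bar>) ^ 2) *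
         (ennreal (G (t + u * (v / r))) * indicator {t / 2..3 * t / 2} (t + u * (v / r)) * indicator {- (real m + 1)..real m + 1} u) \<partial>lborel) \<in> borel_measurable lborel"
          using Gb by measurable
        have 2: "(\<lambda>v::real. ennreal (1 / (1 + \<bar>v\<bar>) ^ 2)) \<in> borel_measurable lborel" by measurable
        show ?thesis
          unfolding window_def nn_integral_inverse_square[symmetric]
          using 1 2 by (subst nn_integral_add) (simp_all add: nn_integral_cmult)
      qed
      also have "ennreal (far_const m Cg Ck / t ^ 2) * ennreal inverse_square_mass = ennreal (far_const m Cg Ck * inverse_square_mass / t ^ 2)"
        using far0 by (simp add: ennreal_mult'[symmetric])
      finally show "ennreal (c0 * (r ^ m * norm (h t))) \<le> ennreal Ck * window m G r t +
        ennreal (far_const m Cg Ck * inverse_square_mass / t ^ 2) + ennreal (r ^ m * (real m * 2 ^ m * L))"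
        using main by (intro order_trans[OF main] add_right_mono)
    qed
  qed
qed

end

section \<open>Summation over dyadic blocks\<close>

definition window_mass :: "nat \<Rightarrow> real" where
  "window_mass m = inverse_square_mass * (2 * real m + 2)"

lemma window_mass_nonneg: "0 \<le> window_mass m"
  by (simp add: window_mass_def inverse_square_mass_nonneg)

lemma nn_integral_window_weights:
  "(\<integral>\<^sup>+ v. \<integral>\<^sup>+ u. ennreal (1 / (1 + \<bar>v\<bar>) ^ 2) * (c * indicator {- (real m + 1)..real m + 1} u) \<partial>lborel \<partial>lborel)
    = ennreal (window_mass m) * c"
proof -
  have "(\<integral>\<^sup>+ u. ennreal (1 / (1 + \<bar>v\<bar>) ^ 2) * (c * indicator {- (real m + 1)..real m + 1} u) \<partial>lborel)
      = ennreal (1 / (1 + \<bar>v\<bar>) ^ 2) * (c * ennreal (2 * real m + 2))" for v :: real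
    by (simp add: nn_integral_cmult nn_integral_cmult_indicator)
  then have "(\<integral>\<^sup>+ v. \<integral>\<^sup>+ u. ennreal (1 / (1 + \<bar>v\<bar>) ^ 2) * (c * indicator {- (real m + 1)..real m + 1} u) \<partial>lborel \<partial>lborel)
      = (\<integral>\<^sup>+ v. ennreal (1 / (1 + \<bar>v\<bar>) ^ 2) * (c * ennreal (2 * real m + 2)) \<partial>lborel)"
    by simp
  also have "\<dots> = ennreal inverse_square_mass * (c * ennreal (2 * real m + 2))"
    by (subst nn_integral_multc) (simp_all add: nn_integral_inverse_square)
  also have "\<dots> = ennreal (window_mass m) * c"
    unfolding window_mass_def by (simp add: ennreal_mult'[OF inverse_square_mass_nonneg] ac_simps)
  finally show ?thesis .
qed

lemma window_mono_affine:
  assumes [measurable]: "G \<in> borel_measurable borel" "g \<in> borel_measurable borel"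
    and ab: "0 \<le> a" "0 \<le> b" and le: "\<And>s. G s \<le> a + b * g s" and g: "\<And>s. 0 \<le> g s"
  shows "window m G r t \<le> ennreal (window_mass m * a) + ennreal b * window m g r t"
proof -
  define k where "k v = ennreal (1 / (1 + \<bar>v\<bar>) ^ 2)" for v :: real
  define I where "I u = (indicator {- (real m + 1)..real m + 1} u :: ennreal)" for u
  define X where "X s = (indicator {t / 2..3 * t / 2} s :: ennreal)" for s
  have [measurable]: "k \<in> borel_measurable borel" "I \<in> borel_measurable borel" "X \<in> borel_measurable borel"
    unfolding k_def I_def X_def by measurable
  have "k v * (ennreal (G s) * X s * I u) \<le> k v * (ennreal a * I u) + ennreal b * (k v * (ennreal (g s) * X s * I u))" for v u s
  proof -
    have "ennreal (G s) \<le> ennreal a + ennreal b * ennreal (g s)"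
      using ennreal_leI[OF le[of s]] ab g[of s] by (simp add: ennreal_plus ennreal_mult)
    then have "ennreal (G s) * X s \<le> (ennreal a + ennreal b * ennreal (g s)) * X s" by (rule mult_right_mono) simp
    also have "\<dots> \<le> ennreal a + ennreal b * ennreal (g s) * X s"
      by (simp add: distrib_right X_def indicator_def)
    finally have "k v * (ennreal (G s) * X s * I u) \<le> k v * ((ennreal a + ennreal b * ennreal (g s) * X s) * I u)"
      by (intro mult_left_mono mult_right_mono) auto
    also have "\<dots> = k v * (ennreal a * I u) + ennreal b * (k v * (ennreal (g s) * X s * I u))"
      by (simp add: distrib_left distrib_right mult_ac)
    finally show ?thesis .
  qed
  then have "window m G r t \<le> (\<integral>\<^sup>+ v. \<integral>\<^sup>+ u. k v * (ennreal a * I u) +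
      ennreal b * (k v * (ennreal (g (t + u * (v / r))) * X (t + u * (v / r)) * I u)) \<partial>lborel \<partial>lborel)"
    unfolding window_def k_def[symmetric] I_def[symmetric] X_def[symmetric] by (intro nn_integral_mono)
  also have "\<dots> = (\<integral>\<^sup>+ v. \<integral>\<^sup>+ u. k v * (ennreal a * I u) \<partial>lborel \<partial>lborel) +
      ennreal b * (\<integral>\<^sup>+ v. \<integral>\<^sup>+ u. k v * (ennreal (g (t + u * (v / r))) * X (t + u * (v / r)) * I u) \<partial>lborel \<partial>lborel)"
    by (simp add: nn_integral_add nn_integral_cmult)
  also have "(\<integral>\<^sup>+ v. \<integral>\<^sup>+ u. k v * (ennreal a * I u) \<partial>lborel \<partial>lborel) = ennreal (window_mass m) * ennreal a"
    unfolding k_def I_def by (rule nn_integral_window_weights)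
  finally show ?thesis
    unfolding window_def k_def[symmetric] I_def[symmetric] X_def[symmetric]
    using ab window_mass_nonneg[of m] by (simp add: ennreal_mult')
qed

text \<open>Fubini: for fixed \<open>u\<close> and \<open>v\<close> the inner function is a translate of \<open>g\<close>, because the scale \<open>r\<close> does not depend on \<open>t\<close>.\<close>

lemma window_integral:
  assumes g[measurable]: "g \<in> borel_measurable borel" and ab: "0 \<le> a" "a \<le> b"
  shows "(\<integral>\<^sup>+ t. window m g r t * indicator {a..<b} t \<partial>lborel)
    \<le> ennreal (window_mass m) * (\<integral>\<^sup>+ s. ennreal (g s) * indicator {a / 2..<3 * b / 2} s \<partial>lborel)"
proof -
  define k where "k v = ennreal (1 / (1 + \<bar>v\<bar>) ^ 2)" for v :: real
  define I where "I u = (indicator {- (real m + 1)..real m + 1} u :: ennreal)" for u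
  define Y where "Y s = ennreal (g s) * indicator {a / 2..<3 * b / 2} s" for s
  have [measurable]: "k \<in> borel_measurable borel" "I \<in> borel_measurable borel" "Y \<in> borel_measurable borel"
    unfolding k_def I_def Y_def by measurable
  have "window m g r t * indicator {a..<b} t \<le> (\<integral>\<^sup>+ v. \<integral>\<^sup>+ u. k v * (Y (t + u * (v / r)) * I u) \<partial>lborel \<partial>lborel)" for t
  proof (cases "t \<in> {a..<b}")
    case True
    have "ennreal (g s) * indicator {t / 2..3 * t / 2} s \<le> Y s" for s
      using True unfolding Y_def by (intro mult_left_mono) (auto simp: indicator_def)
    then show ?thesis
      using True unfolding window_def k_def[symmetric] I_def[symmetric]
      by simp (intro nn_integral_mono mult_left_mono mult_right_mono, auto)
  qed simp
  then have "(\<integral>\<^sup>+ t. window m g r t * indicator {a..<b} t \<partial>lborel)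
      \<le> (\<integral>\<^sup>+ t. \<integral>\<^sup>+ v. \<integral>\<^sup>+ u. k v * (Y (t + u * (v / r)) * I u) \<partial>lborel \<partial>lborel \<partial>lborel)"
    by (rule nn_integral_mono)
  also have "\<dots> = (\<integral>\<^sup>+ v. \<integral>\<^sup>+ t. \<integral>\<^sup>+ u. k v * (Y (t + u * (v / r)) * I u) \<partial>lborel \<partial>lborel \<partial>lborel)"
    by (rule lborel_pair.Fubini') measurable
  also have "\<dots> = (\<integral>\<^sup>+ v. \<integral>\<^sup>+ u. \<integral>\<^sup>+ t. k v * (Y (t + u * (v / r)) * I u) \<partial>lborel \<partial>lborel \<partial>lborel)"
    by (intro nn_integral_cong lborel_pair.Fubini') measurable
  also have "\<dots> = (\<integral>\<^sup>+ v. \<integral>\<^sup>+ u. k v * ((\<integral>\<^sup>+ s. Y s \<partial>lborel) * I u) \<partial>lborel \<partial>lborel)"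
  proof (intro nn_integral_cong)
    fix v u :: real
    have "(\<integral>\<^sup>+ t. k v * (Y (t + u * (v / r)) * I u) \<partial>lborel) = k v * ((\<integral>\<^sup>+ t. Y (t + u * (v / r)) \<partial>lborel) * I u)"
      by (simp add: nn_integral_cmult nn_integral_multc)
    also have "(\<integral>\<^sup>+ t. Y (t + u * (v / r)) \<partial>lborel) = (\<integral>\<^sup>+ s. Y s \<partial>lborel)"
      using nn_integral_real_affine[of Y 1 "u * (v / r)"] by (simp add: add.commute)
    finally show "(\<integral>\<^sup>+ t. k v * (Y (t + u * (v / r)) * I u) \<partial>lborel) = k v * ((\<integral>\<^sup>+ s. Y s \<partial>lborel) * I u)" .
  qed
  also have "\<dots> = ennreal (window_mass m) * (\<integral>\<^sup>+ s. Y s \<partial>lborel)"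
    unfolding k_def I_def by (rule nn_integral_window_weights)
  finally show ?thesis by (simp add: Y_def)
qed

definition dyadic :: "nat \<Rightarrow> real set" where
  "dyadic i = {2 ^ i..<2 ^ Suc i}"

lemma dyadic_disjoint: "disjoint_family dyadic"
proof -
  have "dyadic i \<inter> dyadic j = {}" if "i < j" for i j
  proof -
    have "(2::real) ^ Suc i \<le> 2 ^ j" using that by (intro power_increasing) auto
    then show ?thesis by (auto simp: dyadic_def)
  qed
  then show ?thesis
    unfolding disjoint_family_on_def by (metis Int_commute linorder_neqE_nat)
qed

lemma dyadic_cover:
  assumes "2 ^ n \<le> (t::real)"
  obtains i where "n \<le> i" "t \<in> dyadic i"
proof -
  have "\<exists>j. t < 2 ^ j" using real_arch_pow[of 2 t] by auto
  define j where "j = (LEAST j. t < 2 ^ j)"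
  have j: "t < 2 ^ j" unfolding j_def using \<open>\<exists>j. t < 2 ^ j\<close> by (rule LeastI_ex)
  have "n < j"
  proof (rule ccontr)
    assume "\<not> n < j"
    then have "(2::real) ^ j \<le> 2 ^ n" by (intro power_increasing) auto
    then show False using j assms by linarith
  qed
  then obtain i where i: "j = Suc i" by (cases j) auto
  have "\<not> t < 2 ^ i" using not_less_Least[of i "\<lambda>j. t < 2 ^ j"] i by (simp add: j_def[symmetric])
  with j i \<open>n < j\<close> that[of i] show ?thesis by (auto simp: dyadic_def)
qed

lemma dyadic_sum_le:
  assumes g[measurable]: "g \<in> borel_measurable borel"
  shows "(\<Sum>i. \<integral>\<^sup>+ s. g s * indicator (dyadic (i + c)) s \<partial>lborel) \<le> (\<integral>\<^sup>+ s. g s \<partial>lborel)"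
proof -
  have [measurable]: "dyadic i \<in> sets borel" for i by (simp add: dyadic_def)
  have "(\<Sum>i. \<integral>\<^sup>+ s. g s * indicator (dyadic (i + c)) s \<partial>lborel) = (\<integral>\<^sup>+ s. (\<Sum>i. g s * indicator (dyadic (i + c)) s) \<partial>lborel)"
    by (rule nn_integral_suminf[symmetric]) measurable
  also have "\<dots> = (\<integral>\<^sup>+ s. g s * (\<Sum>i. indicator (dyadic (i + c)) s) \<partial>lborel)"
    by (simp add: ennreal_suminf_cmult)
  also have "\<dots> \<le> (\<integral>\<^sup>+ s. g s * 1 \<partial>lborel)"
  proof (intro nn_integral_mono mult_left_mono)
    fix s
    have "disjoint_family (\<lambda>i. dyadic (i + c))"
      using dyadic_disjoint by (auto simp: disjoint_family_on_def)
    from suminf_indicator[OF this, of s]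
    have "(\<Sum>i. indicator (dyadic (i + c)) s :: ennreal) = indicator (\<Union>i. dyadic (i + c)) s" .
    then show "(\<Sum>i. indicator (dyadic (i + c)) s) \<le> (1::ennreal)" by (simp add: indicator_def)
  qed simp
  finally show ?thesis by simp
qed

text \<open>On \<open>dyadic (Suc i)\<close> the window sees points in three consecutive dyadic blocks only, so the scales \<open>r i\<close> may vary
  freely from block to block.\<close>

lemma window_sum_le:
  assumes g[measurable]: "g \<in> borel_measurable borel"
  shows "(\<Sum>i. \<integral>\<^sup>+ t. window m g (r i) t * indicator (dyadic (Suc i)) t \<partial>lborel)
    \<le> ennreal (3 * window_mass m) * (\<integral>\<^sup>+ s. ennreal (g s) \<partial>lborel)"
proof -
  have [measurable]: "dyadic i \<in> sets borel" for i by (simp add: dyadic_def)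
  define D where "D c i = (\<integral>\<^sup>+ s. ennreal (g s) * indicator (dyadic (i + c)) s \<partial>lborel)" for c i
  have D: "(\<Sum>i. D c i) \<le> (\<integral>\<^sup>+ s. ennreal (g s) \<partial>lborel)" for c
    unfolding D_def by (rule dyadic_sum_le) measurable
  have "(\<integral>\<^sup>+ t. window m g (r i) t * indicator (dyadic (Suc i)) t \<partial>lborel) \<le> ennreal (window_mass m) * (D 0 i + D 1 i + D 2 i)" for i
  proof -
    have "(\<integral>\<^sup>+ t. window m g (r i) t * indicator (dyadic (Suc i)) t \<partial>lborel)
        \<le> ennreal (window_mass m) * (\<integral>\<^sup>+ s. ennreal (g s) * indicator {2 ^ Suc i / 2..<3 * 2 ^ Suc (Suc i) / 2} s \<partial>lborel)"
      unfolding dyadic_def by (rule window_integral) simp_all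
    also have "(\<integral>\<^sup>+ s. ennreal (g s) * indicator {2 ^ Suc i / 2..<3 * 2 ^ Suc (Suc i) / 2} s \<partial>lborel)
        \<le> (\<integral>\<^sup>+ s. ennreal (g s) * indicator (dyadic (i + 0)) s + ennreal (g s) * indicator (dyadic (i + 1)) s + ennreal (g s) * indicator (dyadic (i + 2)) s \<partial>lborel)"
    proof (rule nn_integral_mono)
      fix s :: real
      have "s \<in> dyadic (i + 0) \<or> s \<in> dyadic (i + 1) \<or> s \<in> dyadic (i + 2)" if "s \<in> {2 ^ Suc i / 2..<3 * 2 ^ Suc (Suc i) / 2}"
        using that by (auto simp: dyadic_def)
      then show "ennreal (g s) * indicator {2 ^ Suc i / 2..<3 * 2 ^ Suc (Suc i) / 2} s \<le> ennreal (g s) * indicator (dyadic (i + 0)) s + ennreal (g s) * indicator (dyadic (i + 1)) s + ennreal (g s) * indicator (dyadic (i + 2)) s"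
        by (cases "s \<in> {2 ^ Suc i / 2..<3 * 2 ^ Suc (Suc i) / 2::real}") (auto simp: add_increasing add_increasing2)
    qed
    also have "\<dots> = D 0 i + D 1 i + D 2 i"
      unfolding D_def by (simp add: nn_integral_add)
    finally show ?thesis by (simp add: mult_left_mono)
  qed
  then have "(\<Sum>i. \<integral>\<^sup>+ t. window m g (r i) t * indicator (dyadic (Suc i)) t \<partial>lborel) \<le> (\<Sum>i. ennreal (window_mass m) * (D 0 i + D 1 i + D 2 i))"
    by (rule suminf_le) auto
  also have "\<dots> = ennreal (window_mass m) * ((\<Sum>i. D 0 i) + (\<Sum>i. D 1 i) + (\<Sum>i. D 2 i))"
    by (simp add: ennreal_suminf_cmult suminf_add[symmetric] summableI)
  also have "\<dots> \<le> ennreal (window_mass m) * ((\<integral>\<^sup>+ s. ennreal (g s) \<partial>lborel) + (\<integral>\<^sup>+ s. ennreal (g s) \<partial>lborel) + (\<integral>\<^sup>+ s. ennreal (g s) \<partial>lborel))"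
    by (intro mult_left_mono add_mono D) simp
  also have "\<dots> = ennreal (3 * window_mass m) * (\<integral>\<^sup>+ s. ennreal (g s) \<partial>lborel)"
  proof -
    have "x + x + x = 3 * x" for x :: ennreal
      by (metis distrib_right mult_1 numeral_Bit1 numeral_One)
    moreover have "ennreal (3 * window_mass m) = 3 * ennreal (window_mass m)"
      by (subst ennreal_mult') simp_all
    ultimately show ?thesis by (simp only: ac_simps)
  qed
  finally show ?thesis .
qed

text \<open>Optimising over \<open>l\<close>, namely \<open>l = Q powr (1 / P)\<close>, gives the power inequality. Together with \<open>le_scale_plus_power\<close>
  this replaces Jensen's inequality for the averages \<open>window\<close>.\<close>

lemma power_from_all_scales:
  fixes x b A C P :: real and Q :: ennreal
  assumes x: "0 \<le> x" and b: "0 \<le> b" and A: "0 \<le> A" "0 \<le> C" and P: "1 \<le> P"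
    and scales: "\<And>l. 0 < l \<Longrightarrow> ennreal x \<le> ennreal (A * (C * l) + b) + ennreal (A * l powr (1 - P)) * Q"
  shows "ennreal (x powr P) \<le> ennreal (2 powr P * ((A * (C + 1)) powr P + 1)) * (Q + ennreal (b powr P))"
proof (cases "Q = \<infinity>")
  case True
  have "ennreal c * top = top" if "0 < c" for c
    using that by (simp add: ennreal_mult_eq_top_iff)
  moreover have "0 < 2 powr P * ((A * (C + 1)) powr P + 1)" by (simp add: add_nonneg_pos)
  ultimately have "ennreal (2 powr P * ((A * (C + 1)) powr P + 1)) * top = top" by blast
  then show ?thesis using True by simp
next
  case False
  then obtain q where q: "Q = ennreal q" "0 \<le> q" by (cases Q) auto
  have le: "x \<le> A * (C * l) + b + A * l powr (1 - P) * q" if "0 < l" for l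
    using scales[OF that] that x b A q by (simp add: ennreal_mult'[symmetric] ennreal_plus[symmetric] del: ennreal_plus)
  define B where "B = A * (C + 1)"
  have B: "0 \<le> B" using A by (simp add: B_def)
  have xle: "x \<le> B * q powr (1 / P) + b"
  proof (cases "q = 0")
    case True
    have "x \<le> b"
    proof (rule field_le_epsilon)
      fix e :: real assume e: "0 < e"
      define l where "l = e / (A * C + 1)"
      have AC: "0 < A * C + 1" using A by (simp add: add_nonneg_pos)
      have "x \<le> A * C * l + b" using le[of l] e AC True by (simp add: l_def mult.assoc)
      also have "A * C * l \<le> (A * C + 1) * l" using e AC by (intro mult_right_mono) (auto simp: l_def)
      also have "(A * C + 1) * l = e" using AC by (simp add: l_def)
      finally show "x \<le> b + e" by simp
    qed
    then show ?thesis using True by simp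
  next
    case False
    then have q0: "0 < q" using q by simp
    have "(q powr (1 / P)) powr (1 - P) * q = q powr (1 / P)"
    proof -
      have "(q powr (1 / P)) powr (1 - P) * q = q powr ((1 / P) * (1 - P)) * q powr 1" using q0 by (simp add: powr_powr)
      also have "\<dots> = q powr ((1 / P) * (1 - P) + 1)" by (simp only: powr_add)
      also have "(1 / P) * (1 - P) + 1 = 1 / P" using P by (simp add: field_simps)
      finally show ?thesis .
    qed
    then have eq: "A * (q powr (1 / P)) powr (1 - P) * q = A * q powr (1 / P)" by (simp only: mult.assoc)
    have "0 < q powr (1 / P)" using q0 by simp
    from le[OF this] have "x \<le> A * (C * q powr (1 / P)) + b + A * q powr (1 / P)"
      by (simp only: eq)
    then show ?thesis by (simp add: B_def algebra_simps)
  qed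
  have "x powr P \<le> (2 * max (B * q powr (1 / P)) b) powr P"
    using xle x P by (intro powr_mono2) auto
  also have "\<dots> = 2 powr P * max (B * q powr (1 / P)) b powr P"
    by (rule powr_mult)
  also have "\<dots> \<le> 2 powr P * ((B * q powr (1 / P)) powr P + b powr P)"
    by (intro mult_left_mono) (auto simp: max_def)
  also have "(B * q powr (1 / P)) powr P = B powr P * q"
    using B q P by (simp add: powr_mult powr_powr)
  also have "2 powr P * (B powr P * q + b powr P) \<le> 2 powr P * ((B powr P + 1) * (q + b powr P))"
    using q by (intro mult_left_mono) (simp_all add: algebra_simps)
  finally have "x powr P \<le> 2 powr P * (B powr P + 1) * (q + b powr P)" by (simp add: mult.assoc)
  then have "ennreal (x powr P) \<le> ennreal (2 powr P * (B powr P + 1) * (q + b powr P))" by (rule ennreal_leI)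
  also have "\<dots> = ennreal (2 powr P * (B powr P + 1)) * (ennreal q + ennreal (b powr P))"
    using q by (simp add: ennreal_mult' ennreal_plus[symmetric] del: ennreal_plus)
  finally show ?thesis by (simp add: q(1) B_def)
qed

text \<open>This splits a function into a bounded part and a part dominated by a multiple of its \<open>P\<close>-th power.\<close>

lemma le_scale_plus_power:
  fixes x l P :: real
  assumes "0 \<le> x" "0 < l" "1 \<le> P"
  shows "x \<le> l + l powr (1 - P) * x powr P"
proof (cases "x \<le> l")
  case False
  then have x: "0 < x" "l \<le> x" using assms by auto
  have "x = x powr (1 - P) * x powr P" using x by (simp flip: powr_add)
  also have "\<dots> \<le> l powr (1 - P) * x powr P"
    using x assms by (intro mult_right_mono powr_mono2') auto
  finally show ?thesis using assms by linarith
qed (simp add: add_increasing2)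

lemma Lp_from_windows:
  fixes x G :: "real \<Rightarrow> real" and P :: real
  assumes Gm[measurable]: "G \<in> borel_measurable borel" and G0: "\<And>s. 0 \<le> G s"
    and P: "1 \<le> P" and GP: "(\<integral>\<^sup>+ s. ennreal (G s powr P) \<partial>lborel) < \<infinity>"
    and x0: "\<And>t. 0 \<le> x t" and AB: "0 \<le> A" "0 \<le> B"
    and blocks: "\<And>i. n \<le> i \<Longrightarrow> AE t in lebesgue. t \<in> dyadic (Suc i) \<longrightarrow> ennreal (x t) \<le> ennreal A * window m G (r i) t + ennreal (B / t ^ 2)"
  shows "(\<integral>\<^sup>+ t. ennreal (x t powr P) * indicator {2 ^ Suc n..} t \<partial>lebesgue) < \<infinity>"
proof -
  have [measurable]: "dyadic i \<in> sets borel" for i by (simp add: dyadic_def)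
  define g where "g s = G s powr P" for s
  have [measurable]: "g \<in> borel_measurable borel" unfolding g_def by measurable
  define C' where "C' = 2 powr P * ((A * (window_mass m + 1)) powr P + 1)"
  have C': "0 \<le> C'" by (simp add: C'_def)
  have wm[measurable]: "(\<lambda>t. window m g q t) \<in> borel_measurable borel" for q
    unfolding window_def indicator_def atLeastAtMost_iff by measurable
  \<comment> \<open>At every \<open>t\<close> at most one summand is nonzero.\<close>
  define S where "S t = (\<Sum>i. window m g (r i) t * indicator (dyadic (Suc i)) t)" for t
  have [measurable]: "S \<in> borel_measurable borel" unfolding S_def by measurable
  have pt: "ennreal (x t powr P) \<le> ennreal C' * (S t + ennreal (B powr P * 4) * ennreal (1 / (1 + \<bar>t\<bar>) ^ 2))"
    if t: "t \<in> dyadic (Suc i)" and le: "ennreal (x t) \<le> ennreal A * window m G (r i) t + ennreal (B / t ^ 2)" for t i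
  proof -
    have "(1::real) \<le> 2 ^ Suc i" by (rule one_le_power) simp
    then have t1: "1 \<le> t" using t unfolding dyadic_def by simp
    have "ennreal (x t powr P) \<le> ennreal C' * (window m g (r i) t + ennreal ((B / t ^ 2) powr P))"
      unfolding C'_def
    proof (rule power_from_all_scales[OF x0 _ AB(1) window_mass_nonneg P])
      show "0 \<le> B / t ^ 2" using AB by simp
      fix l :: real assume l: "0 < l"
      have "window m G (r i) t \<le> ennreal (window_mass m * l) + ennreal (l powr (1 - P)) * window m g (r i) t"
        using l by (intro window_mono_affine) (auto simp: g_def G0 intro!: le_scale_plus_power P)
      then have "ennreal A * window m G (r i) t \<le> ennreal A * (ennreal (window_mass m * l) + ennreal (l powr (1 - P)) * window m g (r i) t)"
        by (rule mult_left_mono) simp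
      also have "\<dots> = ennreal (A * (window_mass m * l)) + ennreal (A * l powr (1 - P)) * window m g (r i) t"
        using AB by (simp add: distrib_left ennreal_mult' mult.assoc)
      finally have "ennreal A * window m G (r i) t + ennreal (B / t ^ 2) \<le> ennreal (A * (window_mass m * l)) + ennreal (A * l powr (1 - P)) * window m g (r i) t + ennreal (B / t ^ 2)"
        by (rule add_right_mono)
      also have "\<dots> = ennreal (A * (window_mass m * l) + B / t ^ 2) + ennreal (A * l powr (1 - P)) * window m g (r i) t"
        using AB l window_mass_nonneg[of m] by (simp add: ennreal_plus ac_simps)
      finally show "ennreal (x t) \<le> ennreal (A * (window_mass m * l) + B / t ^ 2) + ennreal (A * l powr (1 - P)) * window m g (r i) t"
        using le by (rule order_trans[rotated])
    qed
    also have "window m g (r i) t \<le> S t"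
    proof -
      have "window m g (r i) t = (\<Sum>j\<in>{i}. window m g (r j) t * indicator (dyadic (Suc j)) t)" using t by simp
      also have "\<dots> \<le> S t" unfolding S_def by (rule sum_le_suminf) (auto intro: summableI)
      finally show ?thesis .
    qed
    also have "ennreal ((B / t ^ 2) powr P) \<le> ennreal (B powr P * 4) * ennreal (1 / (1 + \<bar>t\<bar>) ^ 2)"
    proof -
      have "(B / t ^ 2) powr P = B powr P * (1 / t ^ 2) powr P"
        using AB by (subst powr_mult[symmetric]) auto
      also have "(1 / t ^ 2) powr P \<le> (1 / t ^ 2) powr 1"
        using t1 P by (intro powr_mono') auto
      also have "(1 / t ^ 2) powr 1 = 1 / t ^ 2" using t1 by simp
      also have "1 / t ^ 2 \<le> 4 * (1 / (1 + \<bar>t\<bar>) ^ 2)"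
      proof -
        have "(1 + \<bar>t\<bar>) ^ 2 \<le> (2 * t) ^ 2" using t1 by (intro power_mono) auto
        then show ?thesis using t1 by (simp add: divide_simps power2_eq_square)
      qed
      finally have "(B / t ^ 2) powr P \<le> B powr P * 4 * (1 / (1 + \<bar>t\<bar>) ^ 2)" by (simp add: mult_left_mono)
      then show ?thesis by (subst ennreal_mult'[symmetric]) (auto intro: ennreal_leI)
    qed
    finally show ?thesis by (simp add: mult_left_mono add_mono)
  qed
  have "AE t in lebesgue. \<forall>i\<ge>n. t \<in> dyadic (Suc i) \<longrightarrow> ennreal (x t) \<le> ennreal A * window m G (r i) t + ennreal (B / t ^ 2)"
    using blocks by (simp add: AE_all_countable)
  then have "AE t in lebesgue. ennreal (x t powr P) * indicator {2 ^ Suc n..} t \<le> ennreal C' * (S t + ennreal (B powr P * 4) * ennreal (1 / (1 + \<bar>t\<bar>) ^ 2))"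
  proof eventually_elim
    case (elim t)
    show ?case
    proof (cases "2 ^ Suc n \<le> t")
      case True
      then obtain j where j: "Suc n \<le> j" "t \<in> dyadic j" by (rule dyadic_cover)
      then obtain i where i: "j = Suc i" "n \<le> i" by (cases j) auto
      have "ennreal (x t powr P) \<le> ennreal C' * (S t + ennreal (B powr P * 4) * ennreal (1 / (1 + \<bar>t\<bar>) ^ 2))"
        using elim i j by (intro pt) auto
      then show ?thesis using True by simp
    qed simp
  qed
  then have "(\<integral>\<^sup>+ t. ennreal (x t powr P) * indicator {2 ^ Suc n..} t \<partial>lebesgue)
      \<le> (\<integral>\<^sup>+ t. ennreal C' * (S t + ennreal (B powr P * 4) * ennreal (1 / (1 + \<bar>t\<bar>) ^ 2)) \<partial>lebesgue)"
    by (rule nn_integral_mono_AE)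
  also have "\<dots> = (\<integral>\<^sup>+ t. ennreal C' * (S t + ennreal (B powr P * 4) * ennreal (1 / (1 + \<bar>t\<bar>) ^ 2)) \<partial>lborel)"
    by (rule nn_integral_completion) measurable
  also have "\<dots> = ennreal C' * ((\<integral>\<^sup>+ t. S t \<partial>lborel) + ennreal (B powr P * 4) * ennreal inverse_square_mass)"
    by (simp add: nn_integral_cmult nn_integral_add nn_integral_inverse_square)
  also have "(\<integral>\<^sup>+ t. S t \<partial>lborel) = (\<Sum>i. \<integral>\<^sup>+ t. window m g (r i) t * indicator (dyadic (Suc i)) t \<partial>lborel)"
    unfolding S_def by (rule nn_integral_suminf) measurable
  also have "\<dots> \<le> ennreal (3 * window_mass m) * (\<integral>\<^sup>+ s. ennreal (g s) \<partial>lborel)"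
    by (rule window_sum_le) measurable
  also have "ennreal C' * (ennreal (3 * window_mass m) * (\<integral>\<^sup>+ s. ennreal (g s) \<partial>lborel) + ennreal (B powr P * 4) * ennreal inverse_square_mass) < \<infinity>"
    using GP by (simp add: g_def ennreal_mult_less_top)
  finally show ?thesis by (simp add: mult_left_mono add_mono)
qed

section \<open>The choice of the frequency scale\<close>

text \<open>From \<open>fact N \<le> N ^ N\<close>; used with \<open>N\<close> close to the largest admissible value.\<close>

lemma fact_times_power_le:
  assumes "0 \<le> a" "real N * a \<le> exp (- 1)"
  shows "fact N * a ^ N \<le> exp (- real N)"
proof -
  have "fact N \<le> real N ^ N" by (metis fact_le_power of_nat_power)
  then have "fact N * a ^ N \<le> real N ^ N * a ^ N" using assms by (intro mult_right_mono) auto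
  also have "\<dots> = (real N * a) ^ N" by (simp add: power_mult_distrib)
  also have "\<dots> \<le> exp (- 1) ^ N" using assms by (intro power_mono) auto
  also have "\<dots> = exp (- real N)" by (simp flip: exp_of_nat_mult)
  finally show ?thesis .
qed

text \<open>Take \<open>N\<close> to be the integer part of \<open>y = \<tau> / (\<mu> * exp (m + 1))\<close>, essentially the minimiser of the bound in \<open>low_frequency\<close>.
  The constant \<open>c\<close> is such that \<open>y = (m + 6) * ln B\<close>, so the minimum is about \<open>B ^ (- (m + 6))\<close>. The prefactors
  cost \<open>m + 2\<close> powers of \<open>B \<ge> R\<close>, and the remaining \<open>B ^ (- 4)\<close> is at most a multiple of \<open>t ^ (- 2)\<close> because \<open>c * t\<close> is
  at most \<open>\<mu> * ln B \<le> B ^ 2\<close>.\<close>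

lemma low_frequency_choice:
  fixes c R \<mu> B S t \<tau> :: real and m :: nat
  defines "A \<equiv> real m + 6"
  assumes c: "c = 1 / (2 * exp (real m + 1) * A)" and m: "1 \<le> m" and R: "2 \<le> R" "R \<le> B" and \<mu>: "2 \<le> \<mu>" "\<mu> \<le> B" and S: "0 \<le> S"
    and \<tau>: "\<mu> * ln B = 2 * c * \<tau>" and t: "\<tau> \<le> t" "t \<le> 2 * \<tau>"
  obtains N where "1 \<le> N"
    "(R / 2) ^ m * (real m * 2 ^ m * (2 * R * S * B * (fact N * (\<mu> * exp (real m) / t) ^ N))) \<le> 2 * exp 1 * real m * S / c ^ 2 / t ^ 2"
proof -
  have A: "7 \<le> A" using m by (simp add: A_def)
  have c0: "0 < c" using A by (simp add: c)
  have B2: "2 \<le> B" using R by simp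
  have "ln 2 \<le> ln B" using B2 by simp
  then have lnB: "1 / 2 \<le> ln B" using ln2_ge_two_thirds by linarith
  have \<tau>0: "0 < \<tau>"
  proof -
    have "0 < 2 * c * \<tau>" unfolding \<tau>[symmetric] using \<mu> lnB by simp
    then show ?thesis using c0 by (simp add: zero_less_mult_iff)
  qed
  define y where "y = \<tau> / (\<mu> * exp (real m + 1))"
  have y: "y = A * ln B"
  proof -
    have "\<tau> = \<mu> * ln B / (2 * c)" using \<tau> c0 by (simp add: field_simps)
    also have "\<dots> = \<mu> * ln B * exp (real m + 1) * A" using A by (simp add: c)
    finally show ?thesis using \<mu> by (simp add: y_def)
  qed
  have y2: "2 \<le> y"
  proof -
    have "7 * (1 / 2) \<le> A * ln B" using A lnB by (intro mult_mono) auto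
    then show ?thesis by (simp add: y)
  qed
  define N where "N = nat \<lfloor>y\<rfloor>"
  have N: "real N \<le> y" "y - 1 \<le> real N" "1 \<le> N"
    using y2 unfolding N_def by linarith+
  have N1: "fact N * (\<mu> * exp (real m) / t) ^ N \<le> exp (- real N)"
  proof (rule fact_times_power_le)
    have "real N * (\<mu> * exp (real m) / t) \<le> y * (\<mu> * exp (real m) / \<tau>)"
      using N(1) \<mu> t \<tau>0 y2 by (intro mult_mono divide_left_mono) auto
    also have "\<dots> = exp (- 1)" using \<mu> \<tau>0 by (simp add: y_def exp_add exp_minus field_simps)
    finally show "real N * (\<mu> * exp (real m) / t) \<le> exp (- 1)" .
  qed (use \<mu> t \<tau>0 in simp)
  also have "exp (- real N) \<le> exp (1 - y)" using N(2) by simp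
  also have "exp (1 - y) = exp 1 / B ^ (m + 6)"
  proof -
    have "exp y = B ^ (m + 6)"
      using B2 unfolding y A_def by (metis exp_ln exp_of_nat_mult less_le_trans of_nat_add of_nat_numeral zero_less_numeral)
    then show ?thesis by (simp add: exp_diff)
  qed
  finally have N2: "fact N * (\<mu> * exp (real m) / t) ^ N \<le> exp 1 / B ^ (m + 6)" .
  have "(R / 2) ^ m * (real m * 2 ^ m * (2 * R * S * B * (fact N * (\<mu> * exp (real m) / t) ^ N)))
      = (2 * real m * S) * (R ^ m * R * B * (fact N * (\<mu> * exp (real m) / t) ^ N))"
    by (simp add: power_divide)
  also have "\<dots> \<le> (2 * real m * S) * (B ^ m * B * B * (exp 1 / B ^ (m + 6)))"
    using R B2 S N2 \<mu> t \<tau>0 by (intro mult_left_mono mult_mono power_mono) auto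
  also have "B ^ m * B * B * (exp 1 / B ^ (m + 6)) = exp 1 / B ^ 4"
    using B2 by (simp add: power_add eval_nat_numeral)
  also have "(2 * real m * S) * (exp 1 / B ^ 4) \<le> (2 * real m * S) * (exp 1 * (1 / c ^ 2 / t ^ 2))"
  proof -
    have "c * t \<le> 2 * c * \<tau>" using t c0 by simp
    also have "\<dots> = \<mu> * ln B" by (rule \<tau>[symmetric])
    also have "\<dots> \<le> B * B" using \<mu> B2 lnB ln_le_minus_one[of B] by (intro mult_mono) auto
    finally have "(c * t) ^ 2 \<le> (B * B) ^ 2" using c0 t \<tau>0 by (intro power_mono) auto
    then have "c ^ 2 * t ^ 2 \<le> B ^ 4" by (simp add: power_mult_distrib flip: power_add)
    moreover have "0 < c ^ 2 * t ^ 2" using c0 t \<tau>0 by simp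
    ultimately have "1 / B ^ 4 \<le> 1 / (c ^ 2 * t ^ 2)" by (intro frac_le) auto
    then have "exp 1 * (1 / B ^ 4) \<le> exp 1 * (1 / c ^ 2 / t ^ 2)" by (intro mult_left_mono) auto
    then show ?thesis using S by (intro mult_left_mono) auto
  qed
  finally have "(R / 2) ^ m * (real m * 2 ^ m * (2 * R * S * B * (fact N * (\<mu> * exp (real m) / t) ^ N))) \<le> 2 * exp 1 * real m * S / c ^ 2 / t ^ 2"
    by (simp add: mult_ac)
  with N(3) that show ?thesis by blast
qed

section \<open>The vector-valued setting\<close>

text \<open>The norm is compared with that of one approximating simple function at distance less than one.\<close>

lemma bochner_integrable_finite_norm:
  fixes f :: "'a \<Rightarrow> 'b::real_normed_vector"
  assumes "bochner_integrable M f"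
  shows "(\<integral>\<^sup>+ x. ennreal (norm (f x)) \<partial>M) < \<infinity>"
proof -
  obtain s where f: "f \<in> borel_measurable M"
    and s: "\<And>i. Bochner_Integration.simple_bochner_integrable M (s i)"
    and conv: "(\<lambda>i. \<integral>\<^sup>+ y. ennreal (norm (f y - s i y)) \<partial>M) \<longlonglongrightarrow> 0"
    using assms unfolding bochner_integrable_def has_bochner_int_def by blast
  have "eventually (\<lambda>i. (\<integral>\<^sup>+ y. ennreal (norm (f y - s i y)) \<partial>M) < 1) sequentially"
    by (rule order_tendstoD(2)[OF conv]) simp
  then obtain i where i: "(\<integral>\<^sup>+ y. ennreal (norm (f y - s i y)) \<partial>M) < 1"
    by (auto simp: eventually_sequentially)
  have sf: "simple_function M (s i)"
    using s[of i] by (rule Bochner_Integration.simple_bochner_integrable.cases)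
  have ns: "(\<lambda>x. norm (s i x)) \<in> borel_measurable M"
    by (rule borel_measurable_simple_function[OF simple_function_compose1[OF sf]])
  have si: "Bochner_Integration.simple_bochner_integrable M (\<lambda>x. norm (s i x))"
    using simple_bochner_integrable_compose2[of "\<lambda>x y. norm x" M "s i" "s i"] s[of i] by simp
  have "(\<integral>\<^sup>+ x. ennreal (norm (f x)) \<partial>M) \<le> (\<integral>\<^sup>+ x. ennreal (norm (f x - s i x)) + ennreal (norm (s i x)) \<partial>M)"
  proof (rule nn_integral_mono)
    fix x
    have "norm (f x) \<le> norm (f x - s i x) + norm (s i x)"
      using norm_triangle_ineq[of "f x - s i x" "s i x"] by simp
    then show "ennreal (norm (f x)) \<le> ennreal (norm (f x - s i x)) + ennreal (norm (s i x))"
      by (simp flip: ennreal_plus)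
  qed
  also have "\<dots> = (\<integral>\<^sup>+ x. ennreal (norm (f x - s i x)) \<partial>M) + (\<integral>\<^sup>+ x. ennreal (norm (s i x)) \<partial>M)"
    by (intro nn_integral_add measurable_compose[OF _ measurable_ennreal] norm_diff_simple_measurable f sf ns)
  also have "(\<integral>\<^sup>+ x. ennreal (norm (s i x)) \<partial>M) = ennreal (Bochner_Integration.simple_bochner_integral M (\<lambda>x. norm (s i x)))"
    by (rule simple_bochner_integral_eq_nn_integral[OF si, symmetric]) simp
  also have "(\<integral>\<^sup>+ x. ennreal (norm (f x - s i x)) \<partial>M) + ennreal (Bochner_Integration.simple_bochner_integral M (\<lambda>x. norm (s i x))) < \<infinity>"
    using order.strict_trans[OF i, of top] by simp
  finally show ?thesis .
qed

lemma bochner_integrable_scaleC: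
  fixes f :: "'a \<Rightarrow> 'x::complex_banach"
  assumes "c \<in> borel_measurable M" "f \<in> borel_measurable M" "strongly_measurable M f"
    and "(\<integral>\<^sup>+ x. ennreal (norm (c x) * norm (f x)) \<partial>M) < \<infinity>"
  shows "bochner_integrable M (\<lambda>x. c x *\<^sub>C f x)"
  by (rule bochner_integrableI) (use scaleC_measurable[OF assms(1-3)] assms(4) in \<open>simp_all add: norm_scaleC\<close>)

lemma loc_integrable_regular:
  fixes f :: "real \<Rightarrow> 'b::real_normed_vector"
  assumes f: "loc_integrable U f" and U: "U = (\<Union>n::nat. C n)" and C: "\<And>n. compact (C n)"
  shows "f \<in> borel_measurable (lebesgue_on U)" "strongly_measurable (lebesgue_on U) f"
proof -
  show fm: "f \<in> borel_measurable (lebesgue_on U)"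
    by (rule loc_integrable_essentially_separable(1)[OF f U C])
  obtain D where "countable D" "0 \<in> D" "AE x in lebesgue_on U. f x \<in> closure D"
    using loc_integrable_essentially_separable(2)[OF f U C] by blast
  then show "strongly_measurable (lebesgue_on U) f"
    by (intro strongly_measurableI_separable[OF fm, of D]) auto
qed

lemma test_product_integrable:
  fixes f :: "real \<Rightarrow> 'x::complex_banach"
  assumes f: "loc_integrable U f" and U: "U = (\<Union>n::nat. C n)" and C: "\<And>n. compact (C n)"
    and \<phi>: "smooth_in a b \<phi>" and ab: "{a..b} \<subseteq> U"
  shows "bochner_integrable (lebesgue_on U) (\<lambda>t. \<phi> t *\<^sub>C f t)"
proof (rule bochner_integrable_scaleC)
  have "C n \<in> sets lebesgue" for n
    by (intro sets_completionI_sets) (simp add: borel_closed compact_imp_closed C)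
  then have Um: "U \<in> sets lebesgue" unfolding U by auto
  have "\<phi> \<in> borel_measurable lebesgue"
    using integrable_smooth_in[OF \<phi>] by (rule borel_measurable_integrable)
  then show "\<phi> \<in> borel_measurable (lebesgue_on U)" by (rule measurable_restrict_space1)
  show "f \<in> borel_measurable (lebesgue_on U)" "strongly_measurable (lebesgue_on U) f"
    by (rule loc_integrable_regular[OF f U C])+
  obtain B where B: "\<And>t. norm (\<phi> t) \<le> B" using smooth_in_bounded[OF \<phi>] by blast
  then have B0: "0 \<le> B" using norm_ge_zero order_trans by blast
  have "bochner_integrable (lebesgue_on {a..b}) f" using f ab by (simp add: loc_integrable_def)
  from bochner_integrable_finite_norm[OF this]
  have fin: "(\<integral>\<^sup>+ t. ennreal (norm (f t)) * indicator {a..b} t \<partial>lebesgue) < \<infinity>"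
    by (simp add: nn_integral_restrict_space)
  have nf: "(\<lambda>t. ennreal (norm (f t)) * indicator {a..b} t) \<in> borel_measurable lebesgue"
  proof -
    have "(\<lambda>t. norm (f t)) \<in> borel_measurable (lebesgue_on {a..b})"
      by (rule measurable_compose[OF _ borel_measurable_continuous_onI[OF continuous_on_norm[OF continuous_on_id]]])
         (use \<open>bochner_integrable (lebesgue_on {a..b}) f\<close> in \<open>simp add: bochner_integrable_def has_bochner_int_def\<close>)
    then show ?thesis
      by (subst borel_measurable_restrict_space_iff_ennreal[symmetric]) auto
  qed
  have "(\<integral>\<^sup>+ t. ennreal (norm (\<phi> t) * norm (f t)) \<partial>lebesgue_on U) \<le> (\<integral>\<^sup>+ t. ennreal B * (ennreal (norm (f t)) * indicator {a..b} t) \<partial>lebesgue)"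
    unfolding nn_integral_restrict_space[of U lebesgue, simplified, OF Um]
  proof (rule nn_integral_mono)
    fix t
    show "ennreal (norm (\<phi> t) * norm (f t)) * indicator U t \<le> ennreal B * (ennreal (norm (f t)) * indicator {a..b} t)"
    proof (cases "t \<in> {a..b}")
      case True
      have "ennreal (norm (\<phi> t) * norm (f t)) \<le> ennreal (B * norm (f t))"
        by (intro ennreal_leI mult_right_mono B) simp
      then show ?thesis using True ab B0 by (auto simp: ennreal_mult' indicator_def)
    qed (simp add: smooth_in_outside[OF \<phi>])
  qed
  also have "\<dots> = ennreal B * (\<integral>\<^sup>+ t. ennreal (norm (f t)) * indicator {a..b} t \<partial>lebesgue)"
    by (rule nn_integral_cmult[OF nf])
  also have "\<dots> < \<infinity>" using fin by (simp add: ennreal_mult_less_top)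
  finally show "(\<integral>\<^sup>+ t. ennreal (norm (\<phi> t) * norm (f t)) \<partial>lebesgue_on U) < \<infinity>" .
qed

lemma halfline_union: "{0..} = (\<Union>n::nat. {0..real n})"
  using real_arch_simple by auto

lemma open_halfline_union: "{0<..} = (\<Union>n::nat. {1 / real (Suc n)..real n})"
proof -
  have "\<exists>n::nat. 1 / real (Suc n) \<le> t \<and> t \<le> real n" if t: "0 < t" for t
  proof -
    obtain k where k: "1 / real (Suc k) < t" using nat_approx_posE[OF t] by blast
    obtain l where l: "t \<le> real l" using real_arch_simple by blast
    have "1 / real (Suc (max k l)) \<le> 1 / real (Suc k)" by (intro divide_left_mono) auto
    with k l show ?thesis by (intro exI[of _ "max k l"]) auto
  qed
  moreover have "0 < t" if "t \<in> {1 / real (Suc n)..real n}" for t n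
    by (rule less_le_trans[of _ "1 / real (Suc n)"]) (use that in auto)
  ultimately show ?thesis
    by (intro set_eqI iffI) (simp_all only: UN_iff greaterThan_iff atLeastAtMost_iff, blast+)
qed

lemma line_union: "UNIV = (\<Union>n::nat. {- real n..real n})"
proof -
  have "\<exists>n::nat. \<bar>t\<bar> \<le> real n" for t using real_arch_simple by blast
  then show ?thesis by (auto simp: abs_le_iff) (metis minus_le_iff)
qed

text \<open>\<open>G\<close> is a Borel majorant of the norm of the weak derivative \<open>g\<close> that is locally integrable with a uniform
  bound \<open>CG\<close> on windows of length \<open>m + 1\<close>, which is what membership of \<open>g\<close> in \<open>L\<^sup>p\<close> provides.\<close>

locale vector_valued =
  fixes m :: nat and f g :: "real \<Rightarrow> 'x::complex_banach" and G :: "real \<Rightarrow> real" and CG :: real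
  assumes m: "1 \<le> m" and f: "loc_integrable {0..} f" and weak: "weak_derivative {0<..} m f g"
    and G_borel: "G \<in> borel_measurable borel" and G_nonneg: "\<And>t. 0 \<le> G t"
    and g_le: "AE t in lebesgue. 0 < t \<longrightarrow> norm (g t) \<le> G t"
    and G_loc: "\<And>b. set_integrable lebesgue {-b..b} G"
    and CG: "0 \<le> CG" "\<And>t. 0 < t \<Longrightarrow> (LINT s:{t..t + real m + 1}|lebesgue. G s) \<le> CG"
begin

definition h :: "('x \<Rightarrow> complex) \<Rightarrow> real \<Rightarrow> complex" where
  "h \<Phi> t = \<Phi> (zero_ext f t)"

text \<open>On the half-line the truncation changes \<open>\<Phi> \<circ> g\<close> on a null set only, and it makes the bound by \<open>G\<close> hold everywhere.\<close>

definition \<gamma> :: "('x \<Rightarrow> complex) \<Rightarrow> real \<Rightarrow> complex" where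
  "\<gamma> \<Phi> t = (if 0 < t \<and> norm (\<Phi> (g t)) \<le> G t then \<Phi> (g t) else 0)"

definition Ch :: real where
  "Ch = enn2real (\<integral>\<^sup>+ s. ennreal (norm (f s)) * indicator {0..2 * real m + 1} s \<partial>lebesgue)"

definition Cg :: real where
  "Cg = 2 ^ m * (CG + real m * 2 ^ m * Ch)"

lemma Ch_nonneg: "0 \<le> Ch" by (simp add: Ch_def)

lemma Cg_nonneg: "0 \<le> Cg" using CG Ch_nonneg by (simp add: Cg_def)

lemma f_measurable: "f \<in> borel_measurable (lebesgue_on {0..})"
  by (rule loc_integrable_regular(1)[OF f halfline_union]) simp

lemma zero_ext_f_measurable: "zero_ext f \<in> borel_measurable lebesgue"
proof -
  have "(\<lambda>t. if 0 \<le> t then f t else 0) \<in> borel_measurable lebesgue"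
  proof (subst measurable_If_restrict_space_iff)
    have "{t \<in> space lebesgue. 0 \<le> t} = {0::real..}" by auto
    then show "{t \<in> space lebesgue. 0 \<le> (t::real)} \<in> sets lebesgue" by simp
    have "{t. 0 \<le> t} = {0::real..}" by auto
    then show "f \<in> borel_measurable (restrict_space lebesgue {t. 0 \<le> t}) \<and> (\<lambda>t. 0) \<in> borel_measurable (restrict_space lebesgue {t. \<not> 0 \<le> t})"
      using f_measurable by simp
  qed
  then show ?thesis by (simp add: zero_ext_def[abs_def])
qed

lemma f_separable: "\<exists>D. countable D \<and> 0 \<in> D \<and> (AE t in lebesgue. zero_ext f t \<in> closure D)"
proof -
  obtain D where D: "countable D" "0 \<in> D" "AE x in lebesgue_on {0..}. f x \<in> closure D"
    using loc_integrable_essentially_separable(2)[OF f halfline_union] by auto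
  from D(3) have "AE t in lebesgue. t \<in> {0..} \<longrightarrow> f t \<in> closure D"
    by (subst (asm) AE_restrict_space_iff) auto
  then have "AE t in lebesgue. zero_ext f t \<in> closure D"
    by eventually_elim (use D(2) closure_subset in \<open>auto simp: zero_ext_def\<close>)
  with D show ?thesis by blast
qed

lemma zero_ext_f_strongly_measurable: "strongly_measurable lebesgue (zero_ext f)"
  using f_separable strongly_measurableI_separable[OF zero_ext_f_measurable] by blast

text \<open>Only countably many functionals are needed for an essentially separably valued function, so the
  exceptional sets can be united.\<close>

lemma norm_bound_from_functionals:
  assumes "\<And>\<Phi>. functional \<Phi> \<Longrightarrow> AE t in lebesgue. ennreal (norm (h \<Phi> t)) \<le> B t"
  shows "AE t in lebesgue. ennreal (norm (zero_ext f t)) \<le> B t"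
proof -
  obtain D where D: "countable D" "AE t in lebesgue. zero_ext f t \<in> closure D" using f_separable by blast
  obtain \<F> where F: "countable \<F>" "\<And>\<Phi>. \<Phi> \<in> \<F> \<Longrightarrow> functional \<Phi>"
    "\<And>x B. x \<in> closure D \<Longrightarrow> (\<And>\<Phi>. \<Phi> \<in> \<F> \<Longrightarrow> ennreal (norm (\<Phi> x)) \<le> B) \<Longrightarrow> ennreal (norm x) \<le> B"
    using countable_norming_family[OF D(1)] by metis
  have "AE t in lebesgue. \<forall>\<Phi>\<in>\<F>. ennreal (norm (h \<Phi> t)) \<le> B t"
    using assms F(1,2) by (subst AE_ball_countable) auto
  with D(2) show ?thesis
    by eventually_elim (rule F(3), auto simp: h_def)
qed

lemma finite_Ch: "(\<integral>\<^sup>+ s. ennreal (norm (f s)) * indicator {0..2 * real m + 1} s \<partial>lebesgue) = ennreal Ch"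
proof -
  have "bochner_integrable (lebesgue_on {0..2 * real m + 1}) f" using f by (simp add: loc_integrable_def)
  from bochner_integrable_finite_norm[OF this] show ?thesis
    by (simp add: Ch_def nn_integral_restrict_space ennreal_enn2real)
qed

text \<open>Functionals commute with the Bochner integral, so the weak derivative of \<open>f\<close> can be tested through \<open>\<Phi>\<close>.\<close>

lemma h_weakly_differentiable:
  assumes \<Phi>: "functional \<Phi>"
  shows "weakly_differentiable m (h \<Phi>) (\<gamma> \<Phi>) G"
proof
  interpret \<Phi>: bounded_linear \<Phi> by (rule functional_bounded_linear[OF \<Phi>])
  have \<Phi>m: "\<Phi> \<in> borel_measurable borel"
    by (rule borel_measurable_continuous_onI[OF \<Phi>.continuous_on[OF continuous_on_id]])
  have g: "loc_integrable {0<..} g" and f': "loc_integrable {0<..} f" using weak by (simp_all add: weak_derivative_def)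
  have gm: "g \<in> borel_measurable (lebesgue_on {0<..})"
    by (rule loc_integrable_regular(1)[OF g open_halfline_union]) simp
  show "1 \<le> m" by (rule m)
  show "h \<Phi> \<in> borel_measurable lebesgue"
    unfolding h_def[abs_def] by (rule measurable_compose[OF zero_ext_f_measurable \<Phi>m])
  show "set_integrable lebesgue {- b..b} (h \<Phi>)" for b
  proof -
    have "bochner_integrable (lebesgue_on {0..b}) f" using f by (simp add: loc_integrable_def)
    from bochner_int_functional(1)[OF \<Phi> this]
    have "set_integrable lebesgue {0..b} (\<lambda>t. \<Phi> (f t))"
      by (simp add: integrable_restrict_space set_integrable_def)
    moreover have "indicator {- b..b} t *\<^sub>R h \<Phi> t = indicator {0..b} t *\<^sub>R \<Phi> (f t)" for t
      by (auto simp: h_def zero_ext_def indicator_def \<Phi>.zero)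
    ultimately show ?thesis by (simp add: set_integrable_def)
  qed
  show "\<gamma> \<Phi> \<in> borel_measurable lebesgue"
  proof -
    have 1: "(\<lambda>t. \<Phi> (g t)) \<in> borel_measurable (lebesgue_on {0<..})" by (rule measurable_compose[OF gm \<Phi>m])
    have 2: "G \<in> borel_measurable (lebesgue_on {0<..})"
      by (intro measurable_restrict_space1 measurable_completion) (use G_borel in simp)
    have "(\<lambda>t. if norm (\<Phi> (g t)) \<le> G t then \<Phi> (g t) else 0) \<in> borel_measurable (lebesgue_on {0<..})"
      using 1 2 by measurable
    then have "(\<lambda>t. if t \<in> {0<..} then (if norm (\<Phi> (g t)) \<le> G t then \<Phi> (g t) else 0) else 0) \<in> borel_measurable lebesgue"
      by (rule borel_measurable_if_I) simp
    moreover have "(\<lambda>t. if t \<in> {0<..} then (if norm (\<Phi> (g t)) \<le> G t then \<Phi> (g t) else 0) else 0) = \<gamma> \<Phi>"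
      by (auto simp: \<gamma>_def)
    ultimately show ?thesis by simp
  qed
  show "norm (\<gamma> \<Phi> t) \<le> G t" for t by (simp add: \<gamma>_def G_nonneg)
  show "G \<in> borel_measurable lebesgue" by (rule measurable_completion) (use G_borel in simp)
  show "set_integrable lebesgue {- b..b} G" for b by (rule G_loc)
  show "(LINT t|lebesgue. nderiv m \<phi> t * h \<Phi> t) = (-1) ^ m * (LINT t|lebesgue. \<phi> t * \<gamma> \<Phi> t)"
    if a: "0 < a" and \<phi>: "smooth_in a b \<phi>" for a b \<phi>
  proof -
    have ab: "{a..b} \<subseteq> {0<..}" using a by auto
    have eq: "bochner_int (lebesgue_on {0<..}) (\<lambda>t. nderiv m \<phi> t *\<^sub>C f t) =
        (-1) ^ m *\<^sub>R bochner_int (lebesgue_on {0<..}) (\<lambda>t. \<phi> t *\<^sub>C g t)"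
      using weak smooth_in_test_function[OF \<phi> ab] by (simp add: weak_derivative_def)
    have fi: "bochner_integrable (lebesgue_on {0<..}) (\<lambda>t. nderiv m \<phi> t *\<^sub>C f t)"
      by (rule test_product_integrable[OF f' open_halfline_union _ smooth_in_nderiv[OF \<phi>] ab]) simp
    have gi: "bochner_integrable (lebesgue_on {0<..}) (\<lambda>t. \<phi> t *\<^sub>C g t)"
      by (rule test_product_integrable[OF g open_halfline_union _ \<phi> ab]) simp
    have 1: "\<Phi> (bochner_int (lebesgue_on {0<..}) (\<lambda>t. nderiv m \<phi> t *\<^sub>C f t)) = (LINT t|lebesgue. nderiv m \<phi> t * h \<Phi> t)"
    proof -
      have "\<Phi> (bochner_int (lebesgue_on {0<..}) (\<lambda>t. nderiv m \<phi> t *\<^sub>C f t)) = (LINT t|lebesgue. indicator {0<..} t *\<^sub>R (nderiv m \<phi> t * \<Phi> (f t)))"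
        unfolding bochner_int_functional(2)[OF \<Phi> fi] functional_scaleC[OF \<Phi>] by (subst integral_restrict_space) simp_all
      also have "\<dots> = (LINT t|lebesgue. nderiv m \<phi> t * h \<Phi> t)"
      proof (intro Bochner_Integration.integral_cong refl)
        fix t
        show "indicator {0<..} t *\<^sub>R (nderiv m \<phi> t * \<Phi> (f t)) = nderiv m \<phi> t * h \<Phi> t"
          using smooth_in_outside[OF smooth_in_nderiv[OF \<phi>, of m], of t] a
          by (cases "0 < t") (auto simp: h_def zero_ext_def)
      qed
      finally show ?thesis .
    qed
    have 2: "\<Phi> (bochner_int (lebesgue_on {0<..}) (\<lambda>t. \<phi> t *\<^sub>C g t)) = (LINT t|lebesgue. \<phi> t * \<gamma> \<Phi> t)"
    proof -
      have "\<Phi> (bochner_int (lebesgue_on {0<..}) (\<lambda>t. \<phi> t *\<^sub>C g t)) = (LINT t|lebesgue. indicator {0<..} t *\<^sub>R (\<phi> t * \<Phi> (g t)))"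
        unfolding bochner_int_functional(2)[OF \<Phi> gi] functional_scaleC[OF \<Phi>] by (subst integral_restrict_space) simp_all
      also have "\<dots> = (LINT t|lebesgue. \<phi> t * \<gamma> \<Phi> t)"
      proof (rule integral_cong_AE)
        have \<phi>m: "\<phi> \<in> borel_measurable lebesgue"
          using integrable_smooth_in[OF \<phi>] by (rule borel_measurable_integrable)
        show "(\<lambda>t. \<phi> t * \<gamma> \<Phi> t) \<in> borel_measurable lebesgue"
          using \<phi>m \<open>\<gamma> \<Phi> \<in> borel_measurable lebesgue\<close> by (rule borel_measurable_times)
        have "integrable (lebesgue_on {0<..}) (\<lambda>t. \<phi> t * \<Phi> (g t))"
          using bochner_int_functional(1)[OF \<Phi> gi] by (simp add: functional_scaleC[OF \<Phi>])
        then have "integrable lebesgue (\<lambda>t. indicator {0<..} t *\<^sub>R (\<phi> t * \<Phi> (g t)))"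
          by (subst (asm) integrable_restrict_space) simp_all
        then show "(\<lambda>t. indicator {0<..} t *\<^sub>R (\<phi> t * \<Phi> (g t))) \<in> borel_measurable lebesgue"
          by (rule borel_measurable_integrable)
        show "AE t in lebesgue. indicator {0<..} t *\<^sub>R (\<phi> t * \<Phi> (g t)) = \<phi> t * \<gamma> \<Phi> t"
          using g_le
        proof eventually_elim
          case (elim t)
          show ?case
          proof (cases "0 < t")
            case True
            then have "norm (\<Phi> (g t)) \<le> G t" using elim functional_norm[OF \<Phi>, of "g t"] by simp
            then show ?thesis using True by (simp add: \<gamma>_def)
          qed (simp add: \<gamma>_def)
        qed
      qed
      finally show ?thesis .
    qed
    have "\<Phi> ((-1) ^ m *\<^sub>R x) = (-1) ^ m * \<Phi> x" for x
      by (simp add: \<Phi>.scaleR scaleR_conv_of_real)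
    then show ?thesis using arg_cong[OF eq, of \<Phi>] by (simp add: 1 2)
  qed
qed

lemma h_growth:
  assumes \<Phi>: "functional \<Phi>"
  shows "AE s in lebesgue. norm (h \<Phi> s) \<le> Cg * (1 + \<bar>s\<bar>) ^ m"
proof -
  interpret w: weakly_differentiable m "h \<Phi>" "\<gamma> \<Phi>" G by (rule h_weakly_differentiable[OF \<Phi>])
  have "(\<integral>\<^sup>+ s. ennreal (norm (h \<Phi> s)) * indicator {0..2 * real m + 1} s \<partial>lebesgue) \<le> (\<integral>\<^sup>+ s. ennreal (norm (f s)) * indicator {0..2 * real m + 1} s \<partial>lebesgue)"
    by (intro nn_integral_mono) (auto simp: indicator_def h_def zero_ext_def intro!: ennreal_leI functional_norm[OF \<Phi>])
  then have "(\<integral>\<^sup>+ s. ennreal (norm (h \<Phi> s)) * indicator {0..2 * real m + 1} s \<partial>lebesgue) \<le> ennreal Ch"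
    by (simp add: finite_Ch)
  from w.polynomial_growth[OF CG Ch_nonneg this]
  have "AE t in lebesgue. 0 < t \<longrightarrow> norm (h \<Phi> t) \<le> Cg * (1 + t) ^ m" by (simp add: Cg_def)
  moreover have "AE t in lebesgue. t \<notin> {0::real}" by (intro AE_not_in) simp
  ultimately show ?thesis
  proof eventually_elim
    case (elim t)
    show ?case
    proof (cases "0 < t")
      case False
      then have "h \<Phi> t = 0"
        using elim linear_0[OF bounded_linear.linear[OF functional_bounded_linear[OF \<Phi>]]] by (simp add: h_def zero_ext_def)
      then show ?thesis using Cg_nonneg by simp
    qed (use elim in simp)
  qed
qed

lemma f_growth: "AE s in lebesgue. norm (zero_ext f s) \<le> Cg * (1 + \<bar>s\<bar>) ^ m"
proof -
  have "AE s in lebesgue. ennreal (norm (zero_ext f s)) \<le> ennreal (Cg * (1 + \<bar>s\<bar>) ^ m)"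
    by (rule norm_bound_from_functionals, rule eventually_mono[OF h_growth]) (auto intro: ennreal_leI)
  then show ?thesis
    by eventually_elim (use Cg_nonneg in simp)
qed

text \<open>The transform of a test function decays faster than any power while \<open>f\<close> grows polynomially. Without this
  integrability the distributional pairing would take the default value \<open>0\<close> of the integral.\<close>

lemma fourier_product_integrable:
  assumes \<phi>: "smooth_in a b \<phi>"
  shows "bochner_integrable lebesgue (\<lambda>t. fourier \<phi> t *\<^sub>C zero_ext f t)"
proof (rule bochner_integrable_scaleC)
  show "fourier \<phi> \<in> borel_measurable lebesgue"
    by (rule measurable_completion) (use borel_measurable_continuous_onI[OF continuous_fourier[OF \<phi>]] in simp)
  show "zero_ext f \<in> borel_measurable lebesgue" by (rule zero_ext_f_measurable)
  show "strongly_measurable lebesgue (zero_ext f)" by (rule zero_ext_f_strongly_measurable)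
  have \<phi>': "smooth_in (min a b) (max a b) \<phi>" using \<phi> by (rule smooth_in_mono) auto
  have "min a b \<le> max a b" by simp
  from fourier_decay[OF \<phi>' this, of "m + 2"]
  obtain C where C: "\<And>t. norm (fourier \<phi> t) \<le> C / (1 + \<bar>t\<bar>) ^ (m + 2)" by blast
  have C0: "0 \<le> C" using order_trans[OF norm_ge_zero C[of 0]] by simp
  have "(\<integral>\<^sup>+ t. ennreal (norm (fourier \<phi> t) * norm (zero_ext f t)) \<partial>lebesgue) \<le> (\<integral>\<^sup>+ t. ennreal (C * Cg) * ennreal (1 / (1 + \<bar>t\<bar>) ^ 2) \<partial>lebesgue)"
  proof (rule nn_integral_mono_AE)
    show "AE t in lebesgue. ennreal (norm (fourier \<phi> t) * norm (zero_ext f t)) \<le> ennreal (C * Cg) * ennreal (1 / (1 + \<bar>t\<bar>) ^ 2)"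
      using f_growth
    proof eventually_elim
      case (elim t)
      define w where "w = 1 + \<bar>t\<bar>"
      have w: "1 \<le> w" by (simp add: w_def)
      have "norm (fourier \<phi> t) * norm (zero_ext f t) \<le> (C / w ^ (m + 2)) * (Cg * w ^ m)"
        using elim C[of t] C0 w by (intro mult_mono) (auto simp: w_def)
      also have "\<dots> = C * Cg * (1 / w ^ 2)" using w by (simp add: power_add power2_eq_square)
      finally show ?case
        using C0 Cg_nonneg by (subst ennreal_mult'[symmetric]) (auto intro!: ennreal_leI simp: w_def)
    qed
  qed
  also have "\<dots> = (\<integral>\<^sup>+ t. ennreal (C * Cg) * ennreal (1 / (1 + \<bar>t\<bar>) ^ 2) \<partial>lborel)"
    by (rule nn_integral_completion) measurable
  also have "\<dots> = ennreal (C * Cg) * ennreal inverse_square_mass"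
    by (simp add: nn_integral_cmult nn_integral_inverse_square)
  also have "\<dots> < \<infinity>" by (simp add: ennreal_mult_less_top)
  finally show "(\<integral>\<^sup>+ t. ennreal (norm (fourier \<phi> t) * norm (zero_ext f t)) \<partial>lebesgue) < \<infinity>" .
qed

text \<open>The scalar form of the hypothesis on the Fourier transform.\<close>

lemma transform:
  assumes F: "is_fourier_transform f F" and \<Phi>: "functional \<Phi>" and \<phi>: "smooth_in a b \<phi>"
  shows "(LINT s|lebesgue. fourier \<phi> s * h \<Phi> s) = (LINT s|lebesgue. \<phi> s * \<Phi> (F s))"
proof -
  have "test_function UNIV \<phi>" by (rule smooth_in_test_function[OF \<phi>]) simp
  then have eq: "bochner_int lebesgue (\<lambda>t. fourier \<phi> t *\<^sub>C zero_ext f t) = bochner_int lebesgue (\<lambda>t. \<phi> t *\<^sub>C F t)"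
    and Floc: "loc_integrable UNIV F"
    using F by (simp_all add: is_fourier_transform_def represented_by_def fourier_distr_def regular_distr_def)
  have "bochner_integrable (lebesgue_on UNIV) (\<lambda>t. \<phi> t *\<^sub>C F t)"
    by (rule test_product_integrable[OF Floc line_union _ \<phi>]) simp_all
  then have Fi: "bochner_integrable lebesgue (\<lambda>t. \<phi> t *\<^sub>C F t)" by (simp add: lebesgue_on_UNIV_eq)
  show ?thesis
    using arg_cong[OF eq, of \<Phi>]
    unfolding bochner_int_functional(2)[OF \<Phi> fourier_product_integrable[OF \<phi>]] bochner_int_functional(2)[OF \<Phi> Fi]
    by (simp add: functional_scaleC[OF \<Phi>] h_def)
qed

end

section \<open>The weight\<close>

locale rates =
  fixes M K :: "real \<Rightarrow> real"
  assumes M2: "\<And>s. 0 \<le> s \<Longrightarrow> 2 \<le> M s" and M_cont: "continuous_on {0..} M" and M_mono: "mono_on {0..} M"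
    and K2: "\<And>s. 0 \<le> s \<Longrightarrow> 2 \<le> K s" and K_cont: "continuous_on {0..} K" and K_mono: "mono_on {0..} K"
    and KM: "\<And>s. 1 < s \<Longrightarrow> max s (M s) \<le> K s"
begin

abbreviation N :: "real \<Rightarrow> real" where "N \<equiv> M_log M K"

lemma N_mono: "0 \<le> s \<Longrightarrow> s \<le> t \<Longrightarrow> N s \<le> N t"
proof -
  assume st: "0 \<le> s" "s \<le> t"
  have "ln (K s) \<le> ln (K t)" using K2[of s] mono_onD[OF K_mono, of s t] st by simp
  moreover have "0 \<le> ln (K s)" using K2[of s] st by simp
  moreover have "M s \<le> M t" using mono_onD[OF M_mono, of s t] st by simp
  ultimately show "N s \<le> N t"
    unfolding M_log_def using M2[of s] st by (intro mult_mono) auto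
qed

lemma N_cont: "continuous_on {0..} N"
proof -
  have "\<forall>s\<in>{0..}. K s \<noteq> 0"
  proof
    fix s :: real assume "s \<in> {0..}"
    then show "K s \<noteq> 0" using K2[of s] by simp
  qed
  then show ?thesis unfolding M_log_def[abs_def] by (intro continuous_on_mult continuous_on_ln M_cont K_cont)
qed

lemma N_ge: "1 < s \<Longrightarrow> 2 * ln s \<le> N s"
proof -
  assume s: "1 < s"
  have "ln s \<le> ln (K s)" using KM[OF s] s by simp
  then show "2 * ln s \<le> N s" unfolding M_log_def using M2[of s] s by (intro mult_mono) auto
qed

lemma N_pos: "0 \<le> s \<Longrightarrow> 0 < N s"
  unfolding M_log_def using M2[of s] K2[of s] by simp

text \<open>The set of solutions of \<open>N s = T\<close> is nonempty by the intermediate value theorem, closed, and bounded because \<open>K s \<ge> s\<close> makes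
  \<open>N\<close> tend to infinity; so its supremum is a solution.\<close>

lemma right_inverse_N:
  assumes T: "N 1 \<le> T"
  shows "N (right_inverse N T) = T" "1 \<le> right_inverse N T"
proof -
  define S where "S = {s. 0 \<le> s \<and> N s = T}"
  have T0: "0 < T" using N_pos[of 1] T by simp
  have "\<exists>s\<ge>1. s \<le> exp T \<and> N s = T"
  proof (rule IVT')
    show "N 1 \<le> T" by (rule T)
    show "T \<le> N (exp T)" using N_ge[of "exp T"] T0 by simp
    show "1 \<le> exp T" using T0 by simp
    show "continuous_on {1..exp T} N" by (rule continuous_on_subset[OF N_cont]) auto
  qed
  then obtain s where s: "1 \<le> s" "s \<in> S" by (auto simp: S_def)
  have bdd: "bdd_above S"
  proof (rule bdd_aboveI)
    fix x assume x: "x \<in> S"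
    show "x \<le> exp T"
    proof (cases "1 < x")
      case True
      then have "2 * ln x \<le> T" using N_ge x by (auto simp: S_def)
      then have "ln x \<le> T" using T0 by simp
      then have "exp (ln x) \<le> exp T" by simp
      then show ?thesis using True by simp
    next
      case False
      moreover have "1 \<le> exp T" using T0 by simp
      ultimately show ?thesis by linarith
    qed
  qed
  have "closed S"
  proof -
    have "S = {0..} \<inter> N -` {T}" by (auto simp: S_def)
    then show ?thesis using continuous_closed_preimage[OF N_cont, of "{T}"] by simp
  qed
  then have "Sup S \<in> S" using s bdd by (intro closed_contains_Sup) auto
  then show "N (right_inverse N T) = T" by (simp add: right_inverse_def S_def)
  have "s \<le> Sup S" by (rule cSup_upper[OF s(2) bdd])
  then show "1 \<le> right_inverse N T" using s by (simp add: right_inverse_def S_def)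
qed

lemma weight_ge_1: "1 \<le> weight N T"
  using right_inverse_N(2) by (simp add: weight_def)

lemma weight_mono: "T \<le> T' \<Longrightarrow> weight N T \<le> weight N T'"
proof -
  assume TT: "T \<le> T'"
  show "weight N T \<le> weight N T'"
  proof (cases "N 1 \<le> T \<and> T \<noteq> T'")
    case True
    then have 1: "N 1 \<le> T" "N 1 \<le> T'" "T < T'" using TT by auto
    have "\<not> right_inverse N T' \<le> right_inverse N T"
      using N_mono[of "right_inverse N T'" "right_inverse N T"] right_inverse_N[OF 1(1)] right_inverse_N[OF 1(2)] 1(3) by auto
    then show ?thesis using 1 by (simp add: weight_def)
  next
    case False
    then show ?thesis using weight_ge_1[of T'] by (cases "T = T'") (auto simp: weight_def)
  qed
qed

lemma weight_large:
  assumes "N 2 < T"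
  shows "N (weight N T) = T" "2 < weight N T"
proof -
  have 1: "N 1 \<le> T" using N_mono[of 1 2] assms by simp
  then show w: "N (weight N T) = T" using right_inverse_N by (simp add: weight_def)
  show "2 < weight N T"
    using N_mono[of "weight N T" 2] weight_ge_1[of T] w assms by (cases "weight N T \<le> 2") auto
qed

end

section \<open>The estimate on a dyadic block\<close>

context vector_valued
begin

text \<open>On one dyadic block the scale \<open>R\<close> is fixed by \<open>M R * ln (K R) = 2 * c * \<tau>\<close>. The number \<open>N\<close> of integrations by parts
  depends on this scale too, and \<open>pointwise_estimate\<close> is applied with \<open>r = R / 2\<close> since the cutoffs are supported in \<open>[-2, 2]\<close>.\<close>

lemma block_estimate:
  assumes rates: "rates M K" and F: "is_fourier_transform f F" "smooth F"
    and bound: "\<And>j s. norm (nderiv j F s) \<le> fact j * K \<bar>s\<bar> * M \<bar>s\<bar> ^ j"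
    and Ck: "\<And>N t. kernel N t \<le> Ck / (1 + \<bar>t\<bar>) ^ (2 * m + 4)"
    and c0: "0 < c0" "\<And>N. 1 \<le> N \<Longrightarrow> c0 \<le> integral\<^sup>L lborel (kernel N)"
    and S: "0 \<le> S" "\<And>N k s. 1 \<le> N \<Longrightarrow> k \<le> N \<Longrightarrow> norm (nderiv k (cutoff N) s) \<le> (2 * real N) ^ k * S"
    and c: "c = 1 / (2 * exp (real m + 1) * (real m + 6))" and \<tau>: "1 \<le> \<tau>" and R: "2 \<le> R" "M_log M K R = 2 * c * \<tau>"
  shows "AE t in lebesgue. t \<in> {\<tau>..<2 * \<tau>} \<longrightarrow> ennreal (R ^ m * norm (f t)) \<le>
    ennreal (2 ^ m / c0 * Ck) * window m G (R / 2) t +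
    ennreal (2 ^ m / c0 * (far_const m Cg Ck * inverse_square_mass + 2 * exp 1 * real m * S / c ^ 2) / t ^ 2)"
proof -
  interpret rates M K by (rule rates)
  have Ck0: "0 \<le> Ck" using order_trans[OF kernel_nonneg Ck[of 0 0]] by simp
  have far0: "0 \<le> far_const m Cg Ck" using Ck0 Cg_nonneg by (simp add: far_const_def)
  define E where "E = 2 * exp 1 * real m * S / c ^ 2"
  have E0: "0 \<le> E" using S by (simp add: E_def)
  define Y where "Y t = ennreal (2 ^ m / c0 * Ck) * window m G (R / 2) t +
    ennreal (2 ^ m / c0 * (far_const m Cg Ck * inverse_square_mass + E) / t ^ 2)" for t
  define B where "B = K R"
  define \<mu> where "\<mu> = M R"
  have B: "R \<le> B" "\<mu> \<le> B" using KM[of R] R by (auto simp: B_def \<mu>_def)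
  have \<mu>: "2 \<le> \<mu>" using M2[of R] R by (simp add: \<mu>_def)
  have R1: "1 \<le> R / 2" using R by simp
  have Rm: "0 < R ^ m" using R by simp
  have est: "AE t in lebesgue. t \<in> {\<tau>..<2 * \<tau>} \<longrightarrow> ennreal (R ^ m * norm (h \<Phi> t)) \<le> Y t" if \<Phi>: "functional \<Phi>" for \<Phi>
  proof -
    interpret w: weakly_differentiable m "h \<Phi>" "\<gamma> \<Phi>" G by (rule h_weakly_differentiable[OF \<Phi>])
    define H where "H s = \<Phi> (F s)" for s
    note H_lin = smooth_bounded_linear[OF F(2) functional_bounded_linear[OF \<Phi>], folded H_def]
    have H: "smooth H" by (rule H_lin[THEN conjunct1])
    have H_bound: "norm (nderiv j H s) \<le> fact j * B * \<mu> ^ j" if s: "\<bar>s\<bar> \<le> R" for j s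
    proof -
      have "nderiv j H s = \<Phi> (nderiv j F s)" using H_lin by simp
      then have "norm (nderiv j H s) \<le> norm (nderiv j F s)" using functional_norm[OF \<Phi>] by simp
      also have "\<dots> \<le> fact j * K \<bar>s\<bar> * M \<bar>s\<bar> ^ j" by (rule bound)
      also have "\<dots> \<le> fact j * B * \<mu> ^ j"
        using s M2[of "\<bar>s\<bar>"] K2[of "\<bar>s\<bar>"] B R mono_onD[OF K_mono, of "\<bar>s\<bar>" R] mono_onD[OF M_mono, of "\<bar>s\<bar>" R]
        unfolding B_def \<mu>_def by (intro mult_mono power_mono mult_left_mono) auto
      finally show ?thesis .
    qed
    have "AE t in lebesgue. 1 \<le> t \<longrightarrow> (\<forall>r N L. 1 \<le> r \<longrightarrow> 1 \<le> N \<longrightarrow>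
      (\<forall>k\<in>{1..m}. norm (LINT v|lebesgue. of_real (kernel N v) * h \<Phi> (t + real k * (v / r))) \<le> L) \<longrightarrow>
      ennreal (c0 * (r ^ m * norm (h \<Phi> t))) \<le> ennreal Ck * window m G r t +
        ennreal (far_const m Cg Ck * inverse_square_mass / t ^ 2) + ennreal (r ^ m * (real m * 2 ^ m * L)))"
      by (rule w.pointwise_estimate[OF G_borel h_growth[OF \<Phi>] Cg_nonneg Ck c0(2)])
    then show ?thesis
    proof eventually_elim
      case (elim t)
      show ?case
      proof
        assume t: "t \<in> {\<tau>..<2 * \<tau>}"
        then have t1: "1 \<le> t" using \<tau> by simp
        have "\<mu> * ln B = 2 * c * \<tau>" using R(2) by (simp add: M_log_def \<mu>_def B_def)
        from low_frequency_choice[OF c m R(1) B(1) \<mu> B(2) S(1) this, of t] t obtain N where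
          N: "1 \<le> N" "(R / 2) ^ m * (real m * 2 ^ m * (2 * R * S * B * (fact N * (\<mu> * exp (real m) / t) ^ N))) \<le> E / t ^ 2"
          unfolding E_def by auto
        define L where "L = 2 * R * S * B * (fact N * (\<mu> * exp (real m) / t) ^ N)"
        have B0: "0 \<le> B" using B R by simp
        have L: "norm (LINT v|lebesgue. of_real (kernel N v) * h \<Phi> (t + real k * (v / (R / 2)))) \<le> L" if k: "k \<in> {1..m}" for k
        proof -
          \<comment> \<open>The shift \<open>k * v / (R / 2)\<close> equals \<open>v / q\<close>, and \<open>2 * q \<le> R\<close> keeps the stretched cutoff inside the frequency range.\<close>
          define q where "q = R / 2 / real k"
          have k1: "1 \<le> real k" using k by simp
          have q: "0 < q" "q \<le> R / 2" using k1 R by (auto simp: q_def field_simps)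
          have qm: "1 / q \<le> real m"
          proof -
            have "1 / q = real k / (R / 2)" by (simp add: q_def)
            also have "\<dots> \<le> real k / 1" using R1 by (intro divide_left_mono) auto
            finally show ?thesis using k by simp
          qed
          have "norm (LINT v|lebesgue. of_real (kernel N v) * h \<Phi> (t + v / q)) \<le> 4 * q * S * B * fact N * (\<mu> * exp (real m) / t) ^ N"
            by (rule low_frequency[OF H H_bound B0 \<mu> _ S(2)[OF N(1)] q(1) _ qm _ N(1)])
               (use transform[OF F(1) \<Phi>] q t1 in \<open>auto simp: H_def\<close>)
          also have "\<dots> = 4 * q * (S * B * (fact N * (\<mu> * exp (real m) / t) ^ N))" by simp
          also have "\<dots> \<le> 4 * (R / 2) * (S * B * (fact N * (\<mu> * exp (real m) / t) ^ N))"
            using q S(1) B0 \<mu> t1 by (intro mult_right_mono) auto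
          also have "\<dots> = L" by (simp add: L_def)
          also have "(\<lambda>v. h \<Phi> (t + v / q)) = (\<lambda>v. h \<Phi> (t + real k * (v / (R / 2))))"
          proof
            fix v
            have "v / q = real k * (v / (R / 2))" using k1 R by (simp add: q_def)
            then show "h \<Phi> (t + v / q) = h \<Phi> (t + real k * (v / (R / 2)))" by (rule arg_cong)
          qed
          finally show ?thesis .
        qed
        have "ennreal (c0 * ((R / 2) ^ m * norm (h \<Phi> t))) \<le> ennreal Ck * window m G (R / 2) t +
          ennreal (far_const m Cg Ck * inverse_square_mass / t ^ 2) + ennreal ((R / 2) ^ m * (real m * 2 ^ m * L))"
          using elim[rule_format, of "R / 2" N L] t1 R1 N(1) L by simp
        also have "\<dots> \<le> ennreal Ck * window m G (R / 2) t +
          ennreal (far_const m Cg Ck * inverse_square_mass / t ^ 2) + ennreal (E / t ^ 2)"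
          using N(2) by (intro add_left_mono ennreal_leI) (simp add: L_def)
        also have "\<dots> = ennreal Ck * window m G (R / 2) t + ennreal ((far_const m Cg Ck * inverse_square_mass + E) / t ^ 2)"
          using far0 E0 inverse_square_mass_nonneg by (simp add: add.assoc ennreal_plus[symmetric] add_divide_distrib del: ennreal_plus)
        finally have "ennreal (2 ^ m / c0) * ennreal (c0 * ((R / 2) ^ m * norm (h \<Phi> t))) \<le>
            ennreal (2 ^ m / c0) * (ennreal Ck * window m G (R / 2) t + ennreal ((far_const m Cg Ck * inverse_square_mass + E) / t ^ 2))"
          by (rule mult_left_mono) simp
        also have "\<dots> = Y t"
          using c0(1) by (simp add: Y_def distrib_left mult.assoc[symmetric] ennreal_mult'[symmetric])
        also have "ennreal (2 ^ m / c0) * ennreal (c0 * ((R / 2) ^ m * norm (h \<Phi> t))) = ennreal (R ^ m * norm (h \<Phi> t))"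
          using c0(1) by (simp add: ennreal_mult'[symmetric] power_divide)
        finally show "ennreal (R ^ m * norm (h \<Phi> t)) \<le> Y t" .
      qed
    qed
  qed
  have "AE t in lebesgue. ennreal (norm (zero_ext f t)) \<le> (if t \<in> {\<tau>..<2 * \<tau>} then ennreal (1 / R ^ m) * Y t else top)"
  proof (rule norm_bound_from_functionals)
    fix \<Phi> :: "'x \<Rightarrow> complex" assume "functional \<Phi>"
    from est[OF this] show "AE t in lebesgue. ennreal (norm (h \<Phi> t)) \<le> (if t \<in> {\<tau>..<2 * \<tau>} then ennreal (1 / R ^ m) * Y t else top)"
    proof eventually_elim
      case (elim t)
      have "ennreal (norm (h \<Phi> t)) = ennreal (1 / R ^ m) * ennreal (R ^ m * norm (h \<Phi> t))"
        using Rm R by (simp add: ennreal_mult'[symmetric])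
      then show ?case using elim by (simp add: mult_left_mono)
    qed
  qed
  then have "AE t in lebesgue. t \<in> {\<tau>..<2 * \<tau>} \<longrightarrow> ennreal (R ^ m * norm (f t)) \<le> Y t"
  proof eventually_elim
    case (elim t)
    show ?case
    proof
      assume t: "t \<in> {\<tau>..<2 * \<tau>}"
      have "ennreal (R ^ m * norm (f t)) = ennreal (R ^ m) * ennreal (norm (f t))"
        using Rm by (simp add: ennreal_mult')
      also have "\<dots> \<le> ennreal (R ^ m) * (ennreal (1 / R ^ m) * Y t)"
        using elim t \<tau> by (intro mult_left_mono) (auto simp: zero_ext_def)
      also have "\<dots> = Y t"
        using Rm R by (simp add: mult.assoc[symmetric] ennreal_mult'[symmetric])
      finally show "ennreal (R ^ m * norm (f t)) \<le> Y t" .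
    qed
  qed
  then show ?thesis by (simp add: Y_def E_def)
qed

text \<open>On \<open>dyadic (Suc i)\<close> the weight at \<open>c * t\<close> is at most its value \<open>R i\<close> at \<open>2 * c * 2 ^ Suc i\<close>, the end of the block.
  Blocks on which this scale would be below \<open>2\<close> are finitely many and are covered by the polynomial growth of \<open>f\<close>.\<close>

lemma weighted_window_bound:
  assumes rates: "rates M K" and F: "is_fourier_transform f F" "smooth F"
    and bound: "\<And>j s. norm (nderiv j F s) \<le> fact j * K \<bar>s\<bar> * M \<bar>s\<bar> ^ j"
  obtains c A B n r D where "0 < (c::real)" "0 \<le> (A::real)" "0 \<le> (B::real)"
    "\<forall>i\<ge>n. AE t in lebesgue. t \<in> dyadic (Suc i) \<longrightarrow>
      ennreal (norm (weight (M_log M K) (c * t) ^ m *\<^sub>R f t)) \<le> ennreal A * window m G (r i) t + ennreal (B / t ^ 2)"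
    "AE t in lebesgue. t \<in> {0..2 ^ Suc n} \<longrightarrow> norm (weight (M_log M K) (c * t) ^ m *\<^sub>R f t) \<le> D"
proof -
  interpret rates M K by (rule rates)
  obtain Ck where Ck: "\<And>N t. kernel N t \<le> Ck / (1 + \<bar>t\<bar>) ^ (2 * m + 4)" using kernel_decay[of "2 * m + 4"] by blast
  obtain c0 where c0: "0 < c0" "\<And>N. 1 \<le> N \<Longrightarrow> c0 \<le> integral\<^sup>L lborel (kernel N)" using kernel_mass by blast
  obtain S where S: "0 \<le> S" "\<And>N k s. 1 \<le> N \<Longrightarrow> k \<le> N \<Longrightarrow> norm (nderiv k (cutoff N) s) \<le> (2 * real N) ^ k * S"
    using norm_nderiv_cutoff by blast
  have Ck0: "0 \<le> Ck" using order_trans[OF kernel_nonneg Ck[of 0 0]] by simp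
  have far0: "0 \<le> far_const m Cg Ck" using Ck0 Cg_nonneg by (simp add: far_const_def)
  define c where "c = 1 / (2 * exp (real m + 1) * (real m + 6))"
  have c: "0 < c" by (simp add: c_def add_nonneg_pos)
  define A where "A = 2 ^ m / c0 * Ck"
  define B where "B = 2 ^ m / c0 * (far_const m Cg Ck * inverse_square_mass + 2 * exp 1 * real m * S / c ^ 2)"
  obtain n where n: "N 2 / c < 2 ^ n" using real_arch_pow[of 2 "N 2 / c"] by auto
  define R where "R i = weight N (2 * c * 2 ^ Suc i)" for i :: nat
  define D where "D = weight N (c * 2 ^ Suc n) ^ m * (Cg * (1 + 2 ^ Suc n) ^ m)"
  show ?thesis
  proof (rule that[of c A B n "\<lambda>i. R i / 2" D])
    show "0 < c" by (rule c)
    show "0 \<le> A" using c0 Ck0 by (simp add: A_def)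
    show "0 \<le> B" using c0 far0 S inverse_square_mass_nonneg by (simp add: B_def)
    show "\<forall>i\<ge>n. AE t in lebesgue. t \<in> dyadic (Suc i) \<longrightarrow>
      ennreal (norm (weight N (c * t) ^ m *\<^sub>R f t)) \<le> ennreal A * window m G (R i / 2) t + ennreal (B / t ^ 2)"
    proof (intro allI impI)
      fix i assume i: "n \<le> i"
      have "N 2 < c * 2 ^ n" using n c by (simp add: field_simps)
      also have "\<dots> \<le> 2 * c * 2 ^ Suc i"
      proof -
        have "(2::real) ^ n \<le> 2 ^ Suc (Suc i)" using i by (intro power_increasing) auto
        then show ?thesis using c by simp
      qed
      finally have T: "N 2 < 2 * c * 2 ^ Suc i" .
      have R: "2 \<le> R i" "N (R i) = 2 * c * 2 ^ Suc i"
        using weight_large[OF T] by (simp_all add: R_def)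
      have "(1::real) \<le> 2 ^ Suc i" by (rule one_le_power) simp
      from block_estimate[OF rates F bound Ck c0 S c_def this R]
      have "AE t in lebesgue. t \<in> {2 ^ Suc i..<2 * 2 ^ Suc i} \<longrightarrow> ennreal (R i ^ m * norm (f t)) \<le> ennreal A * window m G (R i / 2) t + ennreal (B / t ^ 2)"
        unfolding A_def B_def .
      then show "AE t in lebesgue. t \<in> dyadic (Suc i) \<longrightarrow>
        ennreal (norm (weight N (c * t) ^ m *\<^sub>R f t)) \<le> ennreal A * window m G (R i / 2) t + ennreal (B / t ^ 2)"
      proof eventually_elim
        case (elim t)
        show ?case
        proof
          assume t: "t \<in> dyadic (Suc i)"
          then have t': "t \<in> {2 ^ Suc i..<2 * 2 ^ Suc i}" by (simp add: dyadic_def)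
          have "c * t \<le> c * (2 * 2 ^ Suc i)" using t' c by (intro mult_left_mono) auto
          then have "weight N (c * t) \<le> R i" unfolding R_def by (intro weight_mono) (simp add: mult_ac)
          then have "weight N (c * t) ^ m \<le> R i ^ m" using weight_ge_1[of "c * t"] by (intro power_mono) auto
          then have "norm (weight N (c * t) ^ m *\<^sub>R f t) \<le> R i ^ m * norm (f t)"
            using weight_ge_1[of "c * t"] by (simp add: mult_right_mono)
          then have "ennreal (norm (weight N (c * t) ^ m *\<^sub>R f t)) \<le> ennreal (R i ^ m * norm (f t))" by (rule ennreal_leI)
          also have "\<dots> \<le> ennreal A * window m G (R i / 2) t + ennreal (B / t ^ 2)" using elim t' by simp
          finally show "ennreal (norm (weight N (c * t) ^ m *\<^sub>R f t)) \<le> ennreal A * window m G (R i / 2) t + ennreal (B / t ^ 2)" .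
        qed
      qed
    qed
    show "AE t in lebesgue. t \<in> {0..2 ^ Suc n} \<longrightarrow> norm (weight N (c * t) ^ m *\<^sub>R f t) \<le> D"
      using f_growth
    proof eventually_elim
      case (elim t)
      show ?case
      proof
        assume t: "t \<in> {0..2 ^ Suc n}"
        then have "norm (f t) \<le> Cg * (1 + t) ^ m" using elim by (simp add: zero_ext_def)
        also have "\<dots> \<le> Cg * (1 + 2 ^ Suc n) ^ m" using t Cg_nonneg by (intro mult_left_mono power_mono) auto
        finally have fb: "norm (f t) \<le> Cg * (1 + 2 ^ Suc n) ^ m" .
        have "c * t \<le> c * 2 ^ Suc n" using t c by (intro mult_left_mono) auto
        then have "weight N (c * t) ^ m \<le> weight N (c * 2 ^ Suc n) ^ m"
          using weight_ge_1[of "c * t"] by (intro power_mono weight_mono) auto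
        then have "weight N (c * t) ^ m * norm (f t) \<le> D"
          unfolding D_def using fb weight_ge_1[of "c * 2 ^ Suc n"] by (intro mult_mono) auto
        then show "norm (weight N (c * t) ^ m *\<^sub>R f t) \<le> D" using weight_ge_1[of "c * t"] by simp
      qed
    qed
  qed
qed

lemma weighted_measurable:
  assumes "rates M K"
  shows "(\<lambda>t. norm (weight (M_log M K) (c * t) ^ m *\<^sub>R f t)) \<in> borel_measurable (lebesgue_on {0..})"
proof -
  interpret rates M K by fact
  have [measurable]: "weight N \<in> borel_measurable borel"
    by (rule borel_measurable_mono) (auto intro: monoI weight_mono)
  have "(\<lambda>t. weight N (c * t) ^ m) \<in> borel_measurable borel" by measurable
  then have 1: "(\<lambda>t. weight N (c * t) ^ m) \<in> borel_measurable (lebesgue_on {0..})"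
    by (intro measurable_restrict_space1 measurable_completion) simp
  have 2: "(\<lambda>t. norm (f t)) \<in> borel_measurable (lebesgue_on {0..})"
    by (rule measurable_compose[OF f_measurable borel_measurable_continuous_onI[OF continuous_on_norm[OF continuous_on_id]]])
  have "(\<lambda>t. \<bar>weight N (c * t) ^ m\<bar> * norm (f t)) \<in> borel_measurable (lebesgue_on {0..})"
    using 1 2 by measurable
  then show ?thesis by simp
qed

end

section \<open>Integrability of the weighted function\<close>

lemma strongly_measurable_real:
  fixes u :: "'a \<Rightarrow> real"
  assumes "u \<in> borel_measurable A"
  shows "strongly_measurable A u"
proof -
  obtain s where s: "(\<forall>i. simple_function A (s i)) \<and> (\<forall>x\<in>space A. (\<lambda>i. s i x) \<longlonglongrightarrow> u x) \<and>
      (\<forall>i. \<forall>x\<in>space A. dist (s i x) 0 \<le> 2 * dist (u x) 0)"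
    using borel_measurable_implies_sequence_metric[OF assms, of 0] by (rule exE)
  then have "AE x in A. (\<lambda>i. s i x) \<longlonglongrightarrow> u x" by (intro AE_I2) simp
  with s show ?thesis unfolding strongly_measurable_def by (intro exI[of _ s]) simp
qed

text \<open>A Borel function that represents the norm of \<open>g\<close>; it vanishes almost everywhere on the negative half-line, so its
  integral over the line is that over the half-line.\<close>

lemma Lp_majorant:
  fixes g :: "real \<Rightarrow> 'x::complex_banach"
  assumes gm: "(\<lambda>t. norm (g t)) \<in> borel_measurable (lebesgue_on {0<..})"
    and P: "1 \<le> P" and gP: "(\<integral>\<^sup>+ t. ennreal (norm (g t) powr P) \<partial>lebesgue_on {0..}) < \<infinity>"
  obtains G where "G \<in> borel_measurable borel" "\<And>t. 0 \<le> G t"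
    "AE t in lebesgue. 0 < t \<longrightarrow> norm (g t) \<le> G t" "(\<integral>\<^sup>+ s. ennreal (G s powr P) \<partial>lborel) < \<infinity>"
proof -
  have "(\<lambda>t. if t \<in> {0<..} then norm (g t) else 0) \<in> borel_measurable lebesgue"
    by (rule borel_measurable_if_I[OF gm]) simp
  from completion_ex_borel_measurable_real[OF this] obtain u where
    u: "u \<in> borel_measurable borel" "AE t in lborel. (if t \<in> {0<..} then norm (g t) else 0) = u t" by auto
  define G where "G t = \<bar>u t\<bar>" for t
  have Gm[measurable]: "G \<in> borel_measurable borel" unfolding G_def using u(1) by measurable
  have AE: "AE t in lebesgue. (if t \<in> {0<..} then norm (g t) else 0) = G t"
    using AE_completion[OF u(2)]
  proof eventually_elim
    case (elim t)
    have "0 \<le> u t" unfolding elim[symmetric] by simp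
    with elim show ?case by (simp add: G_def)
  qed
  show ?thesis
  proof (rule that[OF Gm])
    show "0 \<le> G t" for t by (simp add: G_def)
    show "AE t in lebesgue. 0 < t \<longrightarrow> norm (g t) \<le> G t" using AE by eventually_elim auto
    have "(\<integral>\<^sup>+ s. ennreal (G s powr P) \<partial>lborel) = (\<integral>\<^sup>+ s. ennreal (G s powr P) \<partial>lebesgue)"
      by (rule nn_integral_completion[symmetric]) measurable
    also have "\<dots> \<le> (\<integral>\<^sup>+ s. ennreal (norm (g s) powr P) * indicator {0..} s \<partial>lebesgue)"
    proof (rule nn_integral_mono_AE)
      show "AE s in lebesgue. ennreal (G s powr P) \<le> ennreal (norm (g s) powr P) * indicator {0..} s"
        using AE
      proof eventually_elim
        case (elim s)
        then show ?case by (cases "0 < s") (auto simp flip: elim)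
      qed
    qed
    also have "\<dots> = (\<integral>\<^sup>+ t. ennreal (norm (g t) powr P) \<partial>lebesgue_on {0..})"
      by (simp add: nn_integral_restrict_space)
    finally show "(\<integral>\<^sup>+ s. ennreal (G s powr P) \<partial>lborel) < \<infinity>" using gP by (rule le_less_trans)
  qed
qed

lemma Lp_locally_integrable:
  fixes G :: "real \<Rightarrow> real"
  assumes Gm[measurable]: "G \<in> borel_measurable borel" and G0: "\<And>t. 0 \<le> G t" and P: "1 \<le> P"
    and GP: "(\<integral>\<^sup>+ s. ennreal (G s powr P) \<partial>lborel) < \<infinity>" and ab: "a \<le> b"
  shows "set_integrable lebesgue {a..b} G"
    and "(LINT s:{a..b}|lebesgue. G s) \<le> (b - a) + enn2real (\<integral>\<^sup>+ s. ennreal (G s powr P) \<partial>lborel)"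
proof -
  define I where "I = enn2real (\<integral>\<^sup>+ s. ennreal (G s powr P) \<partial>lborel)"
  have I: "(\<integral>\<^sup>+ s. ennreal (G s powr P) \<partial>lborel) = ennreal I" using GP by (simp add: I_def ennreal_enn2real)
  have le: "G s \<le> 1 + G s powr P" for s using le_scale_plus_power[OF G0[of s], of 1 P] P by simp
  have "(\<integral>\<^sup>+ s. ennreal (indicator {a..b} s *\<^sub>R G s) \<partial>lborel) \<le> (\<integral>\<^sup>+ s. indicator {a..b} s + ennreal (G s powr P) \<partial>lborel)"
    using le G0 by (intro nn_integral_mono) (auto simp: indicator_def ennreal_plus[symmetric] ennreal_leI simp del: ennreal_plus simp flip: ennreal_1)
  also have "\<dots> = ennreal (b - a) + ennreal I"
    using ab by (simp add: nn_integral_add I)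
  also have "\<dots> = ennreal (b - a + I)" using ab by (simp add: I_def ennreal_plus)
  finally have nn: "(\<integral>\<^sup>+ s. ennreal (indicator {a..b} s *\<^sub>R G s) \<partial>lborel) \<le> ennreal (b - a + I)" .
  have int: "integrable lborel (\<lambda>s. indicator {a..b} s *\<^sub>R G s)"
    by (rule integrableI_nonneg) (use G0 nn in \<open>auto intro: le_less_trans\<close>)
  then show "set_integrable lebesgue {a..b} G" by (simp add: set_integrable_def integrable_completion)
  have "ennreal (LINT s:{a..b}|lebesgue. G s) = (\<integral>\<^sup>+ s. ennreal (indicator {a..b} s *\<^sub>R G s) \<partial>lborel)"
  proof -
    have "(LINT s:{a..b}|lebesgue. G s) = (LINT s|lborel. indicator {a..b} s *\<^sub>R G s)"
      unfolding set_lebesgue_integral_def by (rule integral_completion) measurable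
    then show ?thesis using nn_integral_eq_integral[OF int] G0 by simp
  qed
  with nn have "ennreal (LINT s:{a..b}|lebesgue. G s) \<le> ennreal (b - a + I)" by simp
  moreover have "0 \<le> b - a + I" using ab by (simp add: I_def)
  ultimately have "(LINT s:{a..b}|lebesgue. G s) \<le> b - a + I" by (simp only: ennreal_le_iff)
  then show "(LINT s:{a..b}|lebesgue. G s) \<le> (b - a) + enn2real (\<integral>\<^sup>+ s. ennreal (G s powr P) \<partial>lborel)"
    unfolding I_def .
qed

theorem theorem1p5:
  fixes f F :: "real \<Rightarrow> 'x::complex_banach"
    and M K :: "real \<Rightarrow> real"
    and m :: nat and p :: ennreal
  assumes "1 \<le> m" and "1 < p"
    and "loc_integrable {0..} f"
    and "\<exists>g. weak_derivative {0<..} m f g \<and> in_Lp p (lebesgue_on {0..}) g"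
    and "\<forall>s\<ge>0. 2 \<le> M s" and "continuous_on {0..} M" and "mono_on {0..} M"
    and "\<forall>s\<ge>0. 2 \<le> K s" and "continuous_on {0..} K" and "mono_on {0..} K"
    and "\<forall>s>1. max s (M s) \<le> K s"
    and "\<exists>\<epsilon>. 0 < \<epsilon> \<and> \<epsilon> < 1 \<and> K \<in> O[at_top](\<lambda>s. exp (exp ((s * M s) powr (1 - \<epsilon>))))"
    and "is_fourier_transform f F" and "smooth F"
    and "\<forall>j s. norm (nderiv j F s) \<le> fact j * K \<bar>s\<bar> * M \<bar>s\<bar> ^ j"
  shows "\<exists>c\<^sub>1>0. in_Lp p (lebesgue_on {0..})
           (\<lambda>t. norm (weight (M_log M K) (c\<^sub>1 * t) ^ m *\<^sub>R f t))"
proof -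
  have rates: "rates M K"
    using assms(5-11) by unfold_locales auto
  obtain g where g: "weak_derivative {0<..} m f g" "in_Lp p (lebesgue_on {0..}) g" using assms(4) by blast
  have bound: "\<And>j s. norm (nderiv j F s) \<le> fact j * K \<bar>s\<bar> * M \<bar>s\<bar> ^ j" using assms(15) by blast
  show ?thesis
  proof (cases "p = \<infinity>")
    case True
    obtain C where "AE t in lebesgue_on {0..}. norm (g t) \<le> C" using g(2) True by (auto simp: in_Lp_def)
    then have C: "AE t in lebesgue. t \<in> {0..} \<longrightarrow> norm (g t) \<le> C" by (subst (asm) AE_restrict_space_iff) auto
    \<comment> \<open>With a constant majorant every window is at most a multiple of its mass.\<close>
    define G where "G t = \<bar>C\<bar>" for t :: real
    interpret vector_valued m f g G "\<bar>C\<bar> * (real m + 1)"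
    proof
      show "AE t in lebesgue. 0 < t \<longrightarrow> norm (g t) \<le> G t"
        using C by eventually_elim (auto simp: G_def)
      show "set_integrable lebesgue {- b..b} G" for b
        unfolding G_def by (rule absolutely_integrable_continuous_real) (rule continuous_on_const)
      show "(LINT s:{t..t + real m + 1}|lebesgue. G s) \<le> \<bar>C\<bar> * (real m + 1)" if "0 < t" for t
        by (simp add: G_def set_lebesgue_integral_def mult.commute)
    qed (use assms g in \<open>simp_all add: G_def[abs_def]\<close>)
    obtain c A B n r D where c: "0 < (c::real)" "0 \<le> (A::real)" "0 \<le> (B::real)"
      "\<forall>i\<ge>n. AE t in lebesgue. t \<in> dyadic (Suc i) \<longrightarrow>
        ennreal (norm (weight (M_log M K) (c * t) ^ m *\<^sub>R f t)) \<le> ennreal A * window m G (r i) t + ennreal (B / t ^ 2)"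
      "AE t in lebesgue. t \<in> {0..2 ^ Suc n} \<longrightarrow> norm (weight (M_log M K) (c * t) ^ m *\<^sub>R f t) \<le> D"
      by (rule weighted_window_bound[OF rates assms(13,14) bound])
    have "AE t in lebesgue. \<forall>i\<ge>n. t \<in> dyadic (Suc i) \<longrightarrow>
        ennreal (norm (weight (M_log M K) (c * t) ^ m *\<^sub>R f t)) \<le> ennreal A * window m G (r i) t + ennreal (B / t ^ 2)"
      using c(4) by (simp add: AE_all_countable)
    with c(5) have "AE t in lebesgue. t \<in> {0..} \<longrightarrow> norm (weight (M_log M K) (c * t) ^ m *\<^sub>R f t) \<le> max D (A * (window_mass m * \<bar>C\<bar>) + B)"
    proof eventually_elim
      case (elim t)
      show ?case
      proof
        assume t: "t \<in> {0..}"
        show "norm (weight (M_log M K) (c * t) ^ m *\<^sub>R f t) \<le> max D (A * (window_mass m * \<bar>C\<bar>) + B)"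
        proof (cases "t \<le> 2 ^ Suc n")
          case True
          then show ?thesis using elim(1) t by simp
        next
          case False
          then have "2 ^ Suc n \<le> t" by simp
          then obtain j where j: "Suc n \<le> j" "t \<in> dyadic j" by (rule dyadic_cover)
          then obtain i where i: "j = Suc i" "n \<le> i" by (cases j) auto
          have "(1::real) \<le> 2 ^ Suc i" by (rule one_le_power) simp
          then have t1: "1 \<le> t" using j(2) unfolding i(1) dyadic_def by simp
          have "window m G (r i) t \<le> ennreal (window_mass m * \<bar>C\<bar>) + ennreal 0 * window m (\<lambda>_. 0) (r i) t"
            by (rule window_mono_affine) (simp_all add: G_def[abs_def])
          then have w: "window m G (r i) t \<le> ennreal (window_mass m * \<bar>C\<bar>)" by simp
          have "ennreal (norm (weight (M_log M K) (c * t) ^ m *\<^sub>R f t)) \<le> ennreal A * window m G (r i) t + ennreal (B / t ^ 2)"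
            using elim(2) i j by blast
          also have "\<dots> \<le> ennreal A * ennreal (window_mass m * \<bar>C\<bar>) + ennreal B"
          proof (intro add_mono mult_left_mono w ennreal_leI)
            have "B / t ^ 2 \<le> B / 1" using t1 c(3) by (intro divide_left_mono) auto
            then show "B / t ^ 2 \<le> B" by simp
          qed simp
          also have "\<dots> = ennreal (A * (window_mass m * \<bar>C\<bar>) + B)"
            using c window_mass_nonneg[of m] by (simp add: ennreal_mult' ennreal_plus)
          finally have "norm (weight (M_log M K) (c * t) ^ m *\<^sub>R f t) \<le> A * (window_mass m * \<bar>C\<bar>) + B"
            using c window_mass_nonneg[of m] by (subst (asm) ennreal_le_iff) auto
          then show ?thesis by simp
        qed
      qed
    qed
    then have "AE t in lebesgue_on {0..}. norm (norm (weight (M_log M K) (c * t) ^ m *\<^sub>R f t)) \<le> max D (A * (window_mass m * \<bar>C\<bar>) + B)"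
      by (subst AE_restrict_space_iff) auto
    then have "in_Lp p (lebesgue_on {0..}) (\<lambda>t. norm (weight (M_log M K) (c * t) ^ m *\<^sub>R f t))"
      unfolding in_Lp_def using True strongly_measurable_real[OF weighted_measurable[OF rates]] by auto
    with c(1) show ?thesis by blast
  next
    case False
    define P where "P = enn2real p"
    have P: "1 \<le> P"
    proof -
      have "p = ennreal P" using False by (simp add: P_def ennreal_enn2real less_top)
      then have "1 < ennreal P" using assms(2) by simp
      then show ?thesis by (simp add: ennreal_less_iff flip: ennreal_1)
    qed
    have gP: "(\<integral>\<^sup>+ t. ennreal (norm (g t) powr P) \<partial>lebesgue_on {0..}) < \<infinity>"
      using g(2) False by (simp add: in_Lp_def P_def)
    have "loc_integrable {0<..} g" using g(1) by (simp add: weak_derivative_def)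
    then have "g \<in> borel_measurable (lebesgue_on {0<..})"
      by (rule loc_integrable_regular(1)[OF _ open_halfline_union]) simp
    then have "(\<lambda>t. norm (g t)) \<in> borel_measurable (lebesgue_on {0<..})"
      by (rule measurable_compose[OF _ borel_measurable_continuous_onI[OF continuous_on_norm[OF continuous_on_id]]])
    from Lp_majorant[OF this P gP] obtain G where G: "G \<in> borel_measurable borel" "\<And>t. 0 \<le> G t"
      "AE t in lebesgue. 0 < t \<longrightarrow> norm (g t) \<le> G t" and GP: "(\<integral>\<^sup>+ s. ennreal (G s powr P) \<partial>lborel) < \<infinity>" by blast
    note loc = Lp_locally_integrable[OF G(1,2) P GP]
    interpret vector_valued m f g G "real m + 1 + enn2real (\<integral>\<^sup>+ s. ennreal (G s powr P) \<partial>lborel)"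
    proof
      show "set_integrable lebesgue {- b..b} G" for b
      proof (cases "- b \<le> b")
        case False
        then have "{- b..b} = {}" by auto
        then show ?thesis by (simp add: set_integrable_def)
      qed (rule loc(1))
      show "(LINT s:{t..t + real m + 1}|lebesgue. G s) \<le> real m + 1 + enn2real (\<integral>\<^sup>+ s. ennreal (G s powr P) \<partial>lborel)" if "0 < t" for t
        using loc(2)[of t "t + real m + 1"] by simp
    qed (use assms g G in simp_all)
    obtain c A B n r D where c: "0 < (c::real)" "0 \<le> (A::real)" "0 \<le> (B::real)"
      "\<forall>i\<ge>n. AE t in lebesgue. t \<in> dyadic (Suc i) \<longrightarrow>
        ennreal (norm (weight (M_log M K) (c * t) ^ m *\<^sub>R f t)) \<le> ennreal A * window m G (r i) t + ennreal (B / t ^ 2)"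
      "AE t in lebesgue. t \<in> {0..2 ^ Suc n} \<longrightarrow> norm (weight (M_log M K) (c * t) ^ m *\<^sub>R f t) \<le> D"
      by (rule weighted_window_bound[OF rates assms(13,14) bound])
    define x where "x t = norm (weight (M_log M K) (c * t) ^ m *\<^sub>R f t)" for t
    have large: "(\<integral>\<^sup>+ t. ennreal (x t powr P) * indicator {2 ^ Suc n..} t \<partial>lebesgue) < \<infinity>"
    proof (rule Lp_from_windows[OF G(1,2) P GP _ c(2,3)])
      show "0 \<le> x t" for t by (simp add: x_def)
      show "AE t in lebesgue. t \<in> dyadic (Suc i) \<longrightarrow> ennreal (x t) \<le> ennreal A * window m G (r i) t + ennreal (B / t ^ 2)"
        if "n \<le> i" for i using c(4)[rule_format, OF that] unfolding x_def .
    qed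
    have xm: "(\<lambda>t. ennreal (x t powr P) * indicator {2 ^ Suc n..} t) \<in> borel_measurable lebesgue"
    proof -
      have "x \<in> borel_measurable (lebesgue_on {0..})" unfolding x_def by (rule weighted_measurable[OF rates])
      then have "x \<in> borel_measurable (lebesgue_on {2 ^ Suc n..})"
        by (rule measurable_restrict_mono) auto
      then have "(\<lambda>t. ennreal (x t powr P)) \<in> borel_measurable (lebesgue_on {2 ^ Suc n..})" by measurable
      then show ?thesis by (subst (asm) borel_measurable_restrict_space_iff_ennreal) auto
    qed
    have "(\<integral>\<^sup>+ t. ennreal (norm (x t) powr P) \<partial>lebesgue_on {0..}) = (\<integral>\<^sup>+ t. ennreal (x t powr P) * indicator {0..} t \<partial>lebesgue)"
      by (simp add: nn_integral_restrict_space x_def)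
    also have "\<dots> \<le> (\<integral>\<^sup>+ t. ennreal (\<bar>D\<bar> powr P) * indicator {0..2 ^ Suc n} t + ennreal (x t powr P) * indicator {2 ^ Suc n..} t \<partial>lebesgue)"
    proof (rule nn_integral_mono_AE)
      show "AE t in lebesgue. ennreal (x t powr P) * indicator {0..} t \<le> ennreal (\<bar>D\<bar> powr P) * indicator {0..2 ^ Suc n} t + ennreal (x t powr P) * indicator {2 ^ Suc n..} t"
        using c(5)
      proof eventually_elim
        case (elim t)
        show ?case
        proof (cases "t \<in> {0..2 ^ Suc n}")
          case True
          then have "x t \<le> \<bar>D\<bar>" using elim by (simp add: x_def)
          then have "x t powr P \<le> \<bar>D\<bar> powr P" using P by (intro powr_mono2) (auto simp: x_def)
          then have "ennreal (x t powr P) \<le> ennreal (\<bar>D\<bar> powr P)" by (rule ennreal_leI)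
          then show ?thesis using True by (simp add: add_increasing2)
        next
          case False
          then show ?thesis by (auto simp: indicator_def)
        qed
      qed
    qed
    also have "\<dots> = ennreal (\<bar>D\<bar> powr P) * ennreal (2 ^ Suc n) + (\<integral>\<^sup>+ t. ennreal (x t powr P) * indicator {2 ^ Suc n..} t \<partial>lebesgue)"
    proof -
      have "(\<lambda>t::real. ennreal (\<bar>D\<bar> powr P) * indicator {0..2 ^ Suc n} t) \<in> borel_measurable lebesgue"
        by (intro borel_measurable_times_ennreal borel_measurable_const borel_measurable_indicator) simp
      note add = nn_integral_add[OF this xm]
      have "(\<integral>\<^sup>+ t. ennreal (\<bar>D\<bar> powr P) * indicator {0..2 ^ Suc n::real} t \<partial>lebesgue) = ennreal (\<bar>D\<bar> powr P) * emeasure lebesgue {0..2 ^ Suc n::real}"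
        by (rule nn_integral_cmult_indicator) simp
      also have "emeasure lebesgue {0..2 ^ Suc n::real} = ennreal (2 ^ Suc n)"
        using emeasure_lborel_Icc[of 0 "2 ^ Suc n::real"] by simp
      finally show ?thesis unfolding add by (rule arg_cong2[where f = "(+)"]) (rule refl)
    qed
    also have "\<dots> < \<infinity>" using large by (simp add: ennreal_mult_less_top)
    finally have "(\<integral>\<^sup>+ t. ennreal (norm (x t) powr enn2real p) \<partial>lebesgue_on {0..}) < \<infinity>" by (simp add: P_def)
    then have "in_Lp p (lebesgue_on {0..}) x"
      unfolding in_Lp_def using False strongly_measurable_real[OF weighted_measurable[OF rates], of c, folded x_def] by simp
    with c(1) show ?thesis unfolding x_def by (intro exI[of _ c] conjI)
  qed
qed

end
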